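(* Let $h_1,\dots,h_p\in\mathbb{R}[x_1,\dots,x_n]$ and let $X=\{v\in\mathbb{R}^n : h_1(v)=\cdots=h_p(v)=0\}$. Suppose that $X$ is irreducible, smooth and compact in $\mathbb{R}^n$. For $c=(c_1,\dots,c_n)\in\mathbb{R}^n$ let $c_0^*=c_0^*(c)=\min_{x\in X}\langle c,x\rangle$ be the optimal value function, and let $\Phi(c_0,c_1,\dots,c_n)$ be a nonzero polynomial of least possible degree with $\Phi(c_0^*(c),c_1,\dots,c_n)=0$ for all $c\in\mathbb{R}^n$. Let $X^*\subset(\mathbb{P}^n)^*$ be the dual variety to the projective closure of $X$. Then $X^*$ is an irreducible hypersurface, and its defining polynomial equals $\Phi(-c_0,c_1,\dots,c_n)$ (up to a nonzero constant factor). In particular, the algebraic degree of the problem of minimizing $\langle c,x\rangle$ subject to $x\in X$ is the degree in $c_0$ of the irreducible polynomial that vanishes on the dual hypersurface $X^*$.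
   Context: Here $\langle c,x\rangle=c_1x_1+\cdots+c_nx_n$. The coefficients $c_1,\dots,c_n$ are regarded as parameters, so $c_0^*$ is a function $\mathbb{R}^n\to\mathbb{R}$; since it is semialgebraic, a nonzero polynomial $\Phi$ in $n+1$ variables with $\Phi(c_0^*,c_1,\dots,c_n)=0$ exists. The algebraic degree of the optimization problem is the degree in the unknown $c_0$ of such a $\Phi$ of least possible degree. $\mathbb{P}^n$ denotes complex projective space with coordinates $(x_0:x_1:\cdots:x_n)$; $\mathbb{R}^n$ is embedded via $x\mapsto(1:x)$, and the projective closure of $X$ is its Zariski closure in $\mathbb{P}^n$. Irreducible varieties are nonempty by convention. A point of a projective variety $Z\subset\mathbb{P}^n$ of codimension $c$ is singular if all $c\times c$ minors of the Jacobian matrix of a set of generators of the homogeneous ideal of $Z$ vanish there; otherwise it is regular, and $Z_{\rm reg}$ denotes the set of regular points. "$X$ is smooth" means that every point of $X\subset\mathbb{R}^n$ is a regular point (of the projective closure of $X$). A point $(u_0:\cdots:u_n)$ of the dual projective space $(\mathbb{P}^n)^*$ represents the hyperplane $\{x\in\mathbb{P}^n:\sum_{i=0}^n u_ix_i=0\}$. This hyperplane is tangent to $Z$ at a regular point $x\in Z_{\rm reg}$ if it contains $x$ and the vector $u$ lies in the row space of the Jacobian matrix of $Z$ at $x$ (equivalently, the hyperplane contains the embedded tangent space of $Z$ at $x$). The dual variety $Z^*\subset(\mathbb{P}^n)^*$ is the Zariski closure of the set of all hyperplanes that are tangent to $Z$ at some regular point. The coordinates on $(\mathbb{P}^n)^*$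 are denoted $(c_0:c_1:\cdots:c_n)$, so that a pair (objective vector $c$, value $c_0^*$), i.e. the affine hyperplane $\langle c,x\rangle=c_0^*$, corresponds to the point $(-c_0^*:c_1:\cdots:c_n)$. *)

theory Defs
  imports "HOL-Analysis.Analysis" "HOL-Library.Poly_Mapping"
    "HOL-Computational_Algebra.Factorial_Ring"
begin

section \<open>Multivariate polynomials\<close>

text \<open>A monomial is a finitely supported exponent vector, and a polynomial is a finitely supported
  coefficient function on monomials. The ring operations are those of \<^theory>\<open>HOL-Library.Poly_Mapping\<close>
  (multiplication is convolution).\<close>

type_synonym ('v, 'a) mpoly = "('v \<Rightarrow>\<^sub>0 nat) \<Rightarrow>\<^sub>0 'a"

definition Const :: "'a::zero \<Rightarrow> ('v, 'a) mpoly"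
  where "Const a = Poly_Mapping.single 0 a"

definition Var :: "'v \<Rightarrow> ('v, 'a::zero_neq_one) mpoly"
  where "Var i = Poly_Mapping.single (Poly_Mapping.single i 1) 1"

text \<open>Substitution of \<open>\<sigma> i\<close> for the variable \<open>i\<close>, with the coefficients transported along \<open>\<phi>\<close>.\<close>

definition poly_subst ::
    "('a::zero \<Rightarrow> 'b::comm_semiring_1) \<Rightarrow> ('v \<Rightarrow> 'b) \<Rightarrow> ('v, 'a) mpoly \<Rightarrow> 'b"
  where "poly_subst \<phi> \<sigma> f =
    (\<Sum>m\<in>Poly_Mapping.keys f. \<phi> (Poly_Mapping.lookup f m) *
       (\<Prod>i\<in>Poly_Mapping.keys m. \<sigma> i ^ Poly_Mapping.lookup m i))"

definition peval :: "('v \<Rightarrow> 'a) \<Rightarrow> ('v, 'a::comm_semiring_1) mpoly \<Rightarrow> 'a"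
  where "peval x f = poly_subst (\<lambda>a. a) x f"

definition poly_vars :: "('v, 'a::zero) mpoly \<Rightarrow> 'v set"
  where "poly_vars f = (\<Union>m\<in>Poly_Mapping.keys f. Poly_Mapping.keys m)"

definition monom_degree :: "('v \<Rightarrow>\<^sub>0 nat) \<Rightarrow> nat"
  where "monom_degree m = (\<Sum>i\<in>Poly_Mapping.keys m. Poly_Mapping.lookup m i)"

text \<open>Both degrees are \<open>0\<close> for the zero polynomial.\<close>

definition total_degree :: "('v, 'a::zero) mpoly \<Rightarrow> nat"
  where "total_degree f = Max (insert 0 (monom_degree ` Poly_Mapping.keys f))"

definition degree_in :: "'v \<Rightarrow> ('v, 'a::zero) mpoly \<Rightarrow> nat"
  where "degree_in i f = Max (insert 0 ((\<lambda>m. Poly_Mapping.lookup m i) ` Poly_Mapping.keys f))"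

definition homogeneous :: "('v, 'a::zero) mpoly \<Rightarrow> bool"
  where "homogeneous f \<longleftrightarrow> (\<exists>d. \<forall>m\<in>Poly_Mapping.keys f. monom_degree m = d)"

text \<open>Formal partial derivative. Exponent vectors are subtracted with truncation; this is harmless,
  as the coefficient \<open>of_nat (lookup m i)\<close> is \<open>0\<close> when the variable \<open>i\<close> does not occur in \<open>m\<close>.\<close>

definition partial_deriv :: "'v \<Rightarrow> ('v, 'a::comm_semiring_1) mpoly \<Rightarrow> ('v, 'a) mpoly"
  where "partial_deriv i f =
    (\<Sum>m\<in>Poly_Mapping.keys f. Poly_Mapping.single (m - Poly_Mapping.single i 1)
                    (of_nat (Poly_Mapping.lookup m i) * Poly_Mapping.lookup f m))"

definition gradient :: "('m, 'a::comm_semiring_1) mpoly \<Rightarrow> 'a ^ 'm \<Rightarrow> 'a ^ 'm"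
  where "gradient f x = (\<chi> i. peval (($) x) (partial_deriv i f))"


section \<open>Varieties\<close>

text \<open>Algebraic subsets of real affine space.\<close>

definition real_variety :: "(real ^ 'n) set \<Rightarrow> bool"
  where "real_variety X \<longleftrightarrow>
    (\<exists>F :: ('n, real) mpoly set. X = {x. \<forall>f\<in>F. peval (($) x) f = 0})"

text \<open>A subset of complex projective space is represented by the set of all homogeneous coordinate
  vectors of its points, that is, by a set of nonzero vectors. The coordinates are indexed by a finite
  type \<open>'m\<close>, so that the ambient projective space has dimension \<open>CARD('m) - 1\<close>.\<close>

definition projective_variety :: "(complex ^ 'm) set \<Rightarrow> bool"
  where "projective_variety Z \<longleftrightarrow>
    (\<exists>F :: ('m, complex) mpoly set. (\<forall>f\<in>F. homogeneous f) \<and>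
       Z = {x. x \<noteq> 0 \<and> (\<forall>f\<in>F. peval (($) x) f = 0)})"

text \<open>Irreducibility of a closed set, relative to the family \<open>V\<close> of closed sets.\<close>

definition irreducible_variety :: "('p set \<Rightarrow> bool) \<Rightarrow> 'p set \<Rightarrow> bool"
  where "irreducible_variety V Z \<longleftrightarrow>
    V Z \<and> Z \<noteq> {} \<and> (\<forall>A B. V A \<longrightarrow> V B \<longrightarrow> Z = A \<union> B \<longrightarrow> Z = A \<or> Z = B)"

definition zariski_closure :: "(complex ^ 'm) set \<Rightarrow> (complex ^ 'm) set"
  where "zariski_closure S = projective_variety hull S"

text \<open>The homogeneous ideal of \<open>Z\<close>: the polynomials that vanish at every choice of homogeneous
  coordinates of every point of \<open>Z\<close>.\<close>

definition vanishing_ideal :: "(complex ^ 'm) set \<Rightarrow> ('m, complex) mpoly set"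
  where "vanishing_ideal Z = {f. \<forall>x\<in>Z. peval (($) x) f = 0}"

text \<open>The dimension of a projective variety is the transcendence degree of its homogeneous coordinate
  ring minus one. Below, \<open>f 0, \<dots>, f (k - 1)\<close> are algebraically independent modulo the vanishing
  ideal of \<open>Z\<close>: the only polynomial relation \<open>P\<close> among them that holds identically on \<open>Z\<close> is \<open>P = 0\<close>.\<close>

definition coord_ring_trdeg :: "(complex ^ 'm) set \<Rightarrow> nat"
  where "coord_ring_trdeg Z =
    Sup {k. \<exists>f :: nat \<Rightarrow> ('m, complex) mpoly. \<forall>P :: (nat, complex) mpoly.
           poly_vars P \<subseteq> {..<k} \<longrightarrow>
           (\<forall>x\<in>Z. peval (\<lambda>j. peval (($) x) (f j)) P = 0) \<longrightarrow> P = 0}"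

definition codimension :: "(complex ^ 'm) set \<Rightarrow> nat"
  where "codimension Z = CARD('m) - coord_ring_trdeg Z"

definition irreducible_hypersurface :: "(complex ^ 'm) set \<Rightarrow> bool"
  where "irreducible_hypersurface Z \<longleftrightarrow>
    irreducible_variety projective_variety Z \<and> codimension Z = 1"

text \<open>\<open>F\<close> generates the homogeneous ideal of \<open>Z\<close>.\<close>

definition defining_polynomial :: "('m, complex) mpoly \<Rightarrow> (complex ^ 'm) set \<Rightarrow> bool"
  where "defining_polynomial F Z \<longleftrightarrow> vanishing_ideal Z = {G. F dvd G}"


section \<open>Regular points and dual varieties\<close>

text \<open>The \<open>c \<times> c\<close> minor at \<open>x\<close> of the Jacobian matrix with rows \<open>r 0, \<dots>, r (c - 1)\<close> and columns
  \<open>s 0, \<dots>, s (c - 1)\<close>, by the Leibniz formula. Repeated rows or columns give the value \<open>0\<close>, and the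
  minor of size \<open>0\<close> is \<open>1\<close>.\<close>

definition jacobian_minor ::
    "nat \<Rightarrow> (nat \<Rightarrow> ('m, complex) mpoly) \<Rightarrow> (nat \<Rightarrow> 'm) \<Rightarrow> complex ^ 'm \<Rightarrow> complex"
  where "jacobian_minor c r s x =
    (\<Sum>\<pi> | \<pi> permutes {..<c}. of_int (sign \<pi>) * (\<Prod>j<c. gradient (r j) x $ s (\<pi> j)))"

text \<open>As the set of generators of the homogeneous ideal we take the whole ideal. At a point of \<open>Z\<close>
  neither the row space of the Jacobian nor the vanishing of all its \<open>c \<times> c\<close> minors depends on the
  set of generators, because the gradient of \<open>\<Sum>j. g j * f j\<close> at a common zero of the \<open>f j\<close> is a linear
  combination of their gradients.\<close>

definition singular_point :: "(complex ^ 'm) set \<Rightarrow> complex ^ 'm \<Rightarrow> bool"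
  where "singular_point Z x \<longleftrightarrow> x \<in> Z \<and>
    (\<forall>r s. (\<forall>j < codimension Z. r j \<in> vanishing_ideal Z) \<longrightarrow>
           jacobian_minor (codimension Z) r s x = 0)"

definition regular_points :: "(complex ^ 'm) set \<Rightarrow> (complex ^ 'm) set"
  where "regular_points Z = {x \<in> Z. \<not> singular_point Z x}"

definition jacobian_row_space :: "(complex ^ 'm) set \<Rightarrow> complex ^ 'm \<Rightarrow> (complex ^ 'm) set"
  where "jacobian_row_space Z x = vec.span ((\<lambda>f. gradient f x) ` vanishing_ideal Z)"

text \<open>The hyperplane with coordinate vector \<open>u \<noteq> 0\<close> is tangent to \<open>Z\<close> at the point \<open>x\<close>. The pairing
  is bilinear, not Hermitian.\<close>

definition tangent_hyperplane :: "(complex ^ 'm) set \<Rightarrow> complex ^ 'm \<Rightarrow> complex ^ 'm \<Rightarrow> bool"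
  where "tangent_hyperplane Z x u \<longleftrightarrow>
    u \<noteq> 0 \<and> (\<Sum>i\<in>UNIV. u $ i * x $ i) = 0 \<and> u \<in> jacobian_row_space Z x"

definition dual_variety :: "(complex ^ 'm) set \<Rightarrow> (complex ^ 'm) set"
  where "dual_variety Z = zariski_closure {u. \<exists>x\<in>regular_points Z. tangent_hyperplane Z x u}"


section \<open>The optimization problem\<close>

text \<open>The coordinates of real affine space are indexed by \<open>'n\<close>, those of projective space by
  \<open>'n option\<close>: \<open>None\<close> is the index \<open>0\<close>, and \<open>Some i\<close> is the affine index \<open>i\<close>.\<close>

definition embed :: "real ^ 'n \<Rightarrow> complex ^ 'n option"
  where "embed x = (\<chi> i. case i of None \<Rightarrow> 1 | Some j \<Rightarrow> complex_of_real (x $ j))"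

definition projective_closure :: "(real ^ 'n) set \<Rightarrow> (complex ^ 'n option) set"
  where "projective_closure X = zariski_closure (embed ` X)"

definition smooth_variety :: "(real ^ 'n) set \<Rightarrow> bool"
  where "smooth_variety X \<longleftrightarrow> embed ` X \<subseteq> regular_points (projective_closure X)"

text \<open>The least element of the set of values of the objective function, that is, its minimum on \<open>X\<close>.\<close>

definition optimal_value :: "(real ^ 'n) set \<Rightarrow> real ^ 'n \<Rightarrow> real"
  where "optimal_value X c = (LEAST t. t \<in> (\<lambda>x. c \<bullet> x) ` X)"

definition vanishes_on_optimal_value :: "(real ^ 'n) set \<Rightarrow> ('n option, real) mpoly \<Rightarrow> bool"
  where "vanishes_on_optimal_value X \<Phi> \<longleftrightarrow>
    (\<forall>c. peval (\<lambda>i. case i of None \<Rightarrow> optimal_value X c | Some j \<Rightarrow> c $ j) \<Phi> = 0)"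

definition optimal_value_polynomial :: "(real ^ 'n) set \<Rightarrow> ('n option, real) mpoly \<Rightarrow> bool"
  where "optimal_value_polynomial X \<Phi> \<longleftrightarrow>
    is_arg_min total_degree (\<lambda>\<Psi>. \<Psi> \<noteq> 0 \<and> vanishes_on_optimal_value X \<Psi>) \<Phi>"

text \<open>The degree in \<open>c\<^sub>0\<close> of a polynomial \<open>\<Phi>\<close> of least total degree, which is unique up to a nonzero
  constant in the situation of interest.\<close>

definition algebraic_degree :: "(real ^ 'n) set \<Rightarrow> nat"
  where "algebraic_degree X = degree_in None (SOME \<Phi>. optimal_value_polynomial X \<Phi>)"

text \<open>The polynomial \<open>\<Phi>(-c\<^sub>0, c\<^sub>1, \<dots>, c\<^sub>n)\<close>, with coefficients regarded as complex numbers.\<close>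

definition flip_sign :: "('n option, real) mpoly \<Rightarrow> ('n option, complex) mpoly"
  where "flip_sign \<Phi> =
    poly_subst (\<lambda>a. Const (complex_of_real a))
      (\<lambda>i. case i of None \<Rightarrow> - Var None | Some j \<Rightarrow> Var (Some j)) \<Phi>"

end

theory Submission
  imports Defs "HOL-Computational_Algebra.Polynomial"
begin

text \<open>Let \<open>I\<close> be the homogeneous ideal of the projective closure of \<open>X\<close>; it is prime as \<open>X\<close> is
  irreducible. The ideal of the dual variety is the set \<open>J\<close> of all \<open>G\<close> such that \<open>G\<close> composed with
  the gradient of \<open>g\<close> lies in \<open>I\<close> for every \<open>g \<in> I\<close>; it is prime as well, because \<open>I\<close> is a vector
  space. Counting monomials modulo \<open>I\<close> shows \<open>J \<noteq> 0\<close>.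

  If \<open>x\<close> minimizes \<open>\<langle>c, \<cdot>\<rangle>\<close> on \<open>X\<close>, then the hyperplane through \<open>x\<close> with normal vector \<open>c\<close> is tangent
  at \<open>x\<close>: at a regular point every tangent vector is the value of a polynomial vector field that maps
  \<open>I\<close> into \<open>I\<close>, and the power series solving the corresponding differential equation is a curve in
  \<open>X\<close> with that velocity. Hence \<open>J\<close> vanishes on the graph \<open>\<Gamma>\<close> of the optimal value function, and as
  \<open>\<Gamma>\<close> projects onto all of \<open>\<real>\<^sup>n\<close>, no nonzero element of \<open>J\<close> is free of \<open>c\<^sub>0\<close>.

  A nonzero \<open>F \<in> J\<close> of least degree is irreducible, hence prime. If \<open>G\<close> vanishes on \<open>\<Gamma>\<close> but is not
  divisible by \<open>F\<close>, eliminating \<open>c\<^sub>0\<close> from \<open>F\<close> and \<open>G\<close> gives a nonzero polynomial in \<open>c\<close> alone that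
  vanishes on \<open>\<Gamma>\<close>, which is impossible. So \<open>J\<close> consists of the multiples of \<open>F\<close> and is also the ideal
  of \<open>\<Gamma>\<close>.\<close>


section \<open>Substitution and induction\<close>

text \<open>Two obstacles shape the proof. First, the hypotheses concern real points and the
  conclusion complex varieties. The argument is carried by the explicit cone of all nonzero complex
  multiples of the vectors \<open>(1, x)\<close> with \<open>x\<close> in \<open>X\<close>. It has
  the ideal of the projective closure, and this ideal is stable under conjugation, so the gradients
  of its real members span the whole row space at a point. Second, dimension enters only through a
  set \<open>T\<close> of coordinates that are independent modulo a prime ideal. Counting shows that
  more than \<open>card T\<close> polynomials are dependent, and tangent vector fields bound the
  number of independent gradients at a general point by the number of coordinates outside
  \<open>T\<close>. A nonzero maximal minor at the minimizer supplies at least that many, so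
  finitely many members control the ideal there. For \<open>J \<noteq> 0\<close>, counting alone
  yields only a relation between the entries of a gradient and one coordinate of its point. Scaling
  the point while keeping the gradient fixed removes that coordinate.\<close>

definition coeff_hom :: "('a::comm_semiring_1 \<Rightarrow> 'b::comm_semiring_1) \<Rightarrow> bool"
  where "coeff_hom \<phi> \<longleftrightarrow> \<phi> 0 = 0 \<and> \<phi> 1 = 1 \<and> (\<forall>a b. \<phi> (a + b) = \<phi> a + \<phi> b) \<and>
    (\<forall>a b. \<phi> (a * b) = \<phi> a * \<phi> b)"

definition eval_monom :: "('v \<Rightarrow> 'b::comm_semiring_1) \<Rightarrow> ('v \<Rightarrow>\<^sub>0 nat) \<Rightarrow> 'b"
  where "eval_monom \<sigma> m = (\<Prod>i\<in>Poly_Mapping.keys m. \<sigma> i ^ Poly_Mapping.lookup m i)"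

lemma eval_monom_superset:
  assumes "finite V" "Poly_Mapping.keys m \<subseteq> V"
  shows "eval_monom \<sigma> m = (\<Prod>i\<in>V. \<sigma> i ^ Poly_Mapping.lookup m i)"
  unfolding eval_monom_def
  by (rule prod.mono_neutral_left) (use assms in \<open>auto simp: in_keys_iff\<close>)

lemma keys_monom_add: "Poly_Mapping.keys (m + m' :: 'v \<Rightarrow>\<^sub>0 nat) = Poly_Mapping.keys m \<union> Poly_Mapping.keys m'"
  by (auto simp: in_keys_iff lookup_add)

lemma eval_monom_add: "eval_monom \<sigma> (m + m') = eval_monom \<sigma> m * eval_monom \<sigma> m'"
proof -
  let ?V = "Poly_Mapping.keys m \<union> Poly_Mapping.keys m'"
  show ?thesis
    by (subst (1 2 3) eval_monom_superset[where V = ?V])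
       (auto simp: keys_monom_add lookup_add power_add prod.distrib)
qed

lemma eval_monom_0 [simp]: "eval_monom \<sigma> 0 = 1"
  by (simp add: eval_monom_def)

lemma eval_monom_single: "eval_monom \<sigma> (Poly_Mapping.single i n) = \<sigma> i ^ n"
  by (cases "n = 0") (auto simp: eval_monom_def)

lemma poly_subst_eq: "poly_subst \<phi> \<sigma> f =
    (\<Sum>m\<in>Poly_Mapping.keys f. \<phi> (Poly_Mapping.lookup f m) * eval_monom \<sigma> m)"
  by (simp add: poly_subst_def eval_monom_def)

lemma poly_subst_superset:
  assumes "\<phi> 0 = 0" "finite K" "Poly_Mapping.keys f \<subseteq> K"
  shows "poly_subst \<phi> \<sigma> f = (\<Sum>m\<in>K. \<phi> (Poly_Mapping.lookup f m) * eval_monom \<sigma> m)"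
  unfolding poly_subst_eq
  by (rule sum.mono_neutral_left) (use assms in \<open>auto simp: in_keys_iff\<close>)

lemma poly_subst_single:
  "\<phi> 0 = 0 \<Longrightarrow> poly_subst \<phi> \<sigma> (Poly_Mapping.single m a) = \<phi> a * eval_monom \<sigma> m"
  by (cases "a = 0") (auto simp: poly_subst_eq)

lemma poly_mapping_sum_single:
  "f = (\<Sum>m\<in>Poly_Mapping.keys f. Poly_Mapping.single m (Poly_Mapping.lookup f m))"
  by (rule poly_mapping_eqI)
     (auto simp: lookup_sum lookup_single when_def in_keys_iff)

lemma mpoly_sum_induct:
  fixes f :: "('v, 'a::comm_semiring_1) mpoly"
  assumes "P 0" "\<And>m a. P (Poly_Mapping.single m a)" "\<And>f g. P f \<Longrightarrow> P g \<Longrightarrow> P (f + g)"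
  shows "P f"
proof -
  have "P (\<Sum>m\<in>K. Poly_Mapping.single m (Poly_Mapping.lookup f m))" if "finite K" for K
    using that by induction (auto intro: assms)
  thus ?thesis
    by (subst poly_mapping_sum_single) simp
qed

context
  fixes \<phi> :: "'a::comm_semiring_1 \<Rightarrow> 'b::comm_semiring_1" and \<sigma> :: "'v \<Rightarrow> 'b"
  assumes hom: "coeff_hom \<phi>"
begin

lemma poly_subst_0: "poly_subst \<phi> \<sigma> 0 = 0"
  by (simp add: poly_subst_eq)

lemma poly_subst_add: "poly_subst \<phi> \<sigma> (f + g) = poly_subst \<phi> \<sigma> f + poly_subst \<phi> \<sigma> g"
proof -
  let ?K = "Poly_Mapping.keys f \<union> Poly_Mapping.keys g"
  have "\<phi> 0 = 0" "\<And>a b. \<phi> (a + b) = \<phi> a + \<phi> b"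
    using hom by (auto simp: coeff_hom_def)
  thus ?thesis
    by (subst (1 2 3) poly_subst_superset[where K = ?K])
       (auto simp: Poly_Mapping.keys_add lookup_add sum.distrib distrib_right)
qed

lemma poly_subst_mult: "poly_subst \<phi> \<sigma> (f * g) = poly_subst \<phi> \<sigma> f * poly_subst \<phi> \<sigma> g"
proof (induction f rule: mpoly_sum_induct)
  case 1
  show ?case by (simp add: poly_subst_0)
next
  case (2 m a)
  have \<phi>: "\<phi> 0 = 0" "\<And>a b. \<phi> (a * b) = \<phi> a * \<phi> b"
    using hom by (auto simp: coeff_hom_def)
  show ?case
  proof (induction g rule: mpoly_sum_induct)
    case 1
    show ?case by (simp add: poly_subst_0)
  next
    case (2 m' b)
    show ?case
      by (simp add: mult_single poly_subst_single \<phi> eval_monom_add ac_simps)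
  next
    case (3 f g)
    thus ?case by (simp add: distrib_left poly_subst_add)
  qed
next
  case (3 f g)
  thus ?case by (simp add: distrib_right poly_subst_add)
qed

lemma poly_subst_Const: "poly_subst \<phi> \<sigma> (Const a) = \<phi> a"
  using hom by (simp add: Const_def poly_subst_single coeff_hom_def)

lemma poly_subst_Var: "poly_subst \<phi> \<sigma> (Var i) = \<sigma> i"
  using hom by (simp add: Var_def poly_subst_single coeff_hom_def eval_monom_single)

end

lemma Const_0: "Const 0 = 0" and Const_1: "Const 1 = 1"
  and Const_add: "Const (a + b) = Const a + (Const b :: ('v, 'a::comm_semiring_1) mpoly)"
  and Const_mult: "Const (c * d) = Const c * (Const d :: ('v, 'a) mpoly)"
  by (auto simp: Const_def single_add mult_single)

lemma coeff_hom_Const: "coeff_hom (Const :: 'a \<Rightarrow> ('v, 'a::comm_semiring_1) mpoly)"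
  by (simp add: coeff_hom_def Const_0 Const_1 Const_add Const_mult)

lemma Const_uminus: "Const (- a) = - (Const a :: ('v, 'a::comm_ring_1) mpoly)"
  and Const_diff: "Const (a - b) = Const a - (Const b :: ('v, 'a::comm_ring_1) mpoly)"
  and Const_power: "Const (c ^ n) = (Const c :: ('v, 'a) mpoly) ^ n"
proof -
  show "Const (- a) = - (Const a :: ('v, 'a::comm_ring_1) mpoly)"
    by (simp add: Const_def single_uminus)
  show "Const (a - b) = Const a - (Const b :: ('v, 'a::comm_ring_1) mpoly)"
    by (simp add: Const_def single_diff)
  show "Const (c ^ n) = (Const c :: ('v, 'a) mpoly) ^ n"
    by (induction n) (simp_all add: Const_1 Const_mult)
qed

lemma Const_inject [simp]: "Const a = Const b \<longleftrightarrow> a = b"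
  by (metis Const_def lookup_single_eq)

lemma Const_eq_0_iff [simp]: "Const a = 0 \<longleftrightarrow> a = 0"
  by (metis Const_0 Const_inject)

lemma single_eq_eval_monom:
  fixes m :: "'v \<Rightarrow>\<^sub>0 nat"
  shows "Poly_Mapping.single m (a :: 'a::comm_semiring_1) = Const a * eval_monom Var m"
proof -
  have *: "Poly_Mapping.single i (1::'a) ^ n = Poly_Mapping.single (\<Sum>k<n. i) 1" for i :: "'v \<Rightarrow>\<^sub>0 nat" and n
    by (induction n) (auto simp: mult_single add.commute)
  have sn: "(\<Sum>k<n. Poly_Mapping.single i (1::nat)) = Poly_Mapping.single i n" for i :: 'v and n
    by (induction n) (auto simp flip: single_add)
  have prod: "(\<Prod>i\<in>A. Poly_Mapping.single (g i) (1::'a)) = Poly_Mapping.single (\<Sum>i\<in>A. g i) 1"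
    if "finite A" for A :: "'v set" and g :: "'v \<Rightarrow> ('v \<Rightarrow>\<^sub>0 nat)"
    using that by induction (auto simp: mult_single)
  have "eval_monom Var m = (Poly_Mapping.single m 1 :: ('v, 'a) mpoly)"
    unfolding eval_monom_def Var_def * sn
    by (subst prod) (auto simp flip: poly_mapping_sum_single)
  thus ?thesis by (simp add: Const_def mult_single)
qed

lemma mpoly_induct [case_names Const Var add mult]:
  fixes f :: "('v, 'a::comm_semiring_1) mpoly"
  assumes "\<And>a. P (Const a)" "\<And>i. P (Var i)"
    "\<And>f g. P f \<Longrightarrow> P g \<Longrightarrow> P (f + g)" "\<And>f g. P f \<Longrightarrow> P g \<Longrightarrow> P (f * g)"
  shows "P f"
proof (induction f rule: mpoly_sum_induct)
  case 1
  show ?case using assms(1)[of 0] by (simp add: Const_0)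
next
  case (2 m a)
  have pow: "P (Var i ^ n)" for i n
    using assms(1)[of 1] by (induction n) (auto simp: Const_1 intro: assms)
  have "P (\<Prod>i\<in>A. Var i ^ Poly_Mapping.lookup m i)" if "finite A" for A
    using that assms(1)[of 1] by induction (auto simp: Const_1 intro: assms pow)
  thus ?case unfolding single_eq_eval_monom eval_monom_def by (auto intro: assms)
next
  case (3 f g)
  thus ?case by (rule assms)
qed

lemma mpoly_hom_eqI:
  fixes F G :: "('v, 'a::comm_semiring_1) mpoly \<Rightarrow> 'b::comm_semiring_1"
  assumes "\<And>a. F (Const a) = G (Const a)" "\<And>i. F (Var i) = G (Var i)"
    "\<And>f g. F (f + g) = F f + F g" "\<And>f g. G (f + g) = G f + G g"
    "\<And>f g. F (f * g) = F f * F g" "\<And>f g. G (f * g) = G f * G g"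
  shows "F f = G f"
  by (induction f rule: mpoly_induct) (auto simp: assms)

lemma coeff_hom_id: "coeff_hom (\<lambda>a::'a::comm_semiring_1. a)"
  by (simp add: coeff_hom_def)

lemma peval_add [simp]: "peval x (f + g) = peval x f + peval x g"
  and peval_mult [simp]: "peval x (f * g) = peval x f * peval x g"
  and peval_Const [simp]: "peval x (Const a) = a"
  and peval_Var [simp]: "peval x (Var i) = x i"
  and peval_0 [simp]: "peval x 0 = 0"
  by (simp_all add: peval_def coeff_hom_id poly_subst_add poly_subst_mult poly_subst_Const
      poly_subst_Var poly_subst_0)

lemma peval_1 [simp]: "peval x 1 = 1"
  by (metis Const_1 peval_Const)

lemma peval_power [simp]: "peval x (f ^ n) = peval x f ^ n"
  by (induction n) auto

lemma peval_sum [simp]: "peval x (\<Sum>i\<in>A. f i) = (\<Sum>i\<in>A. peval x (f i))"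
  by (induction A rule: infinite_finite_induct) auto

lemma peval_prod [simp]: "peval x (\<Prod>i\<in>A. f i) = (\<Prod>i\<in>A. peval x (f i))"
  by (induction A rule: infinite_finite_induct) auto

lemma peval_uminus [simp]: "peval x (- f) = - peval x (f :: ('v, 'a::comm_ring_1) mpoly)"
  by (metis add.inverse_unique add.right_inverse peval_0 peval_add)

lemma peval_diff [simp]: "peval x (f - g) = peval x f - peval x (g :: ('v, 'a::comm_ring_1) mpoly)"
  by (metis diff_add_cancel eq_diff_eq peval_add)

section \<open>Variables of a polynomial\<close>

lemma poly_vars_0 [simp]: "poly_vars 0 = {}"
  by (simp add: poly_vars_def)

lemma poly_vars_Const [simp]: "poly_vars (Const a) = {}"
  by (auto simp: poly_vars_def Const_def split: if_splits)

lemma poly_vars_1 [simp]: "poly_vars 1 = {}"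
  by (metis Const_1 poly_vars_Const)

lemma poly_vars_Var [simp]: "poly_vars (Var i :: ('v, 'a::comm_semiring_1) mpoly) = {i}"
  by (auto simp: poly_vars_def Var_def)

lemma poly_vars_add: "poly_vars (f + g) \<subseteq> poly_vars f \<union> poly_vars g"
  using Poly_Mapping.keys_add[of f g] by (auto simp: poly_vars_def)

lemma poly_vars_mult: "poly_vars (f * g) \<subseteq> poly_vars f \<union> poly_vars g"
proof
  fix i assume "i \<in> poly_vars (f * g)"
  then obtain m where m: "m \<in> Poly_Mapping.keys (f * g)" "i \<in> Poly_Mapping.keys m"
    by (auto simp: poly_vars_def)
  then obtain a b where "m = a + b" "a \<in> Poly_Mapping.keys f" "b \<in> Poly_Mapping.keys g"
    using keys_mult[of f g] by blast
  with m(2) show "i \<in> poly_vars f \<union> poly_vars g"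
    by (auto simp: poly_vars_def keys_monom_add)
qed

lemma poly_vars_uminus [simp]: "poly_vars (- f :: ('v, 'a::comm_ring_1) mpoly) = poly_vars f"
  by (simp add: poly_vars_def in_keys_iff)

lemma finite_poly_vars [simp]: "finite (poly_vars f)"
  by (simp add: poly_vars_def)

definition polys_in :: "'v set \<Rightarrow> ('v, 'a::zero) mpoly set"
  where "polys_in S = {f. poly_vars f \<subseteq> S}"

lemma polys_in_0 [simp, intro]: "0 \<in> polys_in S"
  and polys_in_1 [simp, intro]: "(1 :: ('v, 'a::comm_semiring_1) mpoly) \<in> polys_in S"
  and polys_in_Const [simp, intro]: "Const a \<in> polys_in S"
  by (auto simp: polys_in_def)

lemma polys_in_Var [intro]: "i \<in> S \<Longrightarrow> (Var i :: ('v, 'a::comm_semiring_1) mpoly) \<in> polys_in S"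
  by (auto simp: polys_in_def)

lemma polys_in_add [intro]: "f \<in> polys_in S \<Longrightarrow> g \<in> polys_in S \<Longrightarrow> f + g \<in> polys_in S"
  using poly_vars_add[of f g] by (auto simp: polys_in_def)

lemma polys_in_mult [intro]: "f \<in> polys_in S \<Longrightarrow> g \<in> polys_in S \<Longrightarrow> f * g \<in> polys_in S"
  using poly_vars_mult[of f g] by (auto simp: polys_in_def)

lemma polys_in_power [intro]:
  "(f :: ('v, 'a::comm_semiring_1) mpoly) \<in> polys_in S \<Longrightarrow> f ^ n \<in> polys_in S"
  by (induction n) auto

lemma polys_in_uminus [intro]: "(f :: ('v, 'a::comm_ring_1) mpoly) \<in> polys_in S \<Longrightarrow> - f \<in> polys_in S"
  by (auto simp: polys_in_def)

lemma polys_in_diff [intro]: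
  "(f :: ('v, 'a::comm_ring_1) mpoly) \<in> polys_in S \<Longrightarrow> g \<in> polys_in S \<Longrightarrow> f - g \<in> polys_in S"
  using polys_in_add[OF _ polys_in_uminus, of f S g] by simp

lemma polys_in_sum [intro]:
  "(\<And>i. i \<in> A \<Longrightarrow> f i \<in> polys_in S) \<Longrightarrow> (\<Sum>i\<in>A. f i :: ('v, 'a::comm_semiring_1) mpoly) \<in> polys_in S"
  by (induction A rule: infinite_finite_induct) auto

lemma polys_in_prod [intro]:
  "(\<And>i. i \<in> A \<Longrightarrow> f i \<in> polys_in S) \<Longrightarrow> (\<Prod>i\<in>A. f i :: ('v, 'a::comm_semiring_1) mpoly) \<in> polys_in S"
  by (induction A rule: infinite_finite_induct) auto

lemma polys_in_mono: "S \<subseteq> S' \<Longrightarrow> polys_in S \<subseteq> polys_in S'"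
  by (auto simp: polys_in_def)

lemma polys_in_UNIV [simp]: "polys_in UNIV = UNIV"
  by (auto simp: polys_in_def)

lemma polys_in_empty: "f \<in> polys_in {} \<longleftrightarrow> (\<exists>a. f = Const a)"
proof
  assume "f \<in> polys_in {}"
  hence "Poly_Mapping.keys f \<subseteq> {0}"
    by (auto simp: polys_in_def poly_vars_def)
  hence "f = Const (Poly_Mapping.lookup f 0)"
    by (auto intro!: poly_mapping_eqI simp: Const_def lookup_single when_def in_keys_iff)
  thus "\<exists>a. f = Const a" ..
qed auto

lemma poly_subst_cong:
  assumes "\<And>i. i \<in> poly_vars f \<Longrightarrow> \<sigma> i = \<sigma>' i"
  shows "poly_subst \<phi> \<sigma> f = poly_subst \<phi> \<sigma>' f"
  unfolding poly_subst_def
  by (intro sum.cong prod.cong arg_cong2[where f = "(*)"] arg_cong2[where f = "(^)"] refl)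
     (use assms in \<open>auto simp: poly_vars_def\<close>)

lemma peval_cong: "(\<And>i. i \<in> poly_vars f \<Longrightarrow> x i = y i) \<Longrightarrow> peval x f = peval y f"
  unfolding peval_def by (rule poly_subst_cong)

lemma coeff_hom_compose:
  "coeff_hom \<phi> \<Longrightarrow> coeff_hom \<psi> \<Longrightarrow> coeff_hom (\<lambda>a. \<psi> (\<phi> a))"
  by (simp add: coeff_hom_def)

text \<open>One composition law serves evaluation after substitution, restriction to a line, and the
  comparison of real with complex evaluation; they differ only in \<open>\<phi>\<close> and
  \<open>\<psi>\<close>.\<close>

lemma hom_poly_subst:
  assumes "coeff_hom \<phi>" "coeff_hom \<psi>"
  shows "\<psi> (poly_subst \<phi> \<sigma> f) = poly_subst (\<lambda>a. \<psi> (\<phi> a)) (\<lambda>i. \<psi> (\<sigma> i)) f"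
proof -
  note c = coeff_hom_compose[OF assms]
  have \<psi>: "\<psi> (a + b) = \<psi> a + \<psi> b" "\<psi> (a * b) = \<psi> a * \<psi> b" for a b
    using assms(2) by (auto simp: coeff_hom_def)
  show ?thesis
    by (rule mpoly_hom_eqI[where f = f])
       (simp_all only: \<psi> poly_subst_add[OF c] poly_subst_mult[OF c] poly_subst_Const[OF c]
         poly_subst_Var[OF c] poly_subst_add[OF assms(1)] poly_subst_mult[OF assms(1)]
         poly_subst_Const[OF assms(1)] poly_subst_Var[OF assms(1)])
qed

lemma coeff_hom_peval: "coeff_hom (peval x)"
  by (simp add: coeff_hom_def)

lemma peval_poly_subst_Const: "peval x (poly_subst Const \<sigma> f) = peval (\<lambda>i. peval x (\<sigma> i)) f"
  by (subst hom_poly_subst[OF coeff_hom_Const coeff_hom_peval]) (simp add: peval_def[symmetric])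

lemma polys_in_poly_subst:
  fixes \<sigma> :: "'v \<Rightarrow> ('w, 'a::comm_semiring_1) mpoly"
  assumes "\<And>i. i \<in> poly_vars f \<Longrightarrow> \<sigma> i \<in> polys_in S"
  shows "poly_subst Const \<sigma> f \<in> polys_in S"
  unfolding poly_subst_def
  by (intro polys_in_sum polys_in_mult polys_in_prod polys_in_power) (use assms in \<open>auto simp: poly_vars_def\<close>)

section \<open>Polynomials in one distinguished variable\<close>

text \<open>The coefficients stay in the ring with all variables instead of moving to a smaller
  variable type; the absence of \<open>i\<close> from them is recorded by membership in
  \<open>polys_in\<close>. Treating one variable after another thus never changes the type.\<close>

definition univ_at :: "'v \<Rightarrow> ('v, 'a::comm_ring_1) mpoly \<Rightarrow> ('v, 'a) mpoly poly"
  where "univ_at i f = poly_subst (\<lambda>a. [:Const a:]) (\<lambda>j. if j = i then [:0, 1:] else [:Var j:]) f"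

lemma coeff_hom_pCons: "coeff_hom (\<lambda>a. [:Const a :: ('v, 'a::comm_ring_1) mpoly:])"
  by (simp add: coeff_hom_def Const_0 Const_1 Const_add Const_mult one_pCons)

lemma univ_at_add [simp]: "univ_at i (f + g) = univ_at i f + univ_at i g"
  and univ_at_mult [simp]: "univ_at i (f * g) = univ_at i f * univ_at i g"
  and univ_at_Const [simp]: "univ_at i (Const a) = [:Const a:]"
  and univ_at_Var: "univ_at i (Var j) = (if j = i then [:0, 1:] else [:Var j:])"
  and univ_at_0 [simp]: "univ_at i 0 = 0"
  by (simp_all add: univ_at_def coeff_hom_pCons poly_subst_add poly_subst_mult poly_subst_Const
      poly_subst_Var poly_subst_0)

lemma univ_at_1 [simp]: "univ_at i 1 = 1"
  by (metis Const_1 one_pCons univ_at_Const)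

lemma univ_at_diff [simp]: "univ_at i (f - g) = univ_at i f - univ_at i g"
  by (metis diff_add_cancel eq_diff_eq univ_at_add)

lemma univ_at_power [simp]: "univ_at i (f ^ n) = univ_at i f ^ n"
  by (induction n) auto

lemma univ_at_sum: "univ_at i (\<Sum>k\<in>A. f k) = (\<Sum>k\<in>A. univ_at i (f k))"
  by (induction A rule: infinite_finite_induct) auto

lemma poly_univ_at: "poly (univ_at i f) (Var i) = f"
  by (rule mpoly_hom_eqI[where f = f]) (auto simp: univ_at_Var)

lemma univ_at_eq_0_iff [simp]: "univ_at i f = 0 \<longleftrightarrow> f = 0"
  by (metis poly_0 poly_univ_at univ_at_0)

lemma univ_at_const: "f \<in> polys_in (- {i}) \<Longrightarrow> univ_at i f = [:f:]"
proof -
  assume f: "f \<in> polys_in (- {i})"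
  have "univ_at i f = poly_subst (\<lambda>a. [:Const a:]) (\<lambda>j. [:Var j:]) f"
    unfolding univ_at_def by (rule poly_subst_cong) (use f in \<open>auto simp: polys_in_def\<close>)
  also have "\<dots> = [:f:]"
    by (rule mpoly_hom_eqI[where f = f])
       (auto simp: coeff_hom_pCons poly_subst_add poly_subst_mult poly_subst_Const poly_subst_Var)
  finally show ?thesis .
qed

lemma coeff_univ_at_in_aux: "f \<in> polys_in S \<Longrightarrow> coeff (univ_at i f) k \<in> polys_in (S - {i})"
proof -
  assume f: "f \<in> polys_in S"
  let ?Q = "{p :: ('a, 'b) mpoly poly. \<forall>k. coeff p k \<in> polys_in (S - {i})}"
  have Q1: "p * q \<in> ?Q" if "p \<in> ?Q" "q \<in> ?Q" for p q
    using that by (auto simp: coeff_mult intro!: polys_in_sum polys_in_mult)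
  have Q0: "1 \<in> ?Q" by (auto simp: coeff_1)
  have Qp: "p ^ n \<in> ?Q" if "p \<in> ?Q" for p n
    using that by (induction n) (use Q0 Q1 in auto)
  have Qprod: "(\<Prod>j\<in>A. p j) \<in> ?Q" if "\<And>j. j \<in> A \<Longrightarrow> p j \<in> ?Q" for A :: "'a set" and p
    using that by (induction A rule: infinite_finite_induct) (use Q0 Q1 in auto)
  have Qs: "(\<Sum>j\<in>A. p j) \<in> ?Q" if "\<And>j. j \<in> A \<Longrightarrow> p j \<in> ?Q" for A :: "('a \<Rightarrow>\<^sub>0 nat) set" and p
    using that by (auto simp: coeff_sum intro!: polys_in_sum)
  have S: "j \<in> S" if "m \<in> Poly_Mapping.keys f" "j \<in> Poly_Mapping.keys m" for m j
    using f that by (auto simp: polys_in_def poly_vars_def)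
  have Qc: "[:c:] \<in> ?Q" if "c \<in> polys_in (S - {i})" for c
    using that by (auto simp: coeff_pCons split: nat.splits)
  have QX: "[:0, 1:] \<in> ?Q"
    by (auto simp: coeff_pCons split: nat.splits)
  have "univ_at i f \<in> ?Q"
    unfolding univ_at_def poly_subst_def
  proof (intro Qs Q1 Qprod Qp)
    fix m assume "m \<in> Poly_Mapping.keys f"
    show "[:Const (poly_mapping.lookup f m):] \<in> ?Q"
      by (intro Qc polys_in_Const)
    fix j assume "j \<in> Poly_Mapping.keys m"
    thus "(if j = i then [:0, 1:] else [:Var j:]) \<in> ?Q"
      using S[OF \<open>m \<in> _\<close>, of j] QX Qc[of "Var j"] polys_in_Var[of j "S - {i}"] by auto
  qed
  thus ?thesis by blast
qed

lemma coeff_univ_at_in: "f \<in> polys_in (insert i S) \<Longrightarrow> i \<notin> S \<Longrightarrow> coeff (univ_at i f) k \<in> polys_in S"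
  using coeff_univ_at_in_aux[of f "insert i S" i k] by auto

lemma coeff_univ_at_in': "coeff (univ_at i f) k \<in> polys_in (- {i})"
  using coeff_univ_at_in_aux[of f UNIV i k] by (auto simp: Compl_eq_Diff_UNIV)

lemma degree_univ_at_0_iff: "degree (univ_at i f) = 0 \<longleftrightarrow> f \<in> polys_in (- {i})"
proof
  assume "degree (univ_at i f) = 0"
  then obtain c where c: "univ_at i f = [:c:]" by (rule degree_eq_zeroE)
  have "c \<in> polys_in (- {i})" using coeff_univ_at_in'[of i f 0] c by simp
  moreover have "f = c" using poly_univ_at[of i f] c by simp
  ultimately show "f \<in> polys_in (- {i})" by simp
qed (simp add: univ_at_const)

section \<open>Absence of zero divisors\<close>

lemma peval_poly: "peval y (poly p a) = poly (map_poly (peval y) p) (peval y a)"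
  by (induction p) (simp_all add: map_poly_pCons)

text \<open>Choose the other coordinates so that the leading coefficient in the new variable
  survives; then only finitely many values of that variable are bad. The set \<open>A\<close> makes
  real nonroots available, which is needed because objective vectors are real.\<close>

lemma exists_nonroot:
  fixes f :: "('v, 'a::idom) mpoly"
  assumes "f \<noteq> 0" "infinite A"
  shows "\<exists>x. range x \<subseteq> A \<and> peval x f \<noteq> 0"
proof -
  have "\<forall>f :: ('v, 'a) mpoly. f \<in> polys_in S \<longrightarrow> f \<noteq> 0 \<longrightarrow> (\<exists>x. range x \<subseteq> A \<and> peval x f \<noteq> 0)" if "finite S" for S
    using that
  proof (induction S)
    case empty
    from assms(2) obtain a where "a \<in> A" by fastforce
    thus ?case by (auto simp: polys_in_empty intro!: exI[of _ "\<lambda>_. a"])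
  next
    case (insert i S)
    show ?case
    proof (intro allI impI)
      fix f :: "('v, 'a) mpoly" assume f: "f \<in> polys_in (insert i S)" "f \<noteq> 0"
      define p where "p = univ_at i f"
      define c where "c = lead_coeff p"
      have "c \<noteq> 0" "c \<in> polys_in S" using f insert.hyps by (auto simp: c_def p_def coeff_univ_at_in)
      then obtain x where x: "range x \<subseteq> A" "peval x c \<noteq> 0" using insert.IH by blast
      define q where "q = map_poly (peval x) p"
      have "coeff q (degree p) \<noteq> 0" using x by (simp add: q_def c_def coeff_map_poly)
      hence "finite {t. poly q t = 0}" by (intro poly_roots_finite) auto
      then obtain t where t: "t \<in> A" "poly q t \<noteq> 0"
        using assms(2) by (metis (mono_tags, lifting) finite_subset mem_Collect_eq subsetI)
      define y where "y = x(i := t)"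
      have cf: "peval y (coeff p k) = peval x (coeff p k)" for k
        by (rule peval_cong) (use coeff_univ_at_in'[of i f k] in \<open>auto simp: y_def p_def polys_in_def\<close>)
      have "map_poly (peval y) p = q"
        unfolding q_def by (rule poly_eqI) (simp add: coeff_map_poly cf)
      moreover have "peval y f = peval y (poly p (Var i))" by (simp add: p_def poly_univ_at)
      ultimately have "peval y f = poly q t" by (simp add: peval_poly y_def)
      hence "peval y f \<noteq> 0" using t by simp
      moreover have "range y \<subseteq> A" using x t by (auto simp: y_def)
      ultimately show "\<exists>x. range x \<subseteq> A \<and> peval x f \<noteq> 0" by blast
    qed
  qed
  from this[of "poly_vars f"] show ?thesis using assms(1) by (auto simp: polys_in_def)
qed

text \<open>The restriction of \<open>f\<close> to the line \<open>x + t * v\<close>, as a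
  polynomial in \<open>t\<close>. For \<open>x = 0\<close> its coefficients are the values at
  \<open>v\<close> of the homogeneous components of \<open>f\<close>.\<close>

definition line_poly :: "('v \<Rightarrow> 'a) \<Rightarrow> ('v \<Rightarrow> 'a) \<Rightarrow> ('v, 'a::comm_ring_1) mpoly \<Rightarrow> 'a poly"
  where "line_poly x v f = poly_subst (\<lambda>a. [:a:]) (\<lambda>i. [:x i, v i:]) f"

lemma coeff_hom_pCons0: "coeff_hom (\<lambda>a::'a::comm_ring_1. [:a:])"
  by (simp add: coeff_hom_def one_pCons)

lemma coeff_hom_poly: "coeff_hom (\<lambda>p::'a::comm_ring_1 poly. poly p t)"
  by (simp add: coeff_hom_def)

lemma poly_line_poly: "poly (line_poly x v f) t = peval (\<lambda>i. x i + t * v i) f"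
  unfolding line_poly_def
  by (subst hom_poly_subst[OF coeff_hom_pCons0 coeff_hom_poly]) (simp add: peval_def)

text \<open>A line through a nonroot of \<open>f\<close> and a nonroot of \<open>g\<close> reduces
  the claim to polynomials in one variable.\<close>

lemma mpoly_no_zero_divisors:
  fixes f g :: "('v, complex) mpoly"
  assumes "f * g = 0"
  shows "f = 0 \<or> g = 0"
proof (rule ccontr)
  assume "\<not> ?thesis"
  then obtain x y where x: "peval x f \<noteq> 0" and y: "peval y g \<noteq> 0"
    using exists_nonroot[of f UNIV] exists_nonroot[of g UNIV] by (auto simp: infinite_UNIV_char_0)
  define v where "v i = y i - x i" for i
  have "line_poly x v f \<noteq> 0" using poly_line_poly[of x v f 0] x by auto
  moreover have "line_poly x v g \<noteq> 0"
    using poly_line_poly[of x v g 1] y by (auto simp: v_def)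
  ultimately have "line_poly x v f * line_poly x v g \<noteq> 0" by simp
  moreover have "line_poly x v f * line_poly x v g = line_poly x v (f * g)"
    by (simp add: line_poly_def poly_subst_mult coeff_hom_pCons0)
  ultimately show False using assms by (simp add: line_poly_def)
    (simp add: poly_subst_eq)
qed

lemma mpoly_mult_eq_0_iff: "(f :: ('v, complex) mpoly) * g = 0 \<longleftrightarrow> f = 0 \<or> g = 0"
  using mpoly_no_zero_divisors by auto

lemma mpoly_mult_cancel: "h * f = h * g \<Longrightarrow> h \<noteq> 0 \<Longrightarrow> f = (g :: ('v, complex) mpoly)"
  using mpoly_mult_eq_0_iff[of h "f - g"] by (simp add: right_diff_distrib)

lemma mpoly_power_eq_0_iff: "(f :: ('v, complex) mpoly) ^ n = 0 \<longleftrightarrow> f = 0 \<and> n > 0"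
  by (induction n) (auto simp: mpoly_mult_eq_0_iff)

lemma degree_univ_at_mult:
  fixes f g :: "('v, complex) mpoly"
  assumes "f \<noteq> 0" "g \<noteq> 0"
  shows "degree (univ_at i (f * g)) = degree (univ_at i f) + degree (univ_at i g)"
    and "lead_coeff (univ_at i (f * g)) = lead_coeff (univ_at i f) * lead_coeff (univ_at i g)"
proof -
  have ne: "lead_coeff (univ_at i f) * lead_coeff (univ_at i g) \<noteq> 0"
    using assms by (simp add: mpoly_mult_eq_0_iff)
  have c: "coeff (univ_at i f * univ_at i g) (degree (univ_at i f) + degree (univ_at i g))
      = lead_coeff (univ_at i f) * lead_coeff (univ_at i g)"
    by (rule coeff_mult_degree_sum)
  show d: "degree (univ_at i (f * g)) = degree (univ_at i f) + degree (univ_at i g)"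
    using degree_mult_le[of "univ_at i f" "univ_at i g"] le_degree[of "univ_at i f * univ_at i g"] c ne
    by (metis antisym univ_at_mult)
  show "lead_coeff (univ_at i (f * g)) = lead_coeff (univ_at i f) * lead_coeff (univ_at i g)"
    using c d by simp
qed

section \<open>Derivations\<close>

lemma partial_deriv_superset:
  assumes "finite K" "Poly_Mapping.keys f \<subseteq> K"
  shows "partial_deriv i f = (\<Sum>m\<in>K. Poly_Mapping.single (m - Poly_Mapping.single i 1)
                    (of_nat (Poly_Mapping.lookup m i) * Poly_Mapping.lookup f m))"
  unfolding partial_deriv_def
  by (rule sum.mono_neutral_left) (use assms in \<open>auto simp: in_keys_iff\<close>)

lemma partial_deriv_add [simp]: "partial_deriv i (f + g) = partial_deriv i f + partial_deriv i g"
proof -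
  let ?K = "Poly_Mapping.keys f \<union> Poly_Mapping.keys g"
  show ?thesis
    by (subst (1 2 3) partial_deriv_superset[where K = ?K])
       (auto simp: Poly_Mapping.keys_add lookup_add sum.distrib distrib_left single_add)
qed

lemma partial_deriv_single:
  "partial_deriv i (Poly_Mapping.single m a) =
     Poly_Mapping.single (m - Poly_Mapping.single i 1) (of_nat (Poly_Mapping.lookup m i) * a)"
  by (cases "a = 0") (auto simp: partial_deriv_def)

lemma partial_deriv_0 [simp]: "partial_deriv i 0 = 0"
  by (simp add: partial_deriv_def)

lemma partial_deriv_Const [simp]: "partial_deriv i (Const a) = 0"
  by (simp add: Const_def partial_deriv_single)

lemma partial_deriv_Var: "partial_deriv i (Var j) = (if i = j then 1 else 0)"
  by (auto simp: Var_def partial_deriv_single lookup_single when_def)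

lemma monom_minus_single_add:
  fixes m m' :: "'v \<Rightarrow>\<^sub>0 nat"
  assumes "Poly_Mapping.lookup m i \<noteq> 0"
  shows "m - Poly_Mapping.single i 1 + m' = m + m' - Poly_Mapping.single i 1"
  by (rule poly_mapping_eqI)
     (use assms in \<open>auto simp: lookup_add lookup_minus lookup_single when_def\<close>)

lemma partial_deriv_mult [simp]:
  "partial_deriv i (f * g) = f * partial_deriv i g + partial_deriv i f * g"
proof (induction f rule: mpoly_sum_induct)
  case (2 m a)
  show ?case
  proof (induction g rule: mpoly_sum_induct)
    case (2 m' b)
    have "Poly_Mapping.single (m + (m' - Poly_Mapping.single i 1)) (a * (of_nat (Poly_Mapping.lookup m' i) * b))
        = Poly_Mapping.single (m + m' - Poly_Mapping.single i 1) (of_nat (Poly_Mapping.lookup m' i) * (a * b))"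
      using monom_minus_single_add[of m' i m] by (cases "Poly_Mapping.lookup m' i = 0") (auto simp: ac_simps)
    moreover have "Poly_Mapping.single (m - Poly_Mapping.single i 1 + m') (of_nat (Poly_Mapping.lookup m i) * a * b)
        = Poly_Mapping.single (m + m' - Poly_Mapping.single i 1) (of_nat (Poly_Mapping.lookup m i) * (a * b))"
      using monom_minus_single_add[of m i m'] by (cases "Poly_Mapping.lookup m i = 0") (auto simp: ac_simps)
    ultimately show ?case
      by (simp add: mult_single partial_deriv_single lookup_add distrib_right single_add add.commute)
  next
    case (3 f g)
    thus ?case by (simp add: algebra_simps)
  qed auto
next
  case (3 f g)
  thus ?case by (simp add: algebra_simps)
qed auto

lemma partial_deriv_diff [simp]:
  "partial_deriv i (f - g) = partial_deriv i f - partial_deriv i (g :: ('v, 'a::comm_ring_1) mpoly)"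
  by (metis diff_add_cancel eq_diff_eq partial_deriv_add)

lemma partial_deriv_not_in_vars: "i \<notin> poly_vars f \<Longrightarrow> partial_deriv i f = 0"
  unfolding partial_deriv_def poly_vars_def
  by (rule sum.neutral) (auto simp: in_keys_iff)

definition derivation :: "('a::comm_ring_1 \<Rightarrow> 'a) \<Rightarrow> bool"
  where "derivation \<delta> \<longleftrightarrow> (\<forall>a b. \<delta> (a + b) = \<delta> a + \<delta> b) \<and> (\<forall>a b. \<delta> (a * b) = a * \<delta> b + \<delta> a * b)"

lemma derivation_0: "derivation \<delta> \<Longrightarrow> \<delta> 0 = 0"
  unfolding derivation_def by (metis add_cancel_right_right)

lemma derivation_diff: "derivation \<delta> \<Longrightarrow> \<delta> (a - b) = \<delta> a - \<delta> b"
  unfolding derivation_def by (metis diff_add_cancel eq_diff_eq)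

text \<open>The chain rule for any derivation that kills the coefficients. Its instances are
  \<open>pderiv\<close> along a line and partial derivatives after a rescaling of the
  variables.\<close>

lemma derivation_poly_subst:
  fixes f :: "('v::finite, 'a::comm_ring_1) mpoly"
  assumes "coeff_hom \<phi>" "derivation \<delta>" "\<And>a. \<delta> (\<phi> a) = 0"
  shows "\<delta> (poly_subst \<phi> \<sigma> f) = (\<Sum>i\<in>UNIV. poly_subst \<phi> \<sigma> (partial_deriv i f) * \<delta> (\<sigma> i))"
proof -
  note s = poly_subst_add[OF assms(1)] poly_subst_mult[OF assms(1)] poly_subst_0[OF assms(1)]
    poly_subst_Const[OF assms(1)] poly_subst_Var[OF assms(1)]
  have \<delta>: "\<delta> (a + b) = \<delta> a + \<delta> b" "\<delta> (a * b) = a * \<delta> b + \<delta> a * b" for a b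
    using assms(2) by (auto simp: derivation_def)
  have one: "poly_subst \<phi> \<sigma> 1 = 1"
    using s(4)[of \<sigma> 1] assms(1) by (simp add: Const_1 coeff_hom_def)
  show ?thesis
  proof (induction f rule: mpoly_induct)
    case (Const a)
    show ?case by (simp add: s assms(3))
  next
    case (Var i)
    have "(\<Sum>j\<in>UNIV. poly_subst \<phi> \<sigma> (partial_deriv j (Var i)) * \<delta> (\<sigma> j)) =
        (\<Sum>j\<in>UNIV. if j = i then \<delta> (\<sigma> j) else 0)"
      by (rule sum.cong) (auto simp: partial_deriv_Var s one)
    thus ?case by (simp add: s)
  next
    case (add f g)
    thus ?case by (simp add: s \<delta> distrib_right sum.distrib)
  next
    case (mult f g)
    thus ?case by (simp add: s \<delta> sum_distrib_left sum_distrib_right algebra_simps flip: sum.distrib)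
  qed
qed

definition vector_field :: "('v::finite \<Rightarrow> ('v, 'a::comm_ring_1) mpoly) \<Rightarrow> ('v, 'a) mpoly \<Rightarrow> ('v, 'a) mpoly"
  where "vector_field b f = (\<Sum>i\<in>UNIV. b i * partial_deriv i f)"

lemma derivation_vector_field: "derivation (vector_field b)"
  by (auto simp: derivation_def vector_field_def distrib_left sum.distrib sum_distrib_left
      sum_distrib_right ac_simps)

lemma vector_field_add [simp]: "vector_field b (f + g) = vector_field b f + vector_field b g"
  and vector_field_mult [simp]: "vector_field b (f * g) = f * vector_field b g + vector_field b f * g"
  and vector_field_0 [simp]: "vector_field b 0 = 0"
  and vector_field_diff [simp]: "vector_field b (f - g) = vector_field b f - vector_field b g"
  using derivation_vector_field[of b] derivation_0[of "vector_field b"] derivation_diff[of "vector_field b"]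
  by (auto simp: derivation_def)

lemma vector_field_Const [simp]: "vector_field b (Const a) = 0"
  by (simp add: vector_field_def)

lemma vector_field_Var [simp]: "vector_field b (Var i) = b i"
proof -
  have "vector_field b (Var i) = (\<Sum>j\<in>UNIV. if j = i then b j else 0)"
    unfolding vector_field_def by (rule sum.cong) (auto simp: partial_deriv_Var)
  thus ?thesis by simp
qed

lemma peval_vector_field:
  "peval (($) x) (vector_field b f) = (\<Sum>i\<in>UNIV. peval (($) x) (b i) * gradient f x $ i)"
  by (simp add: vector_field_def gradient_def)

lemma gradient_add: "gradient (f + g) x = gradient f x + gradient g x"
  by (simp add: gradient_def vec_eq_iff)

lemma gradient_0 [simp]: "gradient 0 x = 0"
  by (simp add: gradient_def vec_eq_iff)

lemma gradient_Const_mult: "gradient (Const a * f) x = a *s gradient f x"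
  by (simp add: gradient_def vec_eq_iff vector_scalar_mult_def)

lemma derivation_pderiv: "derivation (pderiv :: 'a::idom poly \<Rightarrow> 'a poly)"
  by (auto simp: derivation_def pderiv_add pderiv_mult ac_simps)

lemma poly_pderiv_line_poly:
  fixes f :: "('v::finite, 'a::idom) mpoly"
  shows "poly (pderiv (line_poly x v f)) t =
    (\<Sum>i\<in>UNIV. peval (\<lambda>i. x i + t * v i) (partial_deriv i f) * v i)"
  unfolding line_poly_def
  by (subst derivation_poly_subst[OF coeff_hom_pCons0 derivation_pderiv])
     (simp_all add: pderiv_pCons poly_sum mult.commute flip: line_poly_def poly_line_poly)

section \<open>Homogeneous components and degrees\<close>

lemma line_poly_mult: "line_poly x v (f * g) = line_poly x v f * line_poly x v g"
  by (simp add: line_poly_def coeff_hom_pCons0 poly_subst_mult)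

lemma monom_degree_0 [simp]: "monom_degree 0 = 0"
  by (simp add: monom_degree_def)

lemma monom_degree_superset:
  assumes "finite V" "Poly_Mapping.keys m \<subseteq> V"
  shows "monom_degree m = (\<Sum>i\<in>V. Poly_Mapping.lookup m i)"
  unfolding monom_degree_def
  by (rule sum.mono_neutral_left) (use assms in \<open>auto simp: in_keys_iff\<close>)

lemma monom_degree_add: "monom_degree (m + m') = monom_degree m + monom_degree m'"
proof -
  let ?V = "Poly_Mapping.keys m \<union> Poly_Mapping.keys m'"
  show ?thesis
    by (subst (1 2 3) monom_degree_superset[where V = ?V])
       (auto simp: keys_monom_add lookup_add sum.distrib)
qed

definition homog_comp :: "nat \<Rightarrow> ('v, 'a::comm_monoid_add) mpoly \<Rightarrow> ('v, 'a) mpoly"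
  where "homog_comp d f = (\<Sum>m\<in>{m\<in>Poly_Mapping.keys f. monom_degree m = d}.
     Poly_Mapping.single m (Poly_Mapping.lookup f m))"

lemma lookup_homog_comp:
  "Poly_Mapping.lookup (homog_comp d f) m = (if monom_degree m = d then Poly_Mapping.lookup f m else 0)"
  by (auto simp: homog_comp_def lookup_sum lookup_single when_def in_keys_iff)

lemma homogeneous_homog_comp: "homogeneous (homog_comp d f)"
  unfolding homogeneous_def by (rule exI[of _ d]) (auto simp: in_keys_iff lookup_homog_comp split: if_splits)

lemma homog_comp_sum: 
  assumes "total_degree f \<le> D"
  shows "f = (\<Sum>d\<le>D. homog_comp d f)"
proof (rule poly_mapping_eqI)
  fix m
  have "monom_degree m \<le> D" if "m \<in> Poly_Mapping.keys f"
    using assms that by (auto simp: total_degree_def)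
  thus "Poly_Mapping.lookup f m = Poly_Mapping.lookup (\<Sum>d\<le>D. homog_comp d f) m"
    by (auto simp: lookup_sum lookup_homog_comp in_keys_iff)
qed

lemma monom_degree_le_total_degree: "m \<in> Poly_Mapping.keys f \<Longrightarrow> monom_degree m \<le> total_degree f"
  by (simp add: total_degree_def)

lemma prod_pCons_power:
  fixes v :: "'v \<Rightarrow> 'a::comm_ring_1"
  shows "(\<Prod>i\<in>A. [:0, v i:] ^ e i) = monom (\<Prod>i\<in>A. v i ^ e i) (\<Sum>i\<in>A. e i)"
proof -
  have "[:0, c:] ^ n = monom (c ^ n) n" for c :: 'a and n
    by (induction n) (simp_all add: monom_0 monom_Suc one_pCons smult_monom)
  thus ?thesis
    by (induction A rule: infinite_finite_induct) (auto simp: mult_monom)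
qed

lemma coeff_line_poly_0:
  fixes f :: "('v, 'a::comm_ring_1) mpoly"
  shows "coeff (line_poly (\<lambda>_. 0) v f) d = peval v (homog_comp d f)"
proof -
  have "coeff (line_poly (\<lambda>_. 0) v f) d =
      (\<Sum>m\<in>Poly_Mapping.keys f. if monom_degree m = d then Poly_Mapping.lookup f m * eval_monom v m else 0)"
    unfolding line_poly_def poly_subst_def prod_pCons_power
    by (auto simp: coeff_sum monom_degree_def eval_monom_def intro!: sum.cong)
  also have "\<dots> = (\<Sum>m\<in>Poly_Mapping.keys f. Poly_Mapping.lookup (homog_comp d f) m * eval_monom v m)"
    by (rule sum.cong) (auto simp: lookup_homog_comp)
  also have "\<dots> = peval v (homog_comp d f)"
    unfolding peval_def
    by (rule poly_subst_superset[symmetric]) (auto simp: in_keys_iff lookup_homog_comp split: if_splits)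
  finally show ?thesis .
qed

lemma poly_0_if_vanishing_off_0:
  fixes p :: "'a::{idom,ring_char_0} poly"
  assumes "\<And>t. t \<noteq> 0 \<Longrightarrow> poly p t = 0"
  shows "p = 0"
proof (rule ccontr)
  assume "p \<noteq> 0"
  hence "finite (insert 0 {t. poly p t = 0})" by (simp add: poly_roots_finite)
  moreover have "insert 0 {t. poly p t = 0} = UNIV" using assms by auto
  ultimately show False by (simp add: infinite_UNIV_char_0)
qed

text \<open>This makes the ideal of a cone homogeneous: the components at \<open>v\<close> are the
  coefficients of a polynomial in \<open>t\<close>. The value \<open>t = 0\<close> is left out
  because cones here are closed under nonzero factors only.\<close>

lemma peval_homog_comp_eq_0:
  fixes f :: "('v, 'a::{idom,ring_char_0}) mpoly"
  assumes "\<And>t. t \<noteq> 0 \<Longrightarrow> peval (\<lambda>i. t * v i) f = 0"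
  shows "peval v (homog_comp d f) = 0"
proof -
  have "line_poly (\<lambda>_. 0) v f = 0"
    by (rule poly_0_if_vanishing_off_0) (simp add: poly_line_poly assms)
  thus ?thesis by (simp flip: coeff_line_poly_0)
qed

lemma homogeneous_peval_scale:
  fixes f :: "('v, 'a::comm_ring_1) mpoly"
  assumes "homogeneous f"
  shows "\<exists>d. \<forall>t v. peval (\<lambda>i. t * v i) f = t ^ d * peval v f"
proof -
  obtain d where d: "\<And>m. m \<in> Poly_Mapping.keys f \<Longrightarrow> monom_degree m = d"
    using assms by (auto simp: homogeneous_def)
  have em: "eval_monom (\<lambda>i. t * v i) m = t ^ monom_degree m * eval_monom v m" for t :: 'a and v m
    by (simp add: eval_monom_def monom_degree_def power_mult_distrib prod.distrib power_sum)
  show ?thesis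
  proof (intro exI[of _ d] allI)
    fix t v
    show "peval (\<lambda>i. t * v i) f = t ^ d * peval v f"
      unfolding peval_def poly_subst_eq sum_distrib_left em
      by (rule sum.cong) (use d in \<open>simp_all add: mult.left_commute\<close>)
  qed
qed

section \<open>Total degrees of sums and products\<close>

lemma total_degree_leI: "(\<And>m. m \<in> Poly_Mapping.keys f \<Longrightarrow> monom_degree m \<le> D) \<Longrightarrow> total_degree f \<le> D"
  by (simp add: total_degree_def)

lemma total_degree_0 [simp]: "total_degree 0 = 0"
  by (simp add: total_degree_def)

lemma total_degree_add_le: "total_degree f \<le> D \<Longrightarrow> total_degree g \<le> D \<Longrightarrow> total_degree (f + g) \<le> D"
  by (rule total_degree_leI)
     (use Poly_Mapping.keys_add[of f g] monom_degree_le_total_degree[of _ f] monom_degree_le_total_degree[of _ g] in fastforce)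

lemma total_degree_sum_le: "(\<And>i. i \<in> A \<Longrightarrow> total_degree (f i) \<le> D) \<Longrightarrow> total_degree (\<Sum>i\<in>A. f i) \<le> D"
  by (induction A rule: infinite_finite_induct) (auto intro: total_degree_add_le)

lemma total_degree_mult_le: "total_degree (f * g) \<le> total_degree f + total_degree g"
proof (rule total_degree_leI)
  fix m assume "m \<in> Poly_Mapping.keys (f * g)"
  then obtain a b where "m = a + b" "a \<in> Poly_Mapping.keys f" "b \<in> Poly_Mapping.keys g"
    using keys_mult[of f g] by blast
  thus "monom_degree m \<le> total_degree f + total_degree g"
    by (simp add: monom_degree_add add_mono monom_degree_le_total_degree)
qed

lemma homog_comp_total_degree:
  assumes "f \<noteq> 0"
  shows "homog_comp (total_degree f) f \<noteq> 0"
proof -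
  have "Poly_Mapping.keys f \<noteq> {}" using assms by simp
  hence "total_degree f = Max (monom_degree ` Poly_Mapping.keys f)"
    unfolding total_degree_def by (subst Max_insert) auto
  hence "total_degree f \<in> monom_degree ` Poly_Mapping.keys f"
    using \<open>_ \<noteq> {}\<close> by (metis Max_in finite_imageI finite_keys image_is_empty)
  then obtain m where "m \<in> Poly_Mapping.keys f" "monom_degree m = total_degree f" by auto
  hence "Poly_Mapping.lookup (homog_comp (total_degree f) f) m \<noteq> 0"
    by (auto simp: lookup_homog_comp in_keys_iff)
  thus ?thesis by auto
qed

lemma homog_comp_eq_0: "total_degree f < d \<Longrightarrow> homog_comp d f = 0"
  by (rule poly_mapping_eqI)
     (use monom_degree_le_total_degree[of _ f] in \<open>fastforce simp: lookup_homog_comp in_keys_iff\<close>)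

text \<open>The product of the two top components is nonzero, so both are nonzero at a suitable
  \<open>v\<close>. On the line through 0 and \<open>v\<close> the degrees then equal the total
  degrees, and univariate degrees add.\<close>

lemma total_degree_mult:
  fixes f g :: "('v, complex) mpoly"
  assumes "f \<noteq> 0" "g \<noteq> 0"
  shows "total_degree (f * g) = total_degree f + total_degree g"
proof (rule antisym[OF total_degree_mult_le], rule ccontr)
  assume "\<not> total_degree f + total_degree g \<le> total_degree (f * g)"
  hence z: "homog_comp (total_degree f + total_degree g) (f * g) = 0"
    by (intro homog_comp_eq_0) simp
  have "homog_comp (total_degree f) f * homog_comp (total_degree g) g \<noteq> 0"
    using assms by (simp add: mpoly_mult_eq_0_iff homog_comp_total_degree)
  then obtain v where v: "peval v (homog_comp (total_degree f) f * homog_comp (total_degree g) g) \<noteq> 0"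
    using exists_nonroot infinite_UNIV_char_0 by blast
  define p q where "p = line_poly (\<lambda>_. 0) v f" and "q = line_poly (\<lambda>_. 0) v g"
  have deg: "degree (line_poly (\<lambda>_. 0) v h) \<le> total_degree h" for h
    by (rule degree_le) (auto simp: coeff_line_poly_0 homog_comp_eq_0)
  have "coeff p (total_degree f) \<noteq> 0" "coeff q (total_degree g) \<noteq> 0"
    using v by (auto simp: p_def q_def coeff_line_poly_0)
  hence "degree p = total_degree f" "degree q = total_degree g"
    using deg[of f] deg[of g] le_degree by (metis p_def antisym, metis q_def antisym)
  hence "coeff (p * q) (total_degree f + total_degree g) \<noteq> 0"
    using coeff_mult_degree_sum[of p q] \<open>coeff p _ \<noteq> 0\<close> \<open>coeff q _ \<noteq> 0\<close> by simp
  thus False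
    using z by (simp add: p_def q_def coeff_line_poly_0 flip: line_poly_mult)
qed

lemma total_degree_eq_0: "total_degree f = 0 \<longleftrightarrow> (\<exists>a. f = Const a)"
proof
  assume "total_degree f = 0"
  hence "monom_degree m = 0" if "m \<in> Poly_Mapping.keys f" for m
    using monom_degree_le_total_degree[OF that] by simp
  hence "Poly_Mapping.keys m = {}" if "m \<in> Poly_Mapping.keys f" for m
    using that unfolding monom_degree_def by (fastforce simp: in_keys_iff)
  hence "f \<in> polys_in {}" unfolding polys_in_def poly_vars_def by blast
  thus "\<exists>a. f = Const a" by (simp add: polys_in_empty)
qed (auto simp: Const_def total_degree_def)

section \<open>Counting monomials\<close>

text \<open>Elimination: unless the equation for \<open>b\<close> is void, it is solved for one
  unknown \<open>p\<close>, and the remaining system still has more unknowns than equations.\<close>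

lemma homogeneous_linear_system:
  fixes c :: "'a \<Rightarrow> 'b \<Rightarrow> 'f::field"
  assumes "finite B" "finite A" "card B < card A"
  shows "\<exists>d. (\<exists>a\<in>A. d a \<noteq> 0) \<and> (\<forall>b\<in>B. (\<Sum>a\<in>A. d a * c a b) = 0)"
  using assms
proof (induction B arbitrary: A c rule: finite_induct)
  case empty
  then obtain a where "a \<in> A" by fastforce
  thus ?case by (intro exI[of _ "\<lambda>_. 1"]) auto
next
  case (insert b B)
  show ?case
  proof (cases "\<forall>a\<in>A. c a b = 0")
    case True
    have "card B < card A" using insert by simp
    from insert.IH[OF insert.prems(1) this, of c] obtain d where
      "\<exists>a\<in>A. d a \<noteq> 0" "\<forall>e\<in>B. (\<Sum>a\<in>A. d a * c a e) = 0" by blast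
    thus ?thesis using True by (intro exI[of _ d]) simp
  next
    case False
    then obtain p where p: "p \<in> A" "c p b \<noteq> 0" by blast
    have "card B < card (A - {p})" using insert p by simp
    from insert.IH[OF _ this, of "\<lambda>a e. c a e - c a b / c p b * c p e"] insert.prems
    obtain d where d: "\<exists>a\<in>A-{p}. d a \<noteq> 0"
      "\<forall>e\<in>B. (\<Sum>a\<in>A-{p}. d a * (c a e - c a b / c p b * c p e)) = 0" by auto
    define s where "s = (\<Sum>a\<in>A-{p}. d a * c a b)"
    define d' where "d' = d(p := - s / c p b)"
    have sp: "(\<Sum>a\<in>A. d' a * c a e) = (\<Sum>a\<in>A-{p}. d a * c a e) - s / c p b * c p e" for e
      using p insert.prems by (subst sum.remove[of A p]) (auto simp: d'_def intro!: sum.cong)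
    have "(\<Sum>a\<in>A. d' a * c a e) = 0" if "e \<in> insert b B" for e
    proof (cases "e = b")
      case True
      thus ?thesis using p by (simp add: sp s_def)
    next
      case False
      hence "(\<Sum>a\<in>A-{p}. d a * (c a e - c a b / c p b * c p e)) = 0" using d(2) that by auto
      thus ?thesis
        by (simp add: sp s_def right_diff_distrib sum_subtractf sum_divide_distrib sum_distrib_right mult.assoc)
    qed
    moreover have "\<exists>a\<in>A. d' a \<noteq> 0" using d(1) by (auto simp: d'_def)
    ultimately show ?thesis by blast
  qed
qed

text \<open>\<open>mspan D\<close> is spanned by the monomials whose exponents are at most \<open>D\<close> at the algebraically
  independent coordinates \<open>T\<close> and bounded once and for all at the remaining ones. Multiplication by
  \<open>h\<close> times a polynomial raises \<open>D\<close> by a constant only, so the size of \<open>mspan\<close> grows like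
  \<open>D ^ card T\<close>.\<close>

locale algebraic_over =
  fixes V T :: "'v set" and \<Omega> :: "('v \<Rightarrow> complex) set"
    and hh :: "'v \<Rightarrow> ('v, complex) mpoly" and mm :: "'v \<Rightarrow> nat"
    and cc :: "'v \<Rightarrow> nat \<Rightarrow> ('v, complex) mpoly"
  assumes fin: "finite V" and TV: "T \<subseteq> V"
    and hT: "v \<in> V - T \<Longrightarrow> hh v \<in> polys_in T"
    and cT: "v \<in> V - T \<Longrightarrow> cc v j \<in> polys_in T"
    and rel: "v \<in> V - T \<Longrightarrow> w \<in> \<Omega> \<Longrightarrow>
       peval w (hh v) * w v ^ mm v = (\<Sum>j<mm v. peval w (cc v j) * w v ^ j)"
begin

text \<open>Common denominator of the relations: where it is nonzero, each of them has a nonzero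
  leading coefficient.\<close>

definition h :: "('v, complex) mpoly" where "h = (\<Prod>v\<in>V - T. hh v)"

definition exps :: "nat \<Rightarrow> ('v \<Rightarrow> nat) set"
  where "exps D = (\<Pi>\<^sub>E v\<in>V. if v \<in> T then {..D} else {..<mm v})"

definition mspan :: "nat \<Rightarrow> (('v \<Rightarrow> complex) \<Rightarrow> complex) set"
  where "mspan D = {f. \<exists>c. \<forall>w\<in>\<Omega>. f w = (\<Sum>\<alpha>\<in>exps D. c \<alpha> * (\<Prod>v\<in>V. w v ^ \<alpha> v))}"

lemma finite_exps: "finite (exps D)"
  unfolding exps_def using fin by (intro finite_PiE) auto

lemma card_exps: "card (exps D) = (D + 1) ^ card T * (\<Prod>v\<in>V - T. mm v)"
proof -
  have "card (exps D) = (\<Prod>v\<in>V. if v \<in> T then D + 1 else mm v)"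
    unfolding exps_def using fin by (simp add: card_PiE if_distrib cong: if_cong)
  also have "\<dots> = (\<Prod>v\<in>T. if v \<in> T then D + 1 else mm v) * (\<Prod>v\<in>V - T. if v \<in> T then D + 1 else mm v)"
    by (simp add: prod.subset_diff[OF TV fin] mult.commute)
  also have "\<dots> = (D + 1) ^ card T * (\<Prod>v\<in>V - T. mm v)"
    by (auto intro!: arg_cong2[where f = "(*)"] prod.cong)
  finally show ?thesis .
qed

lemma mspan_add: "f \<in> mspan D \<Longrightarrow> g \<in> mspan D \<Longrightarrow> (\<lambda>w. f w + g w) \<in> mspan D"
proof -
  assume "f \<in> mspan D" "g \<in> mspan D"
  then obtain c d where "\<forall>w\<in>\<Omega>. f w = (\<Sum>\<alpha>\<in>exps D. c \<alpha> * (\<Prod>v\<in>V. w v ^ \<alpha> v))"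
    "\<forall>w\<in>\<Omega>. g w = (\<Sum>\<alpha>\<in>exps D. d \<alpha> * (\<Prod>v\<in>V. w v ^ \<alpha> v))" by (auto simp: mspan_def)
  thus ?thesis
    unfolding mspan_def
    by (intro CollectI exI[of _ "\<lambda>\<alpha>. c \<alpha> + d \<alpha>"]) (auto simp: distrib_right sum.distrib)
qed

lemma mspan_scale: "f \<in> mspan D \<Longrightarrow> (\<lambda>w. a * f w) \<in> mspan D"
proof -
  assume "f \<in> mspan D"
  then obtain c where "\<forall>w\<in>\<Omega>. f w = (\<Sum>\<alpha>\<in>exps D. c \<alpha> * (\<Prod>v\<in>V. w v ^ \<alpha> v))"
    by (auto simp: mspan_def)
  thus ?thesis
    unfolding mspan_def
    by (intro CollectI exI[of _ "\<lambda>\<alpha>. a * c \<alpha>"]) (auto simp: sum_distrib_left mult.assoc)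
qed

lemma mspan_cong: "f \<in> mspan D \<Longrightarrow> (\<And>w. w \<in> \<Omega> \<Longrightarrow> g w = f w) \<Longrightarrow> g \<in> mspan D"
  by (auto simp: mspan_def)

lemma mspan_0: "(\<lambda>w. 0) \<in> mspan D"
  unfolding mspan_def by (intro CollectI exI[of _ "\<lambda>\<alpha>. 0"]) auto

lemma mspan_sum: "(\<And>i. i \<in> I \<Longrightarrow> f i \<in> mspan D) \<Longrightarrow> (\<lambda>w. \<Sum>i\<in>I. f i w) \<in> mspan D"
  by (induction I rule: infinite_finite_induct) (auto intro: mspan_0 mspan_add)

lemma mspan_monom: "\<alpha> \<in> exps D \<Longrightarrow> (\<lambda>w. \<Prod>v\<in>V. w v ^ \<alpha> v) \<in> mspan D"
  unfolding mspan_def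
  by (intro CollectI exI[of _ "\<lambda>\<beta>. if \<beta> = \<alpha> then 1 else 0"])
     (auto simp: if_distrib[of "\<lambda>x. x * _"] finite_exps cong: if_cong)

lemma exps_mono: "D \<le> D' \<Longrightarrow> exps D \<subseteq> exps D'"
  unfolding exps_def by (intro PiE_mono) auto

lemma mspan_monom_linear:
  assumes "f \<in> mspan D"
    and "\<And>\<alpha>. \<alpha> \<in> exps D \<Longrightarrow> (\<lambda>w. F w * (\<Prod>v\<in>V. w v ^ \<alpha> v)) \<in> mspan D'"
  shows "(\<lambda>w. F w * f w) \<in> mspan D'"
proof -
  obtain c where c: "\<forall>w\<in>\<Omega>. f w = (\<Sum>\<alpha>\<in>exps D. c \<alpha> * (\<Prod>v\<in>V. w v ^ \<alpha> v))"
    using assms(1) by (auto simp: mspan_def)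
  have "(\<lambda>w. \<Sum>\<alpha>\<in>exps D. c \<alpha> * (F w * (\<Prod>v\<in>V. w v ^ \<alpha> v))) \<in> mspan D'"
    by (intro mspan_sum mspan_scale assms(2))
  thus ?thesis
    by (rule mspan_cong) (simp add: c sum_distrib_left mult.left_commute)
qed

lemma mspan_mono: "D \<le> D' \<Longrightarrow> f \<in> mspan D \<Longrightarrow> f \<in> mspan D'"
  using mspan_monom_linear[of f D "\<lambda>_. 1" D'] exps_mono[of D D'] mspan_monom[of _ D'] by auto

definition tame :: "(('v \<Rightarrow> complex) \<Rightarrow> complex) \<Rightarrow> bool"
  where "tame F \<longleftrightarrow> (\<exists>\<kappa>. \<forall>D f. f \<in> mspan D \<longrightarrow> (\<lambda>w. F w * f w) \<in> mspan (D + \<kappa>))"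

lemma tame_add: "tame F \<Longrightarrow> tame G \<Longrightarrow> tame (\<lambda>w. F w + G w)"
proof -
  assume "tame F" "tame G"
  then obtain k l where "\<forall>D f. f \<in> mspan D \<longrightarrow> (\<lambda>w. F w * f w) \<in> mspan (D + k)"
    "\<forall>D f. f \<in> mspan D \<longrightarrow> (\<lambda>w. G w * f w) \<in> mspan (D + l)" by (auto simp: tame_def)
  hence "f \<in> mspan D \<longrightarrow> (\<lambda>w. (F w + G w) * f w) \<in> mspan (D + (k + l))" for D f
    using mspan_mono[of "D + k" "D + (k + l)"] mspan_mono[of "D + l" "D + (k + l)"]
    unfolding distrib_right by (intro impI mspan_add) auto
  thus ?thesis by (auto simp: tame_def)
qed

lemma tame_mult: "tame F \<Longrightarrow> tame G \<Longrightarrow> tame (\<lambda>w. F w * G w)"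
proof -
  assume "tame F" "tame G"
  then obtain k l where "\<forall>D f. f \<in> mspan D \<longrightarrow> (\<lambda>w. F w * f w) \<in> mspan (D + k)"
    "\<forall>D f. f \<in> mspan D \<longrightarrow> (\<lambda>w. G w * f w) \<in> mspan (D + l)" by (auto simp: tame_def)
  hence "f \<in> mspan D \<longrightarrow> (\<lambda>w. (F w * G w) * f w) \<in> mspan (D + (l + k))" for D f
    by (auto simp: mult.assoc simp flip: add.assoc)
  thus ?thesis by (auto simp: tame_def)
qed

lemma tame_const: "tame (\<lambda>w. a)"
  unfolding tame_def by (intro exI[of _ 0]) (auto intro: mspan_scale)

lemma tame_sum: "(\<And>i. i \<in> I \<Longrightarrow> tame (f i)) \<Longrightarrow> tame (\<lambda>w. \<Sum>i\<in>I. f i w)"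
  by (induction I rule: infinite_finite_induct) (auto intro: tame_const tame_add)

lemma tame_prod: "(\<And>i. i \<in> I \<Longrightarrow> tame (f i)) \<Longrightarrow> tame (\<lambda>w. \<Prod>i\<in>I. f i w)"
  by (induction I rule: infinite_finite_induct) (auto intro: tame_const tame_mult)

lemma tame_power: "tame F \<Longrightarrow> tame (\<lambda>w. F w ^ n)"
  by (induction n) (auto intro: tame_const tame_mult)

lemma prod_shift:
  assumes "v \<in> V"
  shows "(\<Prod>u\<in>V. w u ^ (\<alpha>(v := k)) u) = w v ^ k * (\<Prod>u\<in>V-{v}. w u ^ \<alpha> u :: complex)"
  using fin assms by (subst prod.remove[of V v]) (auto intro!: prod.cong)

lemma tame_T: "v \<in> T \<Longrightarrow> tame (\<lambda>w. w v)"
  unfolding tame_def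
proof (intro exI[of _ 1] allI impI)
  fix D f assume v: "v \<in> T" and f: "f \<in> mspan D"
  show "(\<lambda>w. w v * f w) \<in> mspan (D + 1)"
  proof (rule mspan_monom_linear[OF f])
    fix \<alpha> assume \<alpha>: "\<alpha> \<in> exps D"
    have "\<alpha>(v := Suc (\<alpha> v)) \<in> exps (D + 1)"
      using \<alpha> v TV by (auto simp: exps_def PiE_iff extensional_def split: if_splits)
    from mspan_monom[OF this] show "(\<lambda>w. w v * (\<Prod>v\<in>V. w v ^ \<alpha> v)) \<in> mspan (D + 1)"
      using v TV prod_shift[of v _ \<alpha>] fin by (simp add: prod.remove[of V v] subset_iff mult.assoc)
  qed
qed

lemma tame_poly_T: "f \<in> polys_in T \<Longrightarrow> tame (\<lambda>w. peval w f)"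
  unfolding peval_def poly_subst_def
  by (intro tame_sum tame_mult tame_prod tame_power tame_const tame_T)
     (auto simp: polys_in_def poly_vars_def)

lemma tame_h: "tame (\<lambda>w. peval w h)"
  by (rule tame_poly_T) (auto simp: h_def intro!: polys_in_prod hT)

text \<open>If the exponent of an algebraic coordinate \<open>v\<close> would reach
  \<open>mm v\<close>, the relation, multiplied by the other factors of \<open>h\<close>, rewrites
  the monomial with smaller powers of \<open>v\<close> and coefficients in the coordinates
  \<open>T\<close>. This is where the factor \<open>h\<close> is spent.\<close>

lemma tame_Var:
  assumes "v \<in> V"
  shows "tame (\<lambda>w. peval w h * w v)"
proof (cases "v \<in> T")
  case True
  thus ?thesis by (intro tame_mult tame_h tame_T)
next
  case False
  hence v: "v \<in> V - T" using assms by simp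
  define g where "g j = (\<Prod>u\<in>V - T - {v}. hh u) * cc v j" for j
  have "g j \<in> polys_in T" for j using v by (auto simp: g_def intro!: polys_in_prod hT cT)
  hence "tame (\<lambda>w. peval w (g j))" for j by (rule tame_poly_T)
  then obtain k where k: "\<And>j D f. f \<in> mspan D \<Longrightarrow> (\<lambda>w. peval w (g j) * f w) \<in> mspan (D + k j)"
    unfolding tame_def by metis
  obtain l where l: "\<And>D f. f \<in> mspan D \<Longrightarrow> (\<lambda>w. peval w h * f w) \<in> mspan (D + l)"
    using tame_h unfolding tame_def by metis
  define \<kappa> where "\<kappa> = l + (\<Sum>j<mm v. k j)"
  have relh: "peval w h * w v ^ mm v = (\<Sum>j<mm v. peval w (g j) * w v ^ j)" if "w \<in> \<Omega>" for w
  proof -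
    have "peval w h * w v ^ mm v = (\<Prod>u\<in>V - T - {v}. peval w (hh u)) * (peval w (hh v) * w v ^ mm v)"
      using v fin by (simp add: h_def prod.remove[of "V - T" v])
    thus ?thesis using rel[OF v that] by (simp add: g_def sum_distrib_left mult.assoc)
  qed
  show ?thesis
    unfolding tame_def
  proof (intro exI[of _ \<kappa>] allI impI)
    fix D f assume f: "f \<in> mspan D"
    show "(\<lambda>w. peval w h * w v * f w) \<in> mspan (D + \<kappa>)"
    proof (rule mspan_monom_linear[OF f])
      fix \<alpha> assume \<alpha>: "\<alpha> \<in> exps D"
      hence av: "\<alpha> v < mm v" using v by (auto simp: exps_def PiE_iff)
      have up: "\<alpha>(v := j) \<in> exps D" if "j < mm v" for j
        using \<alpha> v that by (auto simp: exps_def PiE_iff extensional_def split: if_splits)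
      have mon: "w v * (\<Prod>v\<in>V. w v ^ \<alpha> v) = w v ^ Suc (\<alpha> v) * (\<Prod>u\<in>V-{v}. w u ^ \<alpha> u)" for w :: "'v \<Rightarrow> complex"
        using assms fin by (simp add: prod.remove[of V v])
      show "(\<lambda>w. peval w h * w v * (\<Prod>v\<in>V. w v ^ \<alpha> v)) \<in> mspan (D + \<kappa>)"
      proof (cases "Suc (\<alpha> v) < mm v")
        case True
        show ?thesis
        proof (rule mspan_cong[OF mspan_mono[OF _ l[OF mspan_monom[OF up[OF True]]]]])
          show "peval w h * w v * (\<Prod>v\<in>V. w v ^ \<alpha> v) =
              peval w h * (\<Prod>u\<in>V. w u ^ (\<alpha>(v := Suc (\<alpha> v))) u)" for w
            unfolding mult.assoc mon prod_shift[OF assms] ..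
        qed (simp add: \<kappa>_def)
      next
        case False
        hence e: "mm v = Suc (\<alpha> v)" using av by simp
        have "(\<lambda>w. \<Sum>j<mm v. peval w (g j) * (\<Prod>u\<in>V. w u ^ (\<alpha>(v := j)) u)) \<in> mspan (D + \<kappa>)"
        proof (rule mspan_sum)
          fix j assume j: "j \<in> {..<mm v}"
          have "k j \<le> \<kappa>" unfolding \<kappa>_def using j by (intro trans_le_add2 member_le_sum) auto
          thus "(\<lambda>w. peval w (g j) * (\<Prod>u\<in>V. w u ^ (\<alpha>(v := j)) u)) \<in> mspan (D + \<kappa>)"
            by (intro mspan_mono[OF _ k[OF mspan_monom[OF up]]]) (use j in auto)
        qed
        thus ?thesis
        proof (rule mspan_cong)
          fix w assume "w \<in> \<Omega>"
          have "peval w h * w v * (\<Prod>v\<in>V. w v ^ \<alpha> v) = (peval w h * w v ^ mm v) * (\<Prod>u\<in>V-{v}. w u ^ \<alpha> u)"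
            unfolding mult.assoc mon e by simp
          also have "\<dots> = (\<Sum>j<mm v. peval w (g j) * (\<Prod>u\<in>V. w u ^ (\<alpha>(v := j)) u))"
            unfolding relh[OF \<open>w \<in> \<Omega>\<close>] prod_shift[OF assms] by (simp add: sum_distrib_right mult.assoc)
          finally show "peval w h * w v * (\<Prod>v\<in>V. w v ^ \<alpha> v) = \<dots>" .
        qed
      qed
    qed
  qed
qed

lemma tame_poly:
  assumes "f \<in> polys_in V"
  shows "\<exists>e. tame (\<lambda>w. peval w h ^ e * peval w f)"
proof -
  \<comment> \<open>A monomial of degree at most \<open>e\<close> can give one factor
    \<open>h\<close> to each of its variables; the surplus is again a power of
    \<open>h\<close>.\<close>
  define e where "e = total_degree f"
  have "tame (\<lambda>w. peval w h ^ (e - monom_degree m) * (Poly_Mapping.lookup f m *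
      (\<Prod>i\<in>Poly_Mapping.keys m. (peval w h * w i) ^ Poly_Mapping.lookup m i)))"
    if "m \<in> Poly_Mapping.keys f" for m
    by (intro tame_mult tame_prod tame_power tame_const tame_Var tame_h)
       (use that assms in \<open>auto simp: polys_in_def poly_vars_def\<close>)
  hence "tame (\<lambda>w. \<Sum>m\<in>Poly_Mapping.keys f. peval w h ^ (e - monom_degree m) * (Poly_Mapping.lookup f m *
      (\<Prod>i\<in>Poly_Mapping.keys m. (peval w h * w i) ^ Poly_Mapping.lookup m i)))"
    by (intro tame_sum)
  moreover have "(\<Sum>m\<in>Poly_Mapping.keys f. peval w h ^ (e - monom_degree m) * (Poly_Mapping.lookup f m *
      (\<Prod>i\<in>Poly_Mapping.keys m. (peval w h * w i) ^ Poly_Mapping.lookup m i))) = peval w h ^ e * peval w f" for w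
    unfolding peval_def[of w f] poly_subst_def sum_distrib_left
  proof (rule sum.cong)
    fix m assume "m \<in> Poly_Mapping.keys f"
    hence "monom_degree m \<le> e" by (simp add: e_def monom_degree_le_total_degree)
    hence "peval w h ^ e = peval w h ^ (e - monom_degree m) * peval w h ^ monom_degree m"
      by (simp flip: power_add)
    thus "peval w h ^ (e - monom_degree m) * (Poly_Mapping.lookup f m *
      (\<Prod>i\<in>Poly_Mapping.keys m. (peval w h * w i) ^ Poly_Mapping.lookup m i)) =
      peval w h ^ e * (Poly_Mapping.lookup f m * (\<Prod>i\<in>Poly_Mapping.keys m. w i ^ Poly_Mapping.lookup m i))"
      by (simp add: power_mult_distrib prod.distrib monom_degree_def power_sum ac_simps)
  qed simp
  ultimately show ?thesis by auto
qed

lemma tame_iterate: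
  assumes k: "\<And>i D f. i \<in> A \<Longrightarrow> f \<in> mspan D \<Longrightarrow> (\<lambda>w. F i w * f w) \<in> mspan (D + \<kappa>)"
    and "finite A"
  shows "f \<in> mspan D \<Longrightarrow> (\<lambda>w. (\<Prod>i\<in>A. F i w ^ a i) * f w) \<in> mspan (D + \<kappa> * (\<Sum>i\<in>A. a i))"
  using assms(2,1)
proof (induction A)
  case empty
  thus ?case by simp
next
  case (insert i A)
  have "g \<in> mspan E \<Longrightarrow> (\<lambda>w. F i w ^ n * g w) \<in> mspan (E + \<kappa> * n)" for g E n
  proof (induction n)
    case (Suc n)
    from insert.prems(2)[of i, OF _ Suc.IH[OF Suc.prems]] show ?case
      by (simp add: mult.assoc ac_simps)
  qed simp
  from this[OF insert.IH[OF insert.prems(1)], of "a i"] insert.prems(2) insert.hyps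
  show ?case by (simp add: mult.assoc algebra_simps)
qed

text \<open>With \<open>a = card A\<close>, the \<open>(M + 1) ^ a\<close> products of the
  \<open>y i\<close> with exponents up to \<open>M\<close>, multiplied by a common power of
  \<open>h\<close>, lie in a span of order \<open>M ^ card T\<close> monomials. As
  \<open>a > card T\<close>, they are linearly dependent for suitable \<open>M\<close>, and the
  coefficients of the dependence are those of \<open>P\<close>. The power of \<open>h\<close> can be
  cancelled only where \<open>h\<close> is nonzero.\<close>

theorem dependent_polys:
  fixes y :: "'i \<Rightarrow> ('v, complex) mpoly"
  assumes "finite A" "card T < card A" "\<And>i. i \<in> A \<Longrightarrow> y i \<in> polys_in V"
  shows "\<exists>P :: ('i, complex) mpoly. P \<noteq> 0 \<and> poly_vars P \<subseteq> A \<and>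
    (\<forall>w\<in>\<Omega>. peval w h \<noteq> 0 \<longrightarrow> peval (\<lambda>i. peval w (y i)) P = 0)"
proof -
  have "\<forall>i\<in>A. \<exists>e. tame (\<lambda>w. peval w h ^ e * peval w (y i))"
    using tame_poly assms(3) by auto
  then obtain e' where e': "\<And>i. i \<in> A \<Longrightarrow> tame (\<lambda>w. peval w h ^ e' i * peval w (y i))"
    by metis
  define e where "e = (\<Sum>i\<in>A. e' i)"
  have e: "tame (\<lambda>w. peval w h ^ e * peval w (y i))" if "i \<in> A" for i
  proof -
    have "e' i \<le> e" unfolding e_def using that assms(1) by (auto intro: member_le_sum)
    hence "peval w h ^ e * peval w (y i) = peval w h ^ (e - e' i) * (peval w h ^ e' i * peval w (y i))" for w
      by (simp add: mult.assoc[symmetric] flip: power_add)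
    thus ?thesis by (simp only:) (intro tame_mult tame_power tame_h e'[OF that, unfolded])
  qed
  define F where "F i w = peval w h ^ e * peval w (y i)" for i w
  have "\<forall>i\<in>A. \<exists>k. \<forall>D f. f \<in> mspan D \<longrightarrow> (\<lambda>w. F i w * f w) \<in> mspan (D + k)"
    using e unfolding tame_def F_def by blast
  then obtain k where k: "\<And>i D f. i \<in> A \<Longrightarrow> f \<in> mspan D \<Longrightarrow> (\<lambda>w. F i w * f w) \<in> mspan (D + k i)"
    by metis
  obtain l where l: "\<And>D f. f \<in> mspan D \<Longrightarrow> (\<lambda>w. peval w h ^ e * f w) \<in> mspan (D + l)"
    using tame_power[OF tame_h] unfolding tame_def by metis
  define \<kappa> where "\<kappa> = l + (\<Sum>i\<in>A. k i)"
  have F\<kappa>: "(\<lambda>w. F i w * f w) \<in> mspan (D + \<kappa>)" if "i \<in> A" "f \<in> mspan D" for i f D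
    by (rule mspan_mono[OF _ k[OF that]])
       (use that assms(1) in \<open>auto simp: \<kappa>_def intro!: trans_le_add2 member_le_sum\<close>)
  have h\<kappa>: "(\<lambda>w. peval w h ^ e * f w) \<in> mspan (D + \<kappa>)" if "f \<in> mspan D" for f D
    by (rule mspan_mono[OF _ l[OF that]]) (simp add: \<kappa>_def)
  show ?thesis
  proof (cases "\<forall>v\<in>V - T. mm v > 0")
    \<comment> \<open>A relation of degree 0 says that \<open>hh v\<close>, hence \<open>h\<close>,
      vanishes on \<Omega>. The claim is then vacuous for \<open>P = 1\<close>.\<close>
    case False
    then obtain v where v: "v \<in> V - T" "mm v = 0" by auto
    have "peval w h = 0" if "w \<in> \<Omega>" for w
      using rel[OF v(1) that] v fin by (auto simp: h_def)
    thus ?thesis by (intro exI[of _ 1]) auto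
  next
    case pos: True
    have one: "(\<lambda>w. 1) \<in> mspan 0"
    proof -
      have "(\<lambda>v\<in>V. 0) \<in> exps 0" using pos by (auto simp: exps_def)
      from mspan_monom[OF this] show ?thesis by simp
    qed
    define C where "C = (\<Prod>v\<in>V - T. mm v)"
    define a where "a = card A"
    \<comment> \<open>\<open>K\<close> is such that \<open>D + 1 \<le> K * (M + 1)\<close>, so at
      most \<open>K ^ card T * C * (M + 1) ^ card T\<close> monomials are available. Taking
      \<open>M\<close> equal to the constant in front leaves \<open>M * (M + 1) ^ card T\<close>,
      which is less than \<open>(M + 1) ^ a\<close>.\<close>
    define K where "K = \<kappa> * a + 1"
    define M where "M = K ^ card T * C"
    define E where "E = (\<Pi>\<^sub>E i\<in>A. {..M})"
    have finE: "finite E" unfolding E_def using assms(1) by (intro finite_PiE) auto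
    have cardE: "card E = (M + 1) ^ a"
      unfolding E_def a_def using assms(1) by (simp add: card_PiE)
    define D where "D = \<kappa> * (a * M)"
    \<comment> \<open>The exponents of a product sum to at most \<open>a * M\<close>; the padding
      gives every product the same power of \<open>h\<close>, which then factors out of the
      relation.\<close>
    define G where "G \<beta> w = (peval w h ^ e) ^ (a * M - (\<Sum>i\<in>A. \<beta> i)) * (\<Prod>i\<in>A. F i w ^ \<beta> i)" for \<beta> w
    have sumE: "(\<Sum>i\<in>A. \<beta> i) \<le> a * M" if "\<beta> \<in> E" for \<beta>
      using sum_bounded_above[of A \<beta> M] that by (auto simp: E_def PiE_iff a_def)
    have inbox: "G \<beta> \<in> mspan D" if "\<beta> \<in> E" for \<beta>
    proof -
      let ?s = "\<Sum>i\<in>A. \<beta> i"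
      have 1: "(\<lambda>w. \<Prod>i\<in>A. F i w ^ \<beta> i) \<in> mspan (\<kappa> * ?s)"
        using tame_iterate[of A F \<kappa>, OF F\<kappa> assms(1) one, of \<beta>] by simp
      have "(\<lambda>w. (\<Prod>i\<in>{0::nat}. (peval w h ^ e) ^ (a * M - ?s)) * (\<Prod>i\<in>A. F i w ^ \<beta> i))
          \<in> mspan (\<kappa> * ?s + \<kappa> * (\<Sum>i\<in>{0::nat}. a * M - ?s))"
        by (rule tame_iterate[of "{0}" "\<lambda>_ w. peval w h ^ e" \<kappa>, OF h\<kappa> _ 1]) auto
      moreover have "\<kappa> * ?s + \<kappa> * (\<Sum>i\<in>{0::nat}. a * M - ?s) = D"
        using sumE[OF that] by (simp add: D_def flip: distrib_left)
      ultimately show ?thesis by (simp add: G_def[abs_def])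
    qed
    have "\<exists>c. \<forall>\<beta>\<in>E. \<forall>w\<in>\<Omega>. G \<beta> w = (\<Sum>\<alpha>\<in>exps D. c \<beta> \<alpha> * (\<Prod>v\<in>V. w v ^ \<alpha> v))"
      using inbox unfolding mspan_def mem_Collect_eq by (intro bchoice) auto
    then obtain c where c: "\<And>\<beta> w. \<beta> \<in> E \<Longrightarrow> w \<in> \<Omega> \<Longrightarrow>
        G \<beta> w = (\<Sum>\<alpha>\<in>exps D. c \<beta> \<alpha> * (\<Prod>v\<in>V. w v ^ \<alpha> v))" by blast
    have "card (exps D) < card E"
    proof -
      have "D + 1 \<le> K * (M + 1)" by (simp add: D_def K_def algebra_simps)
      hence "(D + 1) ^ card T * C \<le> (K * (M + 1)) ^ card T * C" by (intro mult_right_mono power_mono) auto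
      also have "\<dots> = (K ^ card T * C) * (M + 1) ^ card T" by (simp only: power_mult_distrib ac_simps)
      also have "\<dots> = M * (M + 1) ^ card T" by (simp only: M_def)
      also have "\<dots> < (M + 1) ^ Suc (card T)" by simp
      also have "\<dots> \<le> (M + 1) ^ a" using assms(2) unfolding a_def by (intro power_increasing) auto
      finally show ?thesis by (simp add: cardE card_exps C_def)
    qed
    from homogeneous_linear_system[OF finite_exps finE this, of c]
    obtain d where d: "\<exists>\<beta>\<in>E. d \<beta> \<noteq> 0" "\<And>\<alpha>. \<alpha> \<in> exps D \<Longrightarrow> (\<Sum>\<beta>\<in>E. d \<beta> * c \<beta> \<alpha>) = 0" by auto
    have rel0: "(\<Sum>\<beta>\<in>E. d \<beta> * G \<beta> w) = 0" if "w \<in> \<Omega>" for w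
    proof -
      have "(\<Sum>\<beta>\<in>E. d \<beta> * G \<beta> w) =
          (\<Sum>\<beta>\<in>E. \<Sum>\<alpha>\<in>exps D. d \<beta> * c \<beta> \<alpha> * (\<Prod>v\<in>V. w v ^ \<alpha> v))"
        using c that by (intro sum.cong) (auto simp: sum_distrib_left mult.assoc)
      also have "\<dots> = (\<Sum>\<alpha>\<in>exps D. (\<Sum>\<beta>\<in>E. d \<beta> * c \<beta> \<alpha>) * (\<Prod>v\<in>V. w v ^ \<alpha> v))"
        by (subst sum.swap) (simp add: sum_distrib_right)
      also have "\<dots> = 0" using d(2) by simp
      finally show ?thesis .
    qed
    define mon where "mon \<beta> = (\<Sum>i\<in>A. Poly_Mapping.single i (\<beta> i))" for \<beta> :: "'i \<Rightarrow> nat"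
    have lookup_mon: "Poly_Mapping.lookup (mon \<beta>) i = (if i \<in> A then \<beta> i else 0)" for \<beta> i
      using assms(1) by (auto simp: mon_def lookup_sum lookup_single when_def)
    have inj: "\<beta> = \<gamma>" if "\<beta> \<in> E" "\<gamma> \<in> E" "mon \<beta> = mon \<gamma>" for \<beta> \<gamma>
    proof (rule PiE_ext[OF that(1,2)[unfolded E_def]])
      fix i assume "i \<in> A"
      thus "\<beta> i = \<gamma> i" using that(3) lookup_mon[of \<beta> i] lookup_mon[of \<gamma> i] by simp
    qed
    define P where "P = (\<Sum>\<beta>\<in>E. Poly_Mapping.single (mon \<beta>) (d \<beta>))"
    from d(1) obtain \<beta>0 where \<beta>0: "\<beta>0 \<in> E" "d \<beta>0 \<noteq> 0" by auto
    have "Poly_Mapping.lookup P (mon \<beta>0) = (\<Sum>\<beta>\<in>E. if \<beta> = \<beta>0 then d \<beta> else 0)"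
      unfolding P_def lookup_sum lookup_single when_def
      by (rule sum.cong) (use inj \<beta>0(1) in auto)
    hence "P \<noteq> 0" using \<beta>0 finE by auto
    moreover have "poly_vars P \<subseteq> A"
    proof -
      have "P \<in> polys_in A"
        unfolding P_def
        by (rule polys_in_sum)
           (auto simp: polys_in_def poly_vars_def in_keys_iff lookup_mon lookup_single when_def split: if_splits)
      thus ?thesis by (simp add: polys_in_def)
    qed
    moreover have "peval (\<lambda>i. peval w (y i)) P = 0" if w: "w \<in> \<Omega>" and h0: "peval w h \<noteq> 0" for w
    proof -
      have em: "eval_monom z (mon \<beta>) = (\<Prod>i\<in>A. z i ^ \<beta> i)" for \<beta> and z :: "'i \<Rightarrow> complex"
        by (subst eval_monom_superset[OF assms(1)]) (auto simp: in_keys_iff lookup_mon split: if_splits)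
      have G: "G \<beta> w = (peval w h ^ e) ^ (a * M) * (\<Prod>i\<in>A. peval w (y i) ^ \<beta> i)" if "\<beta> \<in> E" for \<beta>
      proof -
        have "(peval w h ^ e) ^ (a * M) = (peval w h ^ e) ^ (a * M - (\<Sum>i\<in>A. \<beta> i)) * (peval w h ^ e) ^ (\<Sum>i\<in>A. \<beta> i)"
          using sumE[OF that] by (simp flip: power_add)
        thus ?thesis by (simp add: G_def F_def power_mult_distrib prod.distrib power_sum)
      qed
      have "(peval w h ^ e) ^ (a * M) * peval (\<lambda>i. peval w (y i)) P = (\<Sum>\<beta>\<in>E. d \<beta> * G \<beta> w)"
        unfolding P_def peval_sum sum_distrib_left
        by (rule sum.cong) (auto simp: G peval_def poly_subst_single em)
      thus ?thesis using rel0[OF w] h0 by simp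
    qed
    ultimately show ?thesis by blast
  qed
qed

end

section \<open>Unique factorization\<close>

lemma mpoly_is_unit_iff: "(f :: ('v, complex) mpoly) dvd 1 \<longleftrightarrow> f \<noteq> 0 \<and> total_degree f = 0"
proof
  assume "f dvd 1"
  then obtain g where g: "1 = f * g" by (elim dvdE)
  hence "f \<noteq> 0" "g \<noteq> 0" by auto
  moreover have "total_degree (1 :: ('v, complex) mpoly) = 0"
    by (auto simp: total_degree_eq_0 simp flip: Const_1)
  ultimately show "f \<noteq> 0 \<and> total_degree f = 0"
    using total_degree_mult[of f g] g by simp
next
  assume "f \<noteq> 0 \<and> total_degree f = 0"
  then obtain a where a: "f = Const a" "a \<noteq> 0" by (auto simp: total_degree_eq_0)
  hence "f * Const (1 / a) = 1" by (simp add: Const_1 flip: Const_mult)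
  thus "f dvd 1" by (metis dvd_triv_left)
qed

lemma mpoly_irreducible_factor:
  fixes f :: "('v, complex) mpoly"
  assumes "f \<noteq> 0" "\<not> f dvd 1"
  shows "\<exists>p. irreducible p \<and> p dvd f"
  using assms
proof (induction "total_degree f" arbitrary: f rule: less_induct)
  case less
  show ?case
  proof (cases "irreducible f")
    case False
    then obtain a b where ab: "f = a * b" "\<not> a dvd 1" "\<not> b dvd 1"
      using less.prems by (auto simp: irreducible_def)
    hence ne: "a \<noteq> 0" "b \<noteq> 0" using less.prems by auto
    hence "total_degree a < total_degree f"
      using ab by (simp add: total_degree_mult mpoly_is_unit_iff)
    from less.hyps[OF this ne(1) ab(2)] show ?thesis using ab(1) by auto
  qed auto
qed

text \<open>Degrees in a variable outside \<open>S\<close> add up to 0. For nonzero multiples,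
  divisibility thus means the same in the subring \<open>polys_in S\<close> as in the full
  ring.\<close>

lemma dvd_polys_in:
  fixes f :: "('v, complex) mpoly"
  assumes "a dvd f" "f \<noteq> 0" "f \<in> polys_in S"
  shows "a \<in> polys_in S"
proof -
  from assms obtain b where b: "f = a * b" "a \<noteq> 0" "b \<noteq> 0" by (auto simp: mpoly_mult_eq_0_iff)
  have "i \<notin> poly_vars a" if "i \<notin> S" for i
  proof -
    have "f \<in> polys_in (- {i})" using assms(3) that by (auto simp: polys_in_def)
    hence "degree (univ_at i f) = 0" by (simp add: degree_univ_at_0_iff)
    hence "degree (univ_at i a) = 0" using b degree_univ_at_mult(1)[OF b(2,3), of i] by simp
    thus ?thesis by (auto simp: degree_univ_at_0_iff polys_in_def)
  qed
  thus ?thesis by (auto simp: polys_in_def)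
qed

definition prime_in :: "'v set \<Rightarrow> ('v, complex) mpoly \<Rightarrow> bool"
  where "prime_in S p \<longleftrightarrow> p \<in> polys_in S \<and>
    (\<forall>g\<in>polys_in S. \<forall>h\<in>polys_in S. p dvd g * h \<longrightarrow> p dvd g \<or> p dvd h)"

lemma dvd_iff_dvd_coeffs:
  assumes "p \<in> polys_in (- {i})"
  shows "p dvd g \<longleftrightarrow> (\<forall>k. p dvd coeff (univ_at i g) k)"
proof
  assume "p dvd g"
  thus "\<forall>k. p dvd coeff (univ_at i g) k"
    using assms by (elim dvdE) (auto simp: univ_at_const)
next
  assume "\<forall>k. p dvd coeff (univ_at i g) k"
  hence "p dvd poly (univ_at i g) (Var i)"
    unfolding poly_altdef by (intro dvd_sum) auto
  thus "p dvd g" by (simp add: poly_univ_at)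
qed

lemma polys_in_insert: "f \<in> polys_in S \<Longrightarrow> f \<in> polys_in (insert i S)"
  by (auto simp: polys_in_def)

text \<open>Gauss's argument: with \<open>a\<close> and \<open>b\<close> the lowest degrees at which
  \<open>p\<close> fails to divide a coefficient of \<open>g\<close> and of \<open>h\<close>, all
  terms but one of the coefficient of \<open>g * h\<close> at \<open>a + b\<close> are divisible by
  \<open>p\<close>.\<close>

lemma prime_in_insert:
  assumes p: "prime_in S p" and "i \<notin> S"
  shows "prime_in (insert i S) p"
proof -
  have pS: "p \<in> polys_in S" using p by (simp add: prime_in_def)
  hence pi: "p \<in> polys_in (- {i})" using \<open>i \<notin> S\<close> by (auto simp: polys_in_def)
  show ?thesis
    unfolding prime_in_def
  proof (intro conjI ballI impI, goal_cases)
    case 1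
    show ?case using pS by (rule polys_in_insert)
  next
    case (2 g h)
    show ?case
    proof (rule ccontr)
      assume "\<not> (p dvd g \<or> p dvd h)"
      hence ex: "\<exists>k. \<not> p dvd coeff (univ_at i g) k" "\<exists>k. \<not> p dvd coeff (univ_at i h) k"
        using iffD2[OF dvd_iff_dvd_coeffs[OF pi], of g] iffD2[OF dvd_iff_dvd_coeffs[OF pi], of h] by blast+
      define a where "a = (LEAST k. \<not> p dvd coeff (univ_at i g) k)"
      define b where "b = (LEAST k. \<not> p dvd coeff (univ_at i h) k)"
      have a: "\<not> p dvd coeff (univ_at i g) a"
        unfolding a_def by (rule LeastI_ex[OF ex(1)])
      have a': "p dvd coeff (univ_at i g) k" if "k < a" for k
        using not_less_Least[OF that[unfolded a_def]] by simp
      have b: "\<not> p dvd coeff (univ_at i h) b"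
        unfolding b_def by (rule LeastI_ex[OF ex(2)])
      have b': "p dvd coeff (univ_at i h) k" if "k < b" for k
        using not_less_Least[OF that[unfolded b_def]] by simp
      have "p dvd coeff (univ_at i (g * h)) (a + b)"
        using iffD1[OF dvd_iff_dvd_coeffs[OF pi] 2(3)] by blast
      also have "coeff (univ_at i (g * h)) (a + b) =
          (\<Sum>k\<le>a + b. coeff (univ_at i g) k * coeff (univ_at i h) (a + b - k))"
        by (simp add: coeff_mult)
      also have "\<dots> = coeff (univ_at i g) a * coeff (univ_at i h) b +
          (\<Sum>k\<in>{..a + b} - {a}. coeff (univ_at i g) k * coeff (univ_at i h) (a + b - k))"
        by (subst sum.remove[of _ a]) auto
      finally have "p dvd coeff (univ_at i g) a * coeff (univ_at i h) b +
          (\<Sum>k\<in>{..a + b} - {a}. coeff (univ_at i g) k * coeff (univ_at i h) (a + b - k))" .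
      moreover have "p dvd (\<Sum>k\<in>{..a + b} - {a}. coeff (univ_at i g) k * coeff (univ_at i h) (a + b - k))"
      proof (rule dvd_sum)
        fix k assume "k \<in> {..a + b} - {a}"
        then consider "k < a" | "a + b - k < b" by fastforce
        thus "p dvd coeff (univ_at i g) k * coeff (univ_at i h) (a + b - k)"
          by cases (rule dvd_mult2[OF a'] dvd_mult[OF b'], assumption)+
      qed
      ultimately have "p dvd coeff (univ_at i g) a * coeff (univ_at i h) b"
        using dvd_add_left_iff by blast
      moreover have "coeff (univ_at i g) a \<in> polys_in S" "coeff (univ_at i h) b \<in> polys_in S"
        using 2(1,2) \<open>i \<notin> S\<close> by (auto intro: coeff_univ_at_in)
      ultimately show False using p a b unfolding prime_in_def by blast
    qed
  qed
qed

text \<open>One step of division, with \<open>e\<close> first multiplied by the leading coefficient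
  of \<open>m\<close>, since that coefficient need not be invertible. The alternative
  \<open>= 0\<close> covers \<open>n = 0\<close>, where the degree cannot drop.\<close>

lemma pseudo_reduction:
  fixes e m :: "('v, 'a::comm_ring_1) mpoly" and i :: 'v
  defines "l \<equiv> lead_coeff (univ_at i m)" and "c \<equiv> lead_coeff (univ_at i e)"
    and "n \<equiv> degree (univ_at i e)" and "d \<equiv> degree (univ_at i m)"
  assumes "degree (univ_at i m) \<le> degree (univ_at i e)"
  shows "degree (univ_at i (l * e - c * Var i ^ (n - d) * m)) < n \<or> l * e - c * Var i ^ (n - d) * m = 0"
proof -
  define e' where "e' = l * e - c * Var i ^ (n - d) * m"
  have dn: "d \<le> n" using assms by simp
  have lc: "l \<in> polys_in (- {i})" "c \<in> polys_in (- {i})" by (simp_all add: l_def c_def coeff_univ_at_in')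
  have U: "univ_at i e' = smult l (univ_at i e) - smult c (monom 1 (n - d) * univ_at i m)"
    by (simp add: e'_def univ_at_const[OF lc(1)] univ_at_const[OF lc(2)] univ_at_Var
        monom_altdef[of 1] mult.assoc flip: one_pCons)
  have "degree (univ_at i e') \<le> n"
    unfolding U by (intro degree_diff_le order.trans[OF degree_smult_le] order.trans[OF degree_mult_le])
      (use dn in \<open>auto simp: n_def d_def degree_monom_eq\<close>)
  moreover have "coeff (univ_at i e') n = 0"
    using dn by (simp add: U coeff_monom_mult) (simp add: n_def d_def l_def c_def)
  ultimately have "degree (univ_at i e') < n \<or> e' = 0"
    by (metis le_neq_implies_less leading_coeff_0_iff univ_at_eq_0_iff)
  thus ?thesis by (simp only: e'_def)
qed

text \<open>Over the field of fractions in the variables \<open>S\<close>, the ideal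
  \<open>A\<close> would be generated by a member \<open>m\<close> of least degree; the powers of
  its leading coefficient \<open>l\<close> are the cleared denominators.\<close>

lemma pseudo_division:
  fixes A :: "('v, complex) mpoly set"
  assumes i: "i \<notin> S" and A: "A \<subseteq> polys_in (insert i S)" "\<exists>e\<in>A. e \<noteq> 0"
    and diff: "\<And>e e'. e \<in> A \<Longrightarrow> e' \<in> A \<Longrightarrow> e - e' \<in> A"
    and mult: "\<And>r e. r \<in> polys_in (insert i S) \<Longrightarrow> e \<in> A \<Longrightarrow> r * e \<in> A"
  obtains m l where "m \<in> A" "m \<noteq> 0" "l \<noteq> 0" "l \<in> polys_in S"
    "\<And>e. e \<in> A \<Longrightarrow> \<exists>k. \<exists>q\<in>polys_in (insert i S). l ^ k * e = q * m"
proof -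
  obtain m where m: "m \<in> A" "m \<noteq> 0"
    and min: "\<And>e. e \<in> A \<Longrightarrow> e \<noteq> 0 \<Longrightarrow> degree (univ_at i m) \<le> degree (univ_at i e)"
    using A(2) ex_has_least_nat[of "\<lambda>e. e \<in> A \<and> e \<noteq> 0" _ "\<lambda>e. degree (univ_at i e)"] by blast
  define l where "l = lead_coeff (univ_at i m)"
  define d where "d = degree (univ_at i m)"
  have l: "l \<noteq> 0" "l \<in> polys_in S" using m A i by (auto simp: l_def intro!: coeff_univ_at_in)
  have "\<exists>k. \<exists>q\<in>polys_in (insert i S). l ^ k * e = q * m" if "e \<in> A" for e
    using that
  proof (induction "degree (univ_at i e)" arbitrary: e rule: less_induct)
    case less
    show ?case
    proof (cases "e = 0")
      case True
      thus ?thesis by (intro exI[of _ 0] bexI[of _ 0]) auto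
    next
      case False
      define n where "n = degree (univ_at i e)"
      define c where "c = lead_coeff (univ_at i e)"
      have c: "c \<in> polys_in S" using less.prems A i by (auto simp: c_def intro!: coeff_univ_at_in)
      have dn: "d \<le> n" unfolding d_def n_def by (rule min) fact+
      define e' where "e' = l * e - c * Var i ^ (n - d) * m"
      have lc: "l \<in> polys_in (insert i S)" "c \<in> polys_in (insert i S)"
        using l c by (auto intro: polys_in_insert)
      have cx: "c * Var i ^ (n - d) \<in> polys_in (insert i S)" using lc by auto
      have e'A: "e' \<in> A" unfolding e'_def using lc cx less.prems m by (intro diff mult)
      have "degree (univ_at i e') < n \<or> e' = 0"
        using pseudo_reduction[OF dn[unfolded d_def n_def]] by (simp add: e'_def l_def c_def n_def d_def)
      then obtain k q where q: "q \<in> polys_in (insert i S)" "l ^ k * e' = q * m"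
      proof
        assume "degree (univ_at i e') < n"
        from less.hyps[OF this[unfolded n_def] e'A] that show thesis by auto
      next
        assume "e' = 0"
        thus thesis using that[of 0 0] by simp
      qed
      have "l ^ Suc k * e = l ^ k * e' + l ^ k * (c * Var i ^ (n - d)) * m"
        by (simp add: e'_def algebra_simps)
      also have "\<dots> = (q + l ^ k * (c * Var i ^ (n - d))) * m"
        by (simp only: q(2) distrib_right)
      finally show ?thesis using q(1) cx lc by (intro exI[of _ "Suc k"] bexI[of _ "q + l ^ k * (c * Var i ^ (n - d))"]) auto
    qed
  qed
  thus ?thesis using m l that by blast
qed

text \<open>\<open>m\<close> is a greatest common divisor of \<open>f\<close> and \<open>g\<close>
  over the fractions in \<open>S\<close>, given with its Bezout representation; powers of
  \<open>l\<close> clear the denominators of the quotients.\<close>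

lemma pseudo_division_pair:
  fixes f g :: "('v, complex) mpoly"
  assumes i: "i \<notin> S" and fg: "f \<in> polys_in (insert i S)" "g \<in> polys_in (insert i S)" "f \<noteq> 0"
  defines "R \<equiv> polys_in (insert i S)"
  shows "\<exists>m l. (\<exists>\<alpha>\<in>R. \<exists>\<beta>\<in>R. m = \<alpha> * f + \<beta> * g) \<and> m \<noteq> 0 \<and> l \<in> polys_in S \<and> l \<noteq> 0 \<and>
    (\<exists>k. \<exists>q\<in>R. l ^ k * f = q * m) \<and> (\<exists>k. \<exists>q\<in>R. l ^ k * g = q * m)"
proof -
  let ?R = "polys_in (insert i S) :: ('v, complex) mpoly set"
  define A where "A = {\<alpha> * f + \<beta> * g | \<alpha> \<beta>. \<alpha> \<in> ?R \<and> \<beta> \<in> ?R}"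
  have fA: "f \<in> A" unfolding A_def by (intro CollectI exI[of _ 1] exI[of _ 0]) auto
  have gA: "g \<in> A" unfolding A_def by (intro CollectI exI[of _ 0] exI[of _ 1]) auto
  have AR: "A \<subseteq> ?R" using fg by (auto simp: A_def)
  obtain m l where m: "m \<in> A" "m \<noteq> 0" "l \<noteq> 0" "l \<in> polys_in S"
    and div: "\<And>e. e \<in> A \<Longrightarrow> \<exists>k. \<exists>q\<in>?R. l ^ k * e = q * m"
  proof (rule pseudo_division[OF i AR])
    show "\<exists>e\<in>A. e \<noteq> 0" using fA fg(3) by auto
    show "e - e' \<in> A" if ee: "e \<in> A" "e' \<in> A" for e e'
    proof -
      from ee obtain \<alpha> \<beta> \<alpha>' \<beta>' where *: "e = \<alpha> * f + \<beta> * g" "e' = \<alpha>' * f + \<beta>' * g"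
        "\<alpha> \<in> ?R" "\<beta> \<in> ?R" "\<alpha>' \<in> ?R" "\<beta>' \<in> ?R" unfolding A_def by blast
      have "e - e' = (\<alpha> - \<alpha>') * f + (\<beta> - \<beta>') * g" by (simp add: * algebra_simps)
      thus ?thesis unfolding A_def using * by blast
    qed
    show "r * e \<in> A" if re: "r \<in> ?R" "e \<in> A" for r e
    proof -
      from re obtain \<alpha> \<beta> where *: "e = \<alpha> * f + \<beta> * g" "\<alpha> \<in> ?R" "\<beta> \<in> ?R" unfolding A_def by blast
      have "r * e = (r * \<alpha>) * f + (r * \<beta>) * g" by (simp add: * algebra_simps)
      thus ?thesis unfolding A_def using * re by blast
    qed
  qed blast
  have "\<exists>\<alpha>\<in>?R. \<exists>\<beta>\<in>?R. m = \<alpha> * f + \<beta> * g" using m(1) unfolding A_def by blast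
  thus ?thesis unfolding R_def using m(2-4) div[OF fA] div[OF gA] by (intro exI[of _ m] exI[of _ l] conjI)
qed

text \<open>Let \<open>i\<close> occur in \<open>f\<close>, let \<open>f\<close> divide
  \<open>g * h\<close>, and let \<open>m\<close> be the common divisor of \<open>f\<close> and
  \<open>g\<close> over the fractions in \<open>S\<close>. Up to factors free of \<open>i\<close>,
  either \<open>m\<close> is \<open>f\<close>, which then divides \<open>g\<close>; or
  \<open>m\<close> is itself free of \<open>i\<close>, and the Bezout representation shows that
  \<open>f\<close> divides \<open>m * h\<close>, hence \<open>h\<close>.\<close>

lemma irreducible_imp_prime_in:
  fixes f :: "('v, complex) mpoly"
  assumes "finite S"
  shows "f \<in> polys_in S \<Longrightarrow> irreducible f \<Longrightarrow> prime_in S f"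
  using assms
proof (induction S arbitrary: f rule: finite_induct)
  case empty
  then obtain a where "f = Const a" by (auto simp: polys_in_empty)
  hence "total_degree f = 0" by (auto simp: total_degree_eq_0)
  hence "f dvd 1" using empty.prems by (auto simp: mpoly_is_unit_iff irreducible_def)
  thus ?case using empty.prems by (simp add: irreducible_def)
next
  case (insert i S)
  have prime_factor: "\<exists>p c'. c = p * c' \<and> irreducible p \<and> prime_in (insert i S) p \<and> p \<in> polys_in S
      \<and> c' \<noteq> 0 \<and> c' \<in> polys_in S \<and> total_degree c' < total_degree c"
    if c: "c \<in> polys_in S" "c \<noteq> 0" "total_degree c \<noteq> 0" for c
  proof -
    obtain p where p: "irreducible p" "p dvd c"
      using mpoly_irreducible_factor[of c] c by (auto simp: mpoly_is_unit_iff)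
    then obtain c' where c': "c = p * c'" by (elim dvdE)
    have "p \<in> polys_in S" "c' \<in> polys_in S"
      using dvd_polys_in[OF _ c(2,1)] c' by auto
    moreover have "p \<noteq> 0" "c' \<noteq> 0" using c c' by auto
    moreover have "total_degree p > 0" using p \<open>p \<noteq> 0\<close> by (auto simp: irreducible_def mpoly_is_unit_iff)
    moreover have "prime_in (insert i S) p"
      using insert.IH[of p] \<open>p \<in> polys_in S\<close> p(1) insert.hyps(2) by (intro prime_in_insert) auto
    ultimately show ?thesis
      using c' p(1) by (intro exI[of _ p] exI[of _ c']) (simp add: total_degree_mult)
  qed
  show ?case
  proof (cases "f \<in> polys_in S")
    case True
    thus ?thesis using insert by (intro prime_in_insert) auto
  next
    case fS: False
    have f0: "f \<noteq> 0" "\<not> f dvd 1" using insert.prems by (auto simp: irreducible_def)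
    \<comment> \<open>Factors free of \<open>i\<close> can be cancelled: if one of their prime
      factors divided \<open>f\<close>, then \<open>f\<close> would be its associate and free of
      \<open>i\<close> too.\<close>
    have cancel: "f dvd h" if "c \<in> polys_in S" "c \<noteq> 0" "h \<in> polys_in (insert i S)" "f dvd c * h" for c h
      using that
    proof (induction "total_degree c" arbitrary: c rule: less_induct)
      case (less c)
      show ?case
      proof (cases "total_degree c = 0")
        case True
        hence "c dvd 1" using less.prems by (simp add: mpoly_is_unit_iff)
        then obtain u where "1 = c * u" by (elim dvdE)
        have "(c * h) * u = (c * u) * h" by (simp only: ac_simps)
        also have "\<dots> = h" by (simp flip: \<open>1 = c * u\<close>)
        finally show ?thesis using dvd_mult2[OF less.prems(4), of u] by simp
      next
        case False
        then obtain p c' where p: "c = p * c'" "irreducible p" "prime_in (insert i S) p" "p \<in> polys_in S"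
          "c' \<noteq> 0" "c' \<in> polys_in S" "total_degree c' < total_degree c"
          using prime_factor less.prems by blast
        from less.prems(4) obtain s where s: "c * h = f * s" by (elim dvdE)
        have "c' * h \<noteq> 0 \<or> h = 0" using p by (simp add: mpoly_mult_eq_0_iff)
        show ?thesis
        proof (cases "h = 0")
          case False
          have "s \<in> polys_in (insert i S)"
          proof (rule dvd_polys_in)
            show "s dvd c * h" using s by simp
            show "c * h \<noteq> 0" using False less.prems by (simp add: mpoly_mult_eq_0_iff)
            show "c * h \<in> polys_in (insert i S)"
              using less.prems by (intro polys_in_mult) (auto intro: polys_in_insert)
          qed
          moreover have "p dvd f * s" using s p(1) by (metis dvd_triv_left mult.assoc)
          ultimately have "p dvd f \<or> p dvd s" using p(3) insert.prems by (auto simp: prime_in_def)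
          moreover have "\<not> p dvd f"
          proof
            assume "p dvd f"
            then obtain u where u: "f = p * u" by (elim dvdE)
            have "u dvd 1" using insert.prems(2) u p(2) by (auto simp: irreducible_def)
            then obtain a where "u = Const a" by (auto simp: mpoly_is_unit_iff total_degree_eq_0)
            hence "f \<in> polys_in S" using u p(4) by auto
            thus False using fS by simp
          qed
          ultimately obtain s' where "s = p * s'" by (auto elim: dvdE)
          hence "p * (c' * h) = p * (f * s')" using s p(1) by (simp add: ac_simps)
          hence "c' * h = f * s'" using p(2) mpoly_mult_cancel by (auto simp: irreducible_def)
          hence "f dvd c' * h" by simp
          thus ?thesis using less.hyps[OF p(7,6,5) less.prems(3)] by simp
        qed auto
      qed
    qed
    \<comment> \<open>Turns a factorization of \<open>f\<close> with denominator \<open>c\<close>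
      into one without: each prime factor of \<open>c\<close> divides \<open>q\<close> or
      \<open>m\<close> and is removed there. The new factor \<open>m'\<close> differs from
      \<open>m\<close> only by factors free of \<open>i\<close>.\<close>
    have gauss: "\<exists>q' m' a b. f = q' * m' \<and> a * m = b * m' \<and> a \<noteq> 0 \<and> b \<noteq> 0 \<and> a \<in> polys_in S \<and> b \<in> polys_in S"
      if "c \<in> polys_in S" "c \<noteq> 0" "q \<in> polys_in (insert i S)" "m \<in> polys_in (insert i S)" "c * f = q * m"
      for c q m
      using that
    proof (induction "total_degree c" arbitrary: c q m rule: less_induct)
      case (less c)
      show ?case
      proof (cases "total_degree c = 0")
        case True
        hence "c dvd 1" using less.prems by (simp add: mpoly_is_unit_iff)
        then obtain u where "1 = c * u" by (elim dvdE)
        have "(u * q) * m = u * (c * f)" by (simp only: less.prems(5) mult.assoc)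
        also have "\<dots> = (c * u) * f" by (simp only: ac_simps)
        also have "\<dots> = f" by (simp flip: \<open>1 = c * u\<close>)
        finally have "f = (u * q) * m" ..
        thus ?thesis by (intro exI[of _ "u * q"] exI[of _ m] exI[of _ 1]) auto
      next
        case False
        then obtain p c' where p: "c = p * c'" "irreducible p" "prime_in (insert i S) p" "p \<in> polys_in S"
          "c' \<noteq> 0" "c' \<in> polys_in S" "total_degree c' < total_degree c"
          using prime_factor less.prems by blast
        have p0: "p \<noteq> 0" using p(2) by (auto simp: irreducible_def)
        have qm: "q * m \<noteq> 0" using less.prems(2,5) f0 by (metis mpoly_mult_eq_0_iff)
        have "p dvd q * m" using less.prems(5) p(1) by (metis dvd_triv_left mult.assoc)
        hence "p dvd q \<or> p dvd m" using p(3) less.prems by (auto simp: prime_in_def)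
        thus ?thesis
        proof
          assume "p dvd q"
          then obtain q1 where q1: "q = p * q1" by (elim dvdE)
          have "q1 \<in> polys_in (insert i S)"
            by (rule dvd_polys_in[OF _ _ less.prems(3)]) (use q1 qm in auto)
          moreover have "c' * f = q1 * m"
            using less.prems(5) p(1) q1 p0 mpoly_mult_cancel[of p "c' * f" "q1 * m"] by (simp add: ac_simps)
          ultimately show ?thesis using less.hyps[OF p(7,6,5) _ less.prems(4)] by blast
        next
          assume "p dvd m"
          then obtain m1 where m1: "m = p * m1" by (elim dvdE)
          have m1S: "m1 \<in> polys_in (insert i S)"
            by (rule dvd_polys_in[OF _ _ less.prems(4)]) (use m1 qm in auto)
          have "c' * f = q * m1"
            using less.prems(5) p(1) m1 p0 mpoly_mult_cancel[of p "c' * f" "q * m1"] by (simp add: ac_simps)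
          from less.hyps[OF p(7,6,5) less.prems(3) m1S this] obtain q' m' a b
            where *: "f = q' * m'" "a * m1 = b * m'" "a \<noteq> 0" "b \<noteq> 0" "a \<in> polys_in S" "b \<in> polys_in S"
            by blast
          have "a * m = p * (a * m1)" by (simp only: m1 ac_simps)
          also have "\<dots> = (p * b) * m'" by (simp only: *(2) mult.assoc)
          finally have "a * m = (p * b) * m'" .
          moreover have "p * b \<noteq> 0" "p * b \<in> polys_in S" using * p p0 by (auto simp: mpoly_mult_eq_0_iff)
          ultimately show ?thesis using * by blast
        qed
      qed
    qed
    show ?thesis
      unfolding prime_in_def
    proof (intro conjI ballI impI, goal_cases)
      case 1
      show ?case by (rule insert.prems)
    next
      case (2 g h)
      let ?R = "polys_in (insert i S) :: ('v, complex) mpoly set"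
      obtain m l where ml: "\<exists>\<alpha>\<in>?R. \<exists>\<beta>\<in>?R. m = \<alpha> * f + \<beta> * g" and m: "m \<noteq> 0" "l \<in> polys_in S" "l \<noteq> 0"
        and div: "\<exists>k. \<exists>q\<in>?R. l ^ k * f = q * m" "\<exists>k. \<exists>q\<in>?R. l ^ k * g = q * m"
        using pseudo_division_pair[OF insert.hyps(2) insert.prems(1) 2(1) f0(1)]
        by (elim exE conjE) (rule that; (assumption | rule exI, assumption))
      obtain \<alpha> \<beta> where \<alpha>\<beta>: "\<alpha> \<in> ?R" "\<beta> \<in> ?R" "m = \<alpha> * f + \<beta> * g" using ml by blast
      have mR: "m \<in> ?R" unfolding \<alpha>\<beta>(3) using \<alpha>\<beta>(1,2) insert.prems(1) 2(1) by (intro polys_in_add polys_in_mult)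
      obtain k q where q: "q \<in> ?R" "l ^ k * f = q * m" using div(1) by blast
      obtain k2 q2 where q2: "l ^ k2 * g = q2 * m" using div(2) by blast
      obtain q' m' a b where g1: "f = q' * m'" "a * m = b * m'" "a \<noteq> 0" "b \<noteq> 0" "a \<in> polys_in S" "b \<in> polys_in S"
        using gauss[OF _ _ q(1) mR q(2)] m by (auto simp: mpoly_power_eq_0_iff)
      from insert.prems(2) g1(1) have "q' dvd 1 \<or> m' dvd 1" by (simp add: irreducible_def)
      thus ?case
      proof
        assume "q' dvd 1"
        then obtain u where u: "1 = q' * u" by (elim dvdE)
        have "u * f = (q' * u) * m'" by (simp only: g1(1) ac_simps)
        also have "\<dots> = m'" by (simp flip: u)
        finally have m'f: "m' = u * f" ..
        have "(a * l ^ k2) * g = q2 * (a * m)" using q2 by (simp add: ac_simps)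
        also have "\<dots> = f * (q2 * b * u)" unfolding g1(2) m'f by (simp add: ac_simps)
        finally have "f dvd (a * l ^ k2) * g" by simp
        moreover have "a * l ^ k2 \<in> polys_in S" using g1(5) m(2) by (intro polys_in_mult polys_in_power)
        moreover have "a * l ^ k2 \<noteq> 0" using g1(3) m(3) by (simp add: mpoly_mult_eq_0_iff mpoly_power_eq_0_iff)
        ultimately have "f dvd g" using cancel 2(1) by blast
        thus ?case ..
      next
        assume "m' dvd 1"
        then obtain c where c: "m' = Const c" "m' \<noteq> 0"
          by (auto simp: mpoly_is_unit_iff total_degree_eq_0)
        have "m \<in> polys_in S"
        proof (rule dvd_polys_in)
          show "m dvd b * m'" using g1(2) by (metis dvd_triv_right)
          show "b * m' \<noteq> 0" using g1 c by (simp add: mpoly_mult_eq_0_iff)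
          show "b * m' \<in> polys_in S" using g1 c by auto
        qed
        moreover have "f dvd m * h"
        proof -
          have "m * h = f * (\<alpha> * h) + \<beta> * (g * h)" by (simp add: \<alpha>\<beta>(3) algebra_simps)
          thus ?thesis using 2(3) by auto
        qed
        ultimately have "f dvd h" using cancel[of m h] m(1) 2(2) by blast
        thus ?case ..
      qed
    qed
  qed
qed

lemma irreducible_imp_prime_mpoly:
  fixes f :: "('v::finite, complex) mpoly"
  assumes "irreducible f"
  shows "prime_elem f"
proof -
  have "prime_in UNIV f" by (rule irreducible_imp_prime_in) (use assms in auto)
  thus ?thesis using assms unfolding prime_in_def prime_elem_def irreducible_def by simp
qed

text \<open>As \<open>F\<close> is prime, involves \<open>i\<close> and does not divide
  \<open>G\<close>, the two are coprime over the fractions in the other variables. Concretely,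
  \<open>F\<close> divides \<open>q * m\<close> but cannot divide \<open>m\<close>, so it divides
  \<open>q\<close>; then \<open>m\<close> divides a power of \<open>l\<close> and is free of
  \<open>i\<close>.\<close>

lemma mpoly_elimination:
  fixes F G :: "('v, complex) mpoly"
  assumes F: "prime_elem F" "F \<notin> polys_in (- {i})" and G: "\<not> F dvd G"
  shows "\<exists>\<alpha> \<beta>. \<alpha> * F + \<beta> * G \<noteq> 0 \<and> \<alpha> * F + \<beta> * G \<in> polys_in (- {i})"
proof -
  have UN: "insert i (- {i}) = UNIV" by auto
  have "F \<noteq> 0" using F(1) by (simp add: prime_elem_def)
  then obtain m l where ml: "\<exists>\<alpha>\<in>UNIV. \<exists>\<beta>\<in>UNIV. m = \<alpha> * F + \<beta> * G"
    and m: "m \<noteq> 0" "l \<in> polys_in (- {i})" "l \<noteq> 0"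
    and div: "\<exists>k. \<exists>q\<in>UNIV. l ^ k * F = q * m" "\<exists>k. \<exists>q\<in>UNIV. l ^ k * G = q * m"
    using pseudo_division_pair[of i "- {i}" F G] unfolding UN polys_in_UNIV by auto
  obtain \<alpha> \<beta> where \<alpha>\<beta>: "m = \<alpha> * F + \<beta> * G" using ml by blast
  obtain k q where q: "l ^ k * F = q * m" using div(1) by blast
  obtain k2 q2 where q2: "l ^ k2 * G = q2 * m" using div(2) by blast
  have nl: "\<not> F dvd l ^ n" for n
  proof
    assume "F dvd l ^ n"
    from dvd_polys_in[OF this] m F(2) show False by (auto simp: mpoly_power_eq_0_iff)
  qed
  have "F dvd q * m" using q by (metis dvd_triv_right)
  hence "F dvd q \<or> F dvd m" using F(1) prime_elem_dvd_multD by blast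
  hence "m \<in> polys_in (- {i})"
  proof
    assume "F dvd q"
    then obtain q1 where "q = F * q1" by (elim dvdE)
    hence "F * l ^ k = F * (q1 * m)" using q by (simp add: ac_simps)
    hence "l ^ k = q1 * m" using F(1) mpoly_mult_cancel by (auto simp: prime_elem_def)
    hence "m dvd l ^ k" by simp
    thus ?thesis by (rule dvd_polys_in) (use m in \<open>auto simp: mpoly_power_eq_0_iff\<close>)
  next
    assume "F dvd m"
    hence "F dvd l ^ k2 * G" using q2 by simp
    thus ?thesis using F(1) nl G prime_elem_dvd_multD by blast
  qed
  thus ?thesis using m(1) unfolding \<alpha>\<beta> by blast
qed

section \<open>Complex conjugation of polynomials\<close>

definition cnj_poly :: "('v, complex) mpoly \<Rightarrow> ('v, complex) mpoly"
  where "cnj_poly f = poly_subst (\<lambda>a. Const (cnj a)) Var f"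

lemma coeff_hom_Const_cnj: "coeff_hom (\<lambda>a. Const (cnj a))"
  by (simp add: coeff_hom_def Const_0 Const_1 Const_add Const_mult)

lemma cnj_poly_add [simp]: "cnj_poly (f + g) = cnj_poly f + cnj_poly g"
  and cnj_poly_mult [simp]: "cnj_poly (f * g) = cnj_poly f * cnj_poly g"
  and cnj_poly_Const [simp]: "cnj_poly (Const a) = Const (cnj a)"
  and cnj_poly_Var [simp]: "cnj_poly (Var i) = Var i"
  and cnj_poly_0 [simp]: "cnj_poly 0 = 0"
  by (simp_all add: cnj_poly_def coeff_hom_Const_cnj poly_subst_add poly_subst_mult poly_subst_Const
      poly_subst_Var poly_subst_0)

lemma cnj_poly_1 [simp]: "cnj_poly 1 = 1"
  by (metis Const_1 cnj_poly_Const complex_cnj_one)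

lemma cnj_poly_diff [simp]: "cnj_poly (f - g) = cnj_poly f - cnj_poly g"
  by (metis diff_add_cancel eq_diff_eq cnj_poly_add)

lemma cnj_poly_sum [simp]: "cnj_poly (\<Sum>i\<in>A. f i) = (\<Sum>i\<in>A. cnj_poly (f i))"
  by (induction A rule: infinite_finite_induct) auto

lemma cnj_poly_cnj_poly [simp]: "cnj_poly (cnj_poly f) = f"
  by (induction f rule: mpoly_induct) auto

lemma peval_cnj_poly: "peval x (cnj_poly f) = cnj (peval (\<lambda>i. cnj (x i)) f)"
  by (induction f rule: mpoly_induct) auto

lemma partial_deriv_cnj_poly: "partial_deriv i (cnj_poly f) = cnj_poly (partial_deriv i f)"
  by (induction f rule: mpoly_induct) (auto simp: partial_deriv_Var)

lemma vector_field_cnj_poly: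
  "vector_field (\<lambda>i. cnj_poly (b i)) (cnj_poly f) = cnj_poly (vector_field b f)"
  by (simp add: vector_field_def partial_deriv_cnj_poly)

text \<open>Real coefficients are expressed as invariance under conjugation, so that the polynomials
  keep their complex type.\<close>

definition real_poly :: "('v, complex) mpoly \<Rightarrow> bool"
  where "real_poly f \<longleftrightarrow> cnj_poly f = f"

lemma real_poly_peval:
  assumes "real_poly f" "\<And>i. x i \<in> \<real>"
  shows "peval x f \<in> \<real>"
proof -
  have "(\<lambda>i. cnj (x i)) = x" using assms(2) by (auto simp: Reals_cnj_iff)
  thus ?thesis using peval_cnj_poly[of x f] assms(1) by (simp add: real_poly_def Reals_cnj_iff)
qed

lemma real_poly_Const: "a \<in> \<real> \<Longrightarrow> real_poly (Const a)"
  and real_poly_1: "real_poly 1"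
  and real_poly_Var: "real_poly (Var i)"
  and real_poly_diff: "real_poly f \<Longrightarrow> real_poly g \<Longrightarrow> real_poly (f - g)"
  and real_poly_mult: "real_poly f \<Longrightarrow> real_poly g \<Longrightarrow> real_poly (f * g)"
  by (auto simp: real_poly_def Reals_cnj_iff)

lemma real_poly_vector_field:
  assumes "\<And>i. real_poly (b i)" "real_poly f"
  shows "real_poly (vector_field b f)"
proof -
  have "(\<lambda>i. cnj_poly (b i)) = b" using assms(1) by (auto simp: real_poly_def)
  thus ?thesis using vector_field_cnj_poly[of b f] assms(2) by (simp add: real_poly_def)
qed

lemma real_poly_gradient:
  assumes "real_poly g" "\<And>i. x $ i \<in> \<real>"
  shows "gradient g x $ i \<in> \<real>"
proof -
  have "real_poly (partial_deriv i g)"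
    using assms(1) partial_deriv_cnj_poly[of i g] by (simp add: real_poly_def)
  thus ?thesis using assms(2) by (simp add: gradient_def real_poly_peval)
qed

section \<open>Integral curves of polynomial vector fields\<close>

definition coeff_norm :: "('v, complex) mpoly \<Rightarrow> real"
  where "coeff_norm f = (\<Sum>m\<in>Poly_Mapping.keys f. cmod (Poly_Mapping.lookup f m))"

lemma coeff_norm_superset:
  "finite K \<Longrightarrow> Poly_Mapping.keys f \<subseteq> K \<Longrightarrow> coeff_norm f = (\<Sum>m\<in>K. cmod (Poly_Mapping.lookup f m))"
  unfolding coeff_norm_def by (rule sum.mono_neutral_left) (auto simp: in_keys_iff)

lemma coeff_norm_nonneg: "0 \<le> coeff_norm f"
  by (simp add: coeff_norm_def sum_nonneg)

lemma coeff_norm_0 [simp]: "coeff_norm 0 = 0"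
  by (simp add: coeff_norm_def)

lemma coeff_norm_single: "coeff_norm (Poly_Mapping.single m a) = cmod a"
  by (cases "a = 0") (auto simp: coeff_norm_def)

lemma coeff_norm_add: "coeff_norm (f + g) \<le> coeff_norm f + coeff_norm g"
proof -
  let ?K = "Poly_Mapping.keys f \<union> Poly_Mapping.keys g"
  have "coeff_norm (f + g) = (\<Sum>m\<in>?K. cmod (Poly_Mapping.lookup f m + Poly_Mapping.lookup g m))"
    by (subst coeff_norm_superset[of ?K]) (auto simp: Poly_Mapping.keys_add lookup_add)
  also have "\<dots> \<le> (\<Sum>m\<in>?K. cmod (Poly_Mapping.lookup f m) + cmod (Poly_Mapping.lookup g m))"
    by (intro sum_mono norm_triangle_ineq)
  also have "\<dots> = coeff_norm f + coeff_norm g"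
    by (simp add: sum.distrib coeff_norm_superset[of ?K])
  finally show ?thesis .
qed

lemma coeff_norm_sum: "coeff_norm (\<Sum>i\<in>A. f i) \<le> (\<Sum>i\<in>A. coeff_norm (f i))"
proof (induction A rule: infinite_finite_induct)
  case (insert x F)
  thus ?case using coeff_norm_add[of "f x" "sum f F"] by simp
qed auto

lemma coeff_norm_mult: "coeff_norm (f * g) \<le> coeff_norm f * coeff_norm g"
proof -
  have "f * g = (\<Sum>m\<in>Poly_Mapping.keys f. \<Sum>m'\<in>Poly_Mapping.keys g.
      Poly_Mapping.single (m + m') (Poly_Mapping.lookup f m * Poly_Mapping.lookup g m'))"
    by (subst poly_mapping_sum_single[of f], subst poly_mapping_sum_single[of g])
       (simp add: sum_product mult_single)
  also have "coeff_norm \<dots> \<le> (\<Sum>m\<in>Poly_Mapping.keys f. \<Sum>m'\<in>Poly_Mapping.keys g.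
      coeff_norm (Poly_Mapping.single (m + m') (Poly_Mapping.lookup f m * Poly_Mapping.lookup g m')))"
    by (intro order.trans[OF coeff_norm_sum] sum_mono order_refl)
  also have "\<dots> = coeff_norm f * coeff_norm g"
    by (simp add: coeff_norm_single sum_product norm_mult coeff_norm_def[of f] coeff_norm_def[of g])
  finally show ?thesis .
qed

lemma lookup_le_monom_degree: "Poly_Mapping.lookup m i \<le> monom_degree m"
  unfolding monom_degree_def
  by (cases "i \<in> Poly_Mapping.keys m") (auto intro: member_le_sum simp: in_keys_iff)

lemma coeff_norm_partial_deriv:
  "coeff_norm (partial_deriv i f) \<le> real (total_degree f) * coeff_norm f"
proof -
  have "coeff_norm (partial_deriv i f) \<le>
      (\<Sum>m\<in>Poly_Mapping.keys f. cmod (of_nat (Poly_Mapping.lookup m i) * Poly_Mapping.lookup f m))"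
    unfolding partial_deriv_def by (intro order.trans[OF coeff_norm_sum]) (simp add: coeff_norm_single)
  also have "\<dots> \<le> (\<Sum>m\<in>Poly_Mapping.keys f. real (total_degree f) * cmod (Poly_Mapping.lookup f m))"
  proof (rule sum_mono)
    fix m assume "m \<in> Poly_Mapping.keys f"
    hence "Poly_Mapping.lookup m i \<le> total_degree f"
      using lookup_le_monom_degree monom_degree_le_total_degree order.trans by metis
    thus "cmod (of_nat (Poly_Mapping.lookup m i) * Poly_Mapping.lookup f m) \<le>
        real (total_degree f) * cmod (Poly_Mapping.lookup f m)"
      by (simp add: norm_mult mult_right_mono)
  qed
  finally show ?thesis by (simp add: coeff_norm_def sum_distrib_left)
qed

lemma total_degree_partial_deriv: "total_degree (partial_deriv i f) \<le> total_degree f"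
  unfolding partial_deriv_def
proof (rule total_degree_sum_le)
  fix m assume m: "m \<in> Poly_Mapping.keys f"
  have "monom_degree (m - Poly_Mapping.single i 1) \<le> monom_degree m"
  proof (cases "Poly_Mapping.lookup m i = 0")
    case True
    hence "m - Poly_Mapping.single i 1 = m"
      by (intro poly_mapping_eqI) (auto simp: lookup_minus lookup_single when_def)
    thus ?thesis by simp
  next
    case False
    from monom_minus_single_add[OF this, of "Poly_Mapping.single i 1"]
    have "m - Poly_Mapping.single i 1 + Poly_Mapping.single i 1 = m" by simp
    thus ?thesis by (metis le_add1 monom_degree_add)
  qed
  also have "\<dots> \<le> total_degree f" using m by (rule monom_degree_le_total_degree)
  finally show "total_degree (Poly_Mapping.single (m - Poly_Mapping.single i 1)
      (of_nat (Poly_Mapping.lookup m i) * Poly_Mapping.lookup f m)) \<le> total_degree f"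
    by (intro total_degree_leI) (auto split: if_splits)
qed

lemma cmod_peval_le:
  assumes "1 \<le> \<rho>" "\<And>i. cmod (x i) \<le> \<rho>"
  shows "cmod (peval x f) \<le> coeff_norm f * \<rho> ^ total_degree f"
proof -
  have "cmod (peval x f) \<le> (\<Sum>m\<in>Poly_Mapping.keys f. cmod (Poly_Mapping.lookup f m * eval_monom x m))"
    unfolding peval_def poly_subst_eq by (rule norm_sum)
  also have "\<dots> \<le> (\<Sum>m\<in>Poly_Mapping.keys f. cmod (Poly_Mapping.lookup f m) * \<rho> ^ total_degree f)"
  proof (rule sum_mono)
    fix m assume m: "m \<in> Poly_Mapping.keys f"
    have "cmod (eval_monom x m) = (\<Prod>i\<in>Poly_Mapping.keys m. cmod (x i) ^ Poly_Mapping.lookup m i)"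
      by (simp add: eval_monom_def prod_norm norm_power flip: prod_norm)
    also have "\<dots> \<le> (\<Prod>i\<in>Poly_Mapping.keys m. \<rho> ^ Poly_Mapping.lookup m i)"
      by (intro prod_mono) (auto intro: power_mono assms)
    also have "\<dots> = \<rho> ^ monom_degree m" by (simp add: monom_degree_def power_sum)
    also have "\<dots> \<le> \<rho> ^ total_degree f"
      using m assms by (intro power_increasing monom_degree_le_total_degree)
    finally show "cmod (Poly_Mapping.lookup f m * eval_monom x m) \<le> cmod (Poly_Mapping.lookup f m) * \<rho> ^ total_degree f"
      by (simp add: norm_mult mult_left_mono)
  qed
  finally show ?thesis by (simp add: coeff_norm_def sum_distrib_right)
qed

text \<open>The Lie series of the vector field \<open>b\<close>: these are the Taylor coefficients
  at time 0 of \<open>f\<close> along the integral curve of \<open>b\<close> that starts at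
  \<open>x\<close>.\<close>

definition taylor :: "('v::finite \<Rightarrow> ('v, complex) mpoly) \<Rightarrow> ('v \<Rightarrow> complex) \<Rightarrow> ('v, complex) mpoly \<Rightarrow> nat \<Rightarrow> complex"
  where "taylor b x f j = peval x ((vector_field b ^^ j) f) / fact j"

text \<open>The radius of convergence has to be independent of the polynomial \<open>f\<close>: each application of the
  vector field multiplies the coefficient norm by at most a multiple of the current degree, which grows
  linearly, and this is compensated by the factorial.\<close>

lemma taylor_bound:
  fixes b :: "'v::finite \<Rightarrow> ('v, complex) mpoly"
  obtains C where "C > 0" "\<And>f. \<exists>K. \<forall>j. cmod (taylor b x f j) \<le> K * C ^ j"
proof -
  define B where "B = (\<Sum>i\<in>UNIV. coeff_norm (b i))"
  \<comment> \<open>The summand 1 makes \<open>e\<close> positive, so the degree bound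
    \<open>total_degree f + j * e\<close> is at most \<open>e * (total_degree f + 1 + j)\<close>,
    and the second factors multiply to a quotient of factorials.\<close>
  define e where "e = 1 + (\<Sum>i\<in>UNIV. total_degree (b i))"
  define \<rho> where "\<rho> = 1 + (\<Sum>i\<in>UNIV. cmod (x i))"
  define L where "L = vector_field b"
  have B0: "B \<ge> 0" unfolding B_def by (intro sum_nonneg coeff_norm_nonneg)
  have \<rho>: "1 \<le> \<rho>" "cmod (x i) \<le> \<rho>" for i
  proof -
    show "1 \<le> \<rho>" by (simp add: \<rho>_def sum_nonneg)
    show "cmod (x i) \<le> \<rho>" unfolding \<rho>_def using member_le_sum[of i UNIV "\<lambda>i. cmod (x i)"] by simp
  qed
  have nL: "coeff_norm (L f) \<le> B * real (total_degree f) * coeff_norm f" for f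
  proof -
    have "coeff_norm (L f) \<le> (\<Sum>i\<in>UNIV. coeff_norm (b i) * (real (total_degree f) * coeff_norm f))"
      unfolding L_def vector_field_def
      by (intro order.trans[OF coeff_norm_sum] sum_mono order.trans[OF coeff_norm_mult]
          mult_left_mono coeff_norm_partial_deriv coeff_norm_nonneg)
    thus ?thesis by (simp add: B_def sum_distrib_right mult.assoc)
  qed
  have dL: "total_degree (L f) \<le> total_degree f + e" for f
    unfolding L_def vector_field_def
  proof (rule total_degree_sum_le)
    fix i
    have "total_degree (b i) \<le> e"
      unfolding e_def by (intro trans_le_add2 member_le_sum) auto
    thus "total_degree (b i * partial_deriv i f) \<le> total_degree f + e"
      using total_degree_mult_le[of "b i" "partial_deriv i f"] total_degree_partial_deriv[of i f] by linarith
  qed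
  have dLj: "total_degree ((L ^^ j) f) \<le> total_degree f + j * e" for f j
  proof (induction j)
    case (Suc j)
    thus ?case using dL[of "(L ^^ j) f"] by simp
  qed simp
  have nLj: "coeff_norm ((L ^^ j) f) \<le> (B * e) ^ j * (\<Prod>i<j. real (total_degree f + 1 + i)) * coeff_norm f" for f j
  proof (induction j)
    case (Suc j)
    let ?P = "\<Prod>i<j. real (total_degree f + 1 + i)"
    have "real (total_degree ((L ^^ j) f)) \<le> real (total_degree f + j * e)"
      using dLj[of j f] by (simp only: of_nat_le_iff)
    also have "\<dots> \<le> real (e * (total_degree f + 1 + j))"
    proof -
      have "total_degree f \<le> e * (total_degree f + 1)" by (simp add: e_def)
      hence "total_degree f + j * e \<le> e * (total_degree f + 1) + j * e" by (rule add_right_mono)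
      also have "\<dots> = e * (total_degree f + 1 + j)" by (simp add: algebra_simps)
      finally have "total_degree f + j * e \<le> e * (total_degree f + 1 + j)" .
      thus ?thesis by (simp only: of_nat_le_iff)
    qed
    finally have d: "real (total_degree ((L ^^ j) f)) \<le> e * real (total_degree f + 1 + j)"
      by (simp only: of_nat_mult)
    have "coeff_norm ((L ^^ Suc j) f) \<le> B * real (total_degree ((L ^^ j) f)) * coeff_norm ((L ^^ j) f)"
      using nL[of "(L ^^ j) f"] by simp
    also have "\<dots> \<le> B * (e * real (total_degree f + 1 + j)) * ((B * e) ^ j * ?P * coeff_norm f)"
      by (intro mult_mono mult_left_mono d Suc.IH B0 coeff_norm_nonneg mult_nonneg_nonneg) auto
    also have "\<dots> = (B * e) ^ Suc j * (\<Prod>i<Suc j. real (total_degree f + 1 + i)) * coeff_norm f"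
      by simp
    finally show ?case .
  qed simp
  \<comment> \<open>Dividing by \<open>fact j\<close> leaves a binomial coefficient, at most
    \<open>2 ^ (D + j)\<close>. This is geometric in \<open>j\<close>, with a ratio that does not
    depend on \<open>D\<close>.\<close>
  have prod: "(\<Prod>i<j. real (D + 1 + i)) = real ((D + j) choose j) * fact j" for D j
  proof -
    have "(\<Prod>i<j. real (D + 1 + i)) * fact D = fact (D + j)"
    proof (induction j)
      case (Suc j)
      have "(\<Prod>i<Suc j. real (D + 1 + i)) * fact D = ((\<Prod>i<j. real (D + 1 + i)) * fact D) * real (D + 1 + j)"
        by (simp only: prod.lessThan_Suc ac_simps)
      also have "\<dots> = fact (D + Suc j)" unfolding Suc by (simp add: algebra_simps)
      finally show ?case .
    qed simp
    moreover have "real ((D + j) choose j) * fact j * fact D = fact (D + j)"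
      using binomial_fact_lemma[of j "D + j"]
      by (metis (no_types, lifting) add_diff_cancel_right' le_add2 mult.commute mult.left_commute of_nat_fact of_nat_mult)
    ultimately show ?thesis
      by (metis fact_nonzero mult_right_cancel)
  qed
  \<comment> \<open>Adding 1 keeps \<open>C\<close> positive when \<open>B\<close> is 0.\<close>
  define C where "C = 2 * (B * e) * \<rho> ^ e + 1"
  have "\<exists>K. \<forall>j. cmod (taylor b x f j) \<le> K * C ^ j" for f
  proof (intro exI allI)
    fix j
    let ?D = "total_degree f"
    have "cmod (taylor b x f j) = cmod (peval x ((L ^^ j) f)) / fact j"
      by (simp add: taylor_def L_def norm_divide)
    also have "\<dots> \<le> (coeff_norm ((L ^^ j) f) * \<rho> ^ total_degree ((L ^^ j) f)) / fact j"
      by (intro divide_right_mono cmod_peval_le \<rho>) auto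
    also have "\<dots> \<le> ((B * e) ^ j * (real ((?D + j) choose j) * fact j) * coeff_norm f * \<rho> ^ (?D + j * e)) / fact j"
    proof (intro divide_right_mono mult_mono power_increasing)
      show "0 \<le> (B * e) ^ j * (real ((?D + j) choose j) * fact j) * coeff_norm f"
        by (intro mult_nonneg_nonneg zero_le_power coeff_norm_nonneg B0) auto
    qed (use nLj[of j f, unfolded prod] \<rho>(1) dLj[of j f] in auto)
    also have "\<dots> = real ((?D + j) choose j) * ((B * e) ^ j * coeff_norm f * \<rho> ^ (?D + j * e))"
      by simp
    also have "\<dots> \<le> 2 ^ (?D + j) * ((B * e) ^ j * coeff_norm f * \<rho> ^ (?D + j * e))"
    proof (rule mult_right_mono)
      have "(?D + j) choose j \<le> 2 ^ (?D + j)" by (rule binomial_le_pow2)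
      thus "real ((?D + j) choose j) \<le> 2 ^ (?D + j)" by (metis of_nat_le_iff of_nat_numeral of_nat_power)
    qed (use \<rho>(1) B0 in \<open>auto intro!: mult_nonneg_nonneg coeff_norm_nonneg\<close>)
    also have "\<dots> = (2 ^ ?D * coeff_norm f * \<rho> ^ ?D) * (2 * (B * e) * \<rho> ^ e) ^ j"
      by (simp add: power_add power_mult_distrib mult.commute[of j e] power_mult ac_simps)
    also have "\<dots> \<le> (2 ^ ?D * coeff_norm f * \<rho> ^ ?D) * C ^ j"
      using \<rho>(1) B0 by (intro mult_left_mono power_mono) (auto simp: C_def intro!: mult_nonneg_nonneg coeff_norm_nonneg)
    finally show "cmod (taylor b x f j) \<le> (2 ^ ?D * coeff_norm f * \<rho> ^ ?D) * C ^ j" .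
  qed
  moreover have "C > 0" using \<rho>(1) B0 by (auto simp: C_def intro!: add_nonneg_pos mult_nonneg_nonneg)
  ultimately show ?thesis using that by blast
qed

lemma taylor_add: "taylor b x (f + g) j = taylor b x f j + taylor b x g j"
proof -
  have "(vector_field b ^^ j) (f + g) = (vector_field b ^^ j) f + (vector_field b ^^ j) g"
    by (induction j) auto
  thus ?thesis by (simp add: taylor_def add_divide_distrib)
qed

lemma taylor_Const: "taylor b x (Const a) j = (if j = 0 then a else 0)"
proof -
  have "(vector_field b ^^ Suc j) (Const a) = 0" for j
    by (induction j) auto
  thus ?thesis by (cases j) (auto simp: taylor_def)
qed

lemma taylor_Suc: "taylor b x (vector_field b f) j = of_nat (Suc j) * taylor b x f (Suc j)"
  by (simp add: taylor_def funpow_swap1 divide_simps del: of_nat_Suc)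

text \<open>The derivation rule in coefficient form. Writing \<open>Suc j\<close> as
  \<open>(Suc j - i) + i\<close> recombines the two halves of the Leibniz sum.\<close>

lemma taylor_mult: "taylor b x (f * g) j = (\<Sum>i\<le>j. taylor b x f i * taylor b x g (j - i))"
proof (induction j arbitrary: f g)
  case 0
  show ?case by (simp add: taylor_def)
next
  case (Suc j)
  let ?t = "taylor b x" and ?L = "vector_field b"
  have "of_nat (Suc j) * ?t (f * g) (Suc j) = ?t (f * ?L g + ?L f * g) j"
    by (simp only: taylor_Suc[symmetric] vector_field_mult)
  also have "\<dots> = (\<Sum>i\<le>j. ?t f i * (of_nat (Suc (j - i)) * ?t g (Suc (j - i)))) +
      (\<Sum>i\<le>j. of_nat (Suc i) * ?t f (Suc i) * ?t g (j - i))"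
    by (simp only: taylor_add Suc.IH taylor_Suc)
  also have "(\<Sum>i\<le>j. ?t f i * (of_nat (Suc (j - i)) * ?t g (Suc (j - i)))) =
      (\<Sum>i\<le>Suc j. of_nat (Suc j - i) * (?t f i * ?t g (Suc j - i)))"
    by (simp add: Suc_diff_le mult.left_commute del: of_nat_Suc of_nat_diff)
  also have "(\<Sum>i\<le>j. of_nat (Suc i) * ?t f (Suc i) * ?t g (j - i)) =
      (\<Sum>i\<le>Suc j. of_nat i * (?t f i * ?t g (Suc j - i)))"
    by (subst sum.atMost_Suc_shift) (simp add: mult.assoc)
  also have "(\<Sum>i\<le>Suc j. of_nat (Suc j - i) * (?t f i * ?t g (Suc j - i))) +
      (\<Sum>i\<le>Suc j. of_nat i * (?t f i * ?t g (Suc j - i))) =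
      (\<Sum>i\<le>Suc j. of_nat (Suc j) * (?t f i * ?t g (Suc j - i)))"
    unfolding sum.distrib[symmetric] distrib_right[symmetric] of_nat_add[symmetric]
    by (rule sum.cong) auto
  also have "\<dots> = of_nat (Suc j) * (\<Sum>i\<le>Suc j. ?t f i * ?t g (Suc j - i))"
    by (simp only: sum_distrib_left)
  finally show ?case
    by (metis mult_cancel_left of_nat_neq_0)
qed

text \<open>Summing the Taylor series is a ring homomorphism in \<open>f\<close>, by the Cauchy
  product, so it is evaluation at the point whose coordinates are the sums for the variables. In
  particular, a polynomial all of whose iterated derivatives vanish at \<open>x\<close> vanishes on
  the curve.\<close>

theorem vector_field_flow:
  fixes b :: "'v::finite \<Rightarrow> ('v, complex) mpoly"
  obtains \<epsilon> \<gamma> where "\<epsilon> > 0"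
    "\<And>t f. cmod t < \<epsilon> \<Longrightarrow> (\<lambda>j. taylor b x f j * t ^ j) sums peval (\<gamma> t) f"
proof -
  obtain C where C: "C > 0" "\<And>f. \<exists>K. \<forall>j. cmod (taylor b x f j) \<le> K * C ^ j"
    using taylor_bound[of b x] by blast
  have summ: "summable (\<lambda>j. norm (taylor b x f j * t ^ j))" if t: "cmod t < 1 / C" for t f
  proof -
    obtain K where K: "\<And>j. cmod (taylor b x f j) \<le> K * C ^ j" using C(2) by blast
    have "summable (\<lambda>j. K * (C * cmod t) ^ j)"
      using t C(1) by (intro summable_mult summable_geometric) (simp add: field_simps)
    thus ?thesis
    proof (rule summable_comparison_test'[of _ 0])
      fix j
      have "cmod (taylor b x f j) * cmod t ^ j \<le> (K * C ^ j) * cmod t ^ j"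
        by (intro mult_right_mono K) auto
      thus "norm (norm (taylor b x f j * t ^ j)) \<le> K * (C * cmod t) ^ j"
        by (simp add: norm_mult norm_power power_mult_distrib mult.assoc)
    qed
  qed
  define \<phi> where "\<phi> t f = suminf (\<lambda>j. taylor b x f j * t ^ j)" for t f
  define \<gamma> where "\<gamma> t i = \<phi> t (Var i)" for t i
  have \<phi>: "(\<lambda>j. taylor b x f j * t ^ j) sums \<phi> t f" if "cmod t < 1 / C" for t f
    unfolding \<phi>_def by (rule summable_sums[OF summable_norm_cancel[OF summ[OF that]]])
  have "\<phi> t f = peval (\<gamma> t) f" if t: "cmod t < 1 / C" for t f
  proof (rule mpoly_hom_eqI[where f = f])
    fix a
    have "(\<lambda>j. taylor b x (Const a) j * t ^ j) = (\<lambda>j. if j = 0 then a else 0)"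
      by (auto simp: taylor_Const)
    hence "(\<lambda>j. taylor b x (Const a) j * t ^ j) sums a" using sums_single[of 0 "\<lambda>_. a"] by simp
    thus "\<phi> t (Const a) = peval (\<gamma> t) (Const a)" using \<phi>[OF t] sums_unique2 by fastforce
  next
    fix f g
    have "(\<lambda>j. taylor b x (f + g) j * t ^ j) sums (\<phi> t f + \<phi> t g)"
      using sums_add[OF \<phi>[OF t, of f] \<phi>[OF t, of g]] by (simp add: taylor_add distrib_right)
    thus "\<phi> t (f + g) = \<phi> t f + \<phi> t g" using \<phi>[OF t] sums_unique2 by blast
    have "(\<lambda>j. \<Sum>i\<le>j. taylor b x f i * t ^ i * (taylor b x g (j - i) * t ^ (j - i))) sums (\<phi> t f * \<phi> t g)"
      unfolding \<phi>_def by (intro Cauchy_product_sums summ t)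
    moreover have "(\<Sum>i\<le>j. taylor b x f i * t ^ i * (taylor b x g (j - i) * t ^ (j - i))) = taylor b x (f * g) j * t ^ j" for j
      unfolding taylor_mult sum_distrib_right
    proof (rule sum.cong)
      fix i assume "i \<in> {..j}"
      hence "t ^ j = t ^ i * t ^ (j - i)" by (simp flip: power_add)
      thus "taylor b x f i * t ^ i * (taylor b x g (j - i) * t ^ (j - i)) = taylor b x f i * taylor b x g (j - i) * t ^ j"
        by simp
    qed simp
    ultimately have "(\<lambda>j. taylor b x (f * g) j * t ^ j) sums (\<phi> t f * \<phi> t g)" by simp
    thus "\<phi> t (f * g) = \<phi> t f * \<phi> t g" using \<phi>[OF t] sums_unique2 by blast
  qed (simp_all add: \<gamma>_def)
  thus ?thesis using that[of "1 / C" \<gamma>] C(1) \<phi> by simp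
qed

lemma real_poly_taylor:
  assumes "\<And>i. real_poly (b i)" "real_poly f" "\<And>i. x i \<in> \<real>"
  shows "taylor b x f j \<in> \<real>"
proof -
  have "real_poly ((vector_field b ^^ j) f)"
    by (induction j) (auto intro: real_poly_vector_field assms)
  hence "peval x ((vector_field b ^^ j) f) \<in> \<real>" using assms(3) by (rule real_poly_peval)
  moreover have "(fact j :: complex) \<in> \<real>" by (metis Reals_of_nat of_nat_fact)
  ultimately show ?thesis unfolding taylor_def by (rule Reals_divide)
qed

lemma power_series_DERIV_0:
  fixes a :: "nat \<Rightarrow> real"
  assumes "\<epsilon> > 0" "\<And>t. \<bar>t\<bar> < \<epsilon> \<Longrightarrow> (\<lambda>j. a j * t ^ j) sums F t"
  shows "DERIV F 0 :> a 1" "F 0 = a 0"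
proof -
  define G where "G t = suminf (\<lambda>j. a j * t ^ j)" for t
  have GF: "G t = F t" if "\<bar>t\<bar> < \<epsilon>" for t
    unfolding G_def using assms(2)[OF that] by (rule sums_unique[symmetric])
  have "summable (\<lambda>j. a j * (\<epsilon> / 2) ^ j)" using assms(1) assms(2)[of "\<epsilon> / 2"] by (auto intro: sums_summable)
  hence "DERIV G 0 :> suminf (\<lambda>n. diffs a n * 0 ^ n)"
    unfolding G_def by (rule termdiffs_strong) (use assms(1) in auto)
  hence "DERIV G 0 :> a 1" by (simp add: powser_zero diffs_def)
  thus "DERIV F 0 :> a 1"
    by (rule has_field_derivative_transform_within[OF _ assms(1)]) (auto simp: GF dist_real_def)
  show "F 0 = a 0" using GF[of 0] assms(1) by (simp add: G_def powser_zero)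
qed

section \<open>Tangent vector fields of an irreducible set\<close>

lemma partial_deriv_sum: "partial_deriv i (\<Sum>k\<in>A. f k) = (\<Sum>k\<in>A. partial_deriv i (f k))"
  by (induction A rule: infinite_finite_induct) auto

lemma of_nat_eq_Const: "(of_nat n :: ('v, 'a::comm_semiring_1) mpoly) = Const (of_nat n)"
  by (simp add: Const_def)

lemma coeff_univ_at_partial_deriv:
  fixes f :: "('v, 'a::comm_ring_1) mpoly"
  shows "coeff (univ_at i (partial_deriv i f)) n = of_nat (Suc n) * coeff (univ_at i f) (Suc n)"
proof -
  define c where "c = coeff (univ_at i f)"
  define d where "d = degree (univ_at i f)"
  have c: "c k \<in> polys_in (- {i})" for k by (simp add: c_def coeff_univ_at_in')
  have f: "f = (\<Sum>k\<le>d. c k * Var i ^ k)"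
    unfolding c_def d_def poly_altdef[symmetric] poly_univ_at ..
  have pow: "partial_deriv i (Var i ^ k) = of_nat k * (Var i ^ (k - 1) :: ('v, 'a) mpoly)" for k
  proof (induction k)
    case (Suc k)
    thus ?case by (cases k) (simp_all add: partial_deriv_Var algebra_simps)
  qed (simp flip: Const_1)
  have pc: "partial_deriv i (c k) = 0" for k
    using c[of k] by (intro partial_deriv_not_in_vars) (auto simp: polys_in_def)
  have "partial_deriv i f = (\<Sum>k\<le>d. of_nat k * (c k * Var i ^ (k - 1)))"
    by (subst f) (simp add: partial_deriv_sum pow pc mult.left_commute)
  hence "coeff (univ_at i (partial_deriv i f)) n =
      (\<Sum>k\<le>d. coeff (univ_at i (of_nat k * (c k * Var i ^ (k - 1)))) n)"
    by (simp add: univ_at_sum coeff_sum del: univ_at_mult)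
  also have "\<dots> = (\<Sum>k\<le>d. if k = Suc n then of_nat k * c k else 0)"
  proof (rule sum.cong)
    fix k
    have "univ_at i (of_nat k * (c k * Var i ^ (k - 1))) = monom (of_nat k * c k) (k - 1)"
      by (simp add: univ_at_const[OF c] univ_at_Var of_nat_eq_Const monom_altdef mult.commute flip: one_pCons)
    thus "coeff (univ_at i (of_nat k * (c k * Var i ^ (k - 1)))) n = (if k = Suc n then of_nat k * c k else 0)"
      by (cases k) auto
  qed simp
  also have "\<dots> = of_nat (Suc n) * c (Suc n)"
    by (auto simp: c_def d_def coeff_eq_0)
  finally show ?thesis by (simp add: c_def)
qed

lemma polys_in_partial_deriv: "f \<in> polys_in S \<Longrightarrow> partial_deriv i f \<in> polys_in S"
proof -
  assume f: "f \<in> polys_in S"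
  have "Poly_Mapping.keys (m - Poly_Mapping.single i 1) \<subseteq> Poly_Mapping.keys m" for m :: "'a \<Rightarrow>\<^sub>0 nat"
    by (auto simp: in_keys_iff lookup_minus)
  thus ?thesis
    unfolding partial_deriv_def
    by (intro polys_in_sum) (use f in \<open>force simp: polys_in_def poly_vars_def split: if_splits\<close>)
qed

section \<open>Separation of a vector from a span by the bilinear pairing\<close>

lemma separating_vector:
  fixes u :: "complex ^ 'v"
  assumes "u \<notin> vec.span S"
  shows "\<exists>w. (\<forall>v\<in>S. (\<Sum>i\<in>UNIV. v $ i * w $ i) = 0) \<and> (\<Sum>i\<in>UNIV. u $ i * w $ i) \<noteq> 0"
proof -
  obtain B where B: "B \<subseteq> S" "vec.independent B" "S \<subseteq> vec.span B"
    using vec.maximal_independent_subset[of S] by blast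
  have uB: "u \<notin> vec.span B" using assms B(1) vec.span_mono by blast
  hence "vec.independent (insert u B)" using B(2) by (auto simp: vec.independent_insert)
  \<comment> \<open>Linear extension gives a map from the space to itself; its coordinate at an
    arbitrary index \<open>k\<close> is the functional wanted.\<close>
  obtain k :: 'v where True by auto
  from vec.linear_independent_extend[OF \<open>vec.independent (insert u B)\<close>,
      of "\<lambda>v. if v = u then axis k 1 else 0 :: complex ^ 'v"]
  obtain g where g: "Vector_Spaces.linear (*s) (*s) g"
    and gv: "\<And>v. v \<in> insert u B \<Longrightarrow> g v = (if v = u then axis k 1 else 0)" by blast
  interpret Vector_Spaces.linear "(*s)" "(*s)" g by (rule g)
  define w :: "complex ^ 'v" where "w = (\<chi> i. g (axis i 1) $ k)"
  have gw: "g v $ k = (\<Sum>i\<in>UNIV. v $ i * w $ i)" for v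
  proof -
    have "v = (\<Sum>i\<in>UNIV. v $ i *s axis i 1)" by (rule basis_expansion[symmetric])
    hence "g v = (\<Sum>i\<in>UNIV. v $ i *s g (axis i 1))" by (metis (no_types, lifting) sum scale sum.cong)
    thus ?thesis by (simp add: w_def)
  qed
  have "g v = 0" if "v \<in> B" for v
    using gv[of v] that uB vec.span_base by auto
  hence "g v = 0" if "v \<in> S" for v
    using eq_0_on_span[of B v] that B(3) by auto
  moreover have "g u $ k = 1" using gv[of u] by simp
  ultimately show ?thesis by (intro exI[of _ w]) (auto simp flip: gw)
qed

text \<open>The given vectors are real, so the real and the imaginary part of a complex
  \<open>w\<close> each annihilate \<open>S\<close>, and at least one of them does not annihilate
  \<open>u\<close>.\<close>

lemma real_separating_vector:
  fixes u :: "complex ^ 'v"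
  assumes "u \<notin> vec.span S" "\<And>v i. v \<in> insert u S \<Longrightarrow> v $ i \<in> \<real>"
  shows "\<exists>w. (\<forall>i. w $ i \<in> \<real>) \<and> (\<forall>v\<in>S. (\<Sum>i\<in>UNIV. v $ i * w $ i) = 0) \<and> (\<Sum>i\<in>UNIV. u $ i * w $ i) \<noteq> 0"
proof -
  obtain w where w: "\<And>v. v \<in> S \<Longrightarrow> (\<Sum>i\<in>UNIV. v $ i * w $ i) = 0" "(\<Sum>i\<in>UNIV. u $ i * w $ i) \<noteq> 0"
    using separating_vector[OF assms(1)] by blast
  define wr wi :: "complex ^ 'v" where "wr = (\<chi> i. of_real (Re (w $ i)))" and "wi = (\<chi> i. of_real (Im (w $ i)))"
  have re: "(\<Sum>i\<in>UNIV. v $ i * wr $ i) = of_real (Re (\<Sum>i\<in>UNIV. v $ i * w $ i))"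
    and im: "(\<Sum>i\<in>UNIV. v $ i * wi $ i) = of_real (Im (\<Sum>i\<in>UNIV. v $ i * w $ i))" if "v \<in> insert u S" for v
  proof -
    have "v $ i = of_real (Re (v $ i))" for i using assms(2)[OF that, of i] by simp
    hence i: "Im (v $ i) = 0" for i by (metis Im_complex_of_real)
    have v: "v $ i = of_real (Re (v $ i))" for i using assms(2)[OF that, of i] by simp
    show "(\<Sum>i\<in>UNIV. v $ i * wr $ i) = of_real (Re (\<Sum>i\<in>UNIV. v $ i * w $ i))"
      by (simp add: wr_def i) (intro sum.cong, simp, metis v of_real_mult)
    show "(\<Sum>i\<in>UNIV. v $ i * wi $ i) = of_real (Im (\<Sum>i\<in>UNIV. v $ i * w $ i))"
      by (simp add: wi_def i) (intro sum.cong, simp, metis v of_real_mult)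
  qed
  have "(\<Sum>i\<in>UNIV. u $ i * wr $ i) \<noteq> 0 \<or> (\<Sum>i\<in>UNIV. u $ i * wi $ i) \<noteq> 0"
    using w(2) unfolding re[OF insertI1] im[OF insertI1] of_real_eq_0_iff complex_eq_iff[of _ 0]
    by (simp only: zero_complex.sel Re_complex_of_real) blast
  moreover have "\<forall>v\<in>S. (\<Sum>i\<in>UNIV. v $ i * wr $ i) = 0"
    using re[OF insertI2] w(1) by (metis zero_complex.sel(1) of_real_0)
  moreover have "\<forall>v\<in>S. (\<Sum>i\<in>UNIV. v $ i * wi $ i) = 0"
    using im[OF insertI2] w(1) by (metis zero_complex.sel(2) of_real_0)
  moreover have "\<forall>i. wr $ i \<in> \<real>" "\<forall>i. wi $ i \<in> \<real>" by (auto simp: wr_def wi_def)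
  ultimately show ?thesis by blast
qed

text \<open>Independence stated one gradient at a time, the form in which elimination adds one
  function per step. Unlike independence of the set of gradients, it excludes repetitions.\<close>

definition indep_gradients :: "(nat \<Rightarrow> ('v::finite, complex) mpoly) \<Rightarrow> nat \<Rightarrow> complex ^ 'v \<Rightarrow> bool"
  where "indep_gradients f k x \<longleftrightarrow>
    (\<forall>j<k. gradient (f j) x \<notin> vec.span ((\<lambda>i. gradient (f i) x) ` {..<j}))"

lemma indep_gradients_card:
  assumes "indep_gradients f k x"
  shows "vec.independent ((\<lambda>i. gradient (f i) x) ` {..<k}) \<and> card ((\<lambda>i. gradient (f i) x) ` {..<k}) = k"
  using assms
proof (induction k)
  case 0
  show ?case by (simp add: vec.independent_empty)
next
  case (Suc k)
  hence "indep_gradients f k x" by (simp add: indep_gradients_def)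
  note IH = Suc.IH[OF this]
  have n: "gradient (f k) x \<notin> vec.span ((\<lambda>i. gradient (f i) x) ` {..<k})"
    using Suc.prems by (simp add: indep_gradients_def)
  hence "gradient (f k) x \<notin> (\<lambda>i. gradient (f i) x) ` {..<k}"
    by (rule contrapos_nn) (rule vec.span_base)
  thus ?case using IH n by (simp only: lessThan_Suc image_insert vec.independent_insert card_insert_disjoint
        finite_imageI finite_lessThan if_False simp_thms)
qed

text \<open>An analogue of Gaussian elimination without division: vector fields that annihilate
  \<open>f 0, \<dots>, f (k - 1)\<close> identically and take at \<open>x\<close> all values that they can take.\<close>

lemma annihilating_vector_fields:
  fixes f :: "nat \<Rightarrow> ('v::finite, complex) mpoly" and x :: "complex ^ 'v"
  assumes "\<forall>j<k. real_poly (f j)" "\<forall>i. x $ i \<in> \<real>" "indep_gradients f k x"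
  shows "\<exists>s (B :: complex ^ 'v \<Rightarrow> 'v \<Rightarrow> ('v, complex) mpoly). real_poly s \<and> peval (($) x) s \<noteq> 0 \<and>
    (\<forall>v. (\<forall>i. v $ i \<in> \<real>) \<longrightarrow> (\<forall>i. real_poly (B v i))) \<and>
    (\<forall>v. \<forall>j<k. vector_field (B v) (f j) = 0) \<and>
    (\<forall>v. (\<forall>j<k. (\<Sum>i\<in>UNIV. gradient (f j) x $ i * v $ i) = 0) \<longrightarrow>
       (\<forall>i. peval (($) x) (B v i) = peval (($) x) s * v $ i)) \<and>
    (\<forall>q. peval (($) q) s \<noteq> 0 \<longrightarrow> indep_gradients f k q)"
  using assms
proof (induction k)
  case 0
  show ?case
    by (intro exI[of _ 1] exI[of _ "\<lambda>v i. Const (v $ i)"])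
       (auto simp: indep_gradients_def real_poly_1 real_poly_Const)
next
  case (Suc k)
  have ind0: "indep_gradients f k x" using Suc.prems(3) by (simp add: indep_gradients_def)
  have rp: "\<forall>j<k. real_poly (f j)" using Suc.prems(1) by simp
  obtain s and B :: "complex ^ 'v \<Rightarrow> 'v \<Rightarrow> ('v, complex) mpoly" where s: "real_poly s" "peval (($) x) s \<noteq> 0"
    and Breal': "\<forall>v. (\<forall>i. v $ i \<in> \<real>) \<longrightarrow> (\<forall>i. real_poly (B v i))"
    and B0': "\<forall>v. \<forall>j<k. vector_field (B v) (f j) = 0"
    and Bx': "\<forall>v. (\<forall>j<k. (\<Sum>i\<in>UNIV. gradient (f j) x $ i * v $ i) = 0) \<longrightarrow>
       (\<forall>i. peval (($) x) (B v i) = peval (($) x) s * v $ i)"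
    and ind': "\<forall>q. peval (($) q) s \<noteq> 0 \<longrightarrow> indep_gradients f k q"
    using Suc.IH[OF rp Suc.prems(2) ind0] by (elim exE conjE) (rule that; assumption)
  note Breal = Breal'[rule_format] and B0 = B0'[rule_format] and ind = ind'[rule_format]
  have Bx: "peval (($) x) (B v i) = peval (($) x) s * v $ i"
    if "\<forall>j<k. (\<Sum>i\<in>UNIV. gradient (f j) x $ i * v $ i) = 0" for v i
    using Bx' that by blast
  have gr: "gradient (f j) x $ i \<in> \<real>" if "j \<le> k" for j i
    using Suc.prems(1,2) that by (intro real_poly_gradient) auto
  have "gradient (f k) x \<notin> vec.span ((\<lambda>i. gradient (f i) x) ` {..<k})"
    using Suc.prems(3) by (simp add: indep_gradients_def)
  from real_separating_vector[OF this] gr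
  obtain w where w: "\<forall>i. w $ i \<in> \<real>" "\<forall>j<k. (\<Sum>i\<in>UNIV. gradient (f j) x $ i * w $ i) = 0"
    "(\<Sum>i\<in>UNIV. gradient (f k) x $ i * w $ i) \<noteq> 0" by fastforce
  define L where "L v = vector_field (B v) (f k)" for v
  \<comment> \<open>The cross-combination kills \<open>f k\<close> identically without a division by
    \<open>L w\<close>. At \<open>x\<close> its second term vanishes for \<open>v\<close> orthogonal
    to all the gradients, so the value there is only scaled by \<open>L w\<close>.\<close>
  define B' where "B' v i = L w * B v i - L v * B w i" for v i
  have vB': "vector_field (B' v) g = L w * vector_field (B v) g - L v * vector_field (B w) g" for v g
    by (simp add: vector_field_def B'_def left_diff_distrib sum_subtractf sum_distrib_left mult.assoc)
  have Lreal: "real_poly (L v)" if "\<forall>i. v $ i \<in> \<real>" for v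
    unfolding L_def using Breal that Suc.prems(1) by (intro real_poly_vector_field) auto
  have Lx: "peval (($) x) (L v) = peval (($) x) s * (\<Sum>i\<in>UNIV. gradient (f k) x $ i * v $ i)"
    if "\<forall>j<k. (\<Sum>i\<in>UNIV. gradient (f j) x $ i * v $ i) = 0" for v
    unfolding L_def peval_vector_field by (simp add: Bx[OF that] sum_distrib_left ac_simps)
  show ?case
  proof (intro exI[of _ "s * L w"] exI[of _ B'] conjI allI impI)
    show "real_poly (s * L w)" using s w(1) by (intro real_poly_mult Lreal) auto
    show "peval (($) x) (s * L w) \<noteq> 0" using s(2) w(3) by (simp add: Lx[OF w(2)])
    show "real_poly (B' v i)" if "\<forall>i. v $ i \<in> \<real>" for v i
      unfolding B'_def using that w(1) by (intro real_poly_diff real_poly_mult Lreal Breal) auto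
    show "vector_field (B' v) (f j) = 0" if "j < Suc k" for v j
      using that B0 by (auto simp: vB' less_Suc_eq) (simp add: L_def mult.commute)
    show "peval (($) x) (B' v i) = peval (($) x) (s * L w) * v $ i"
      if v: "\<forall>j<Suc k. (\<Sum>i\<in>UNIV. gradient (f j) x $ i * v $ i) = 0" for v i
    proof -
      have v': "\<forall>j<k. (\<Sum>i\<in>UNIV. gradient (f j) x $ i * v $ i) = 0" using v by simp
      have "peval (($) x) (L v) = 0" using v by (simp add: Lx[OF v'])
      thus ?thesis by (simp add: B'_def Bx[OF v'])
    qed
    show "indep_gradients f (Suc k) q" if q: "peval (($) q) (s * L w) \<noteq> 0" for q
    proof -
      \<comment> \<open>At \<open>q\<close> the field \<open>B w\<close> is orthogonal to the
        earlier gradients but not to that of \<open>f k\<close>.\<close>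
      have "gradient (f k) q \<notin> vec.span ((\<lambda>i. gradient (f i) q) ` {..<k})"
      proof
        assume "gradient (f k) q \<in> vec.span ((\<lambda>i. gradient (f i) q) ` {..<k})"
        hence "(\<Sum>i\<in>UNIV. peval (($) q) (B w i) * gradient (f k) q $ i) = 0"
        proof (induction rule: vec.span_induct_alt)
          case (step c y z)
          then obtain j where j: "j < k" "y = gradient (f j) q" by auto
          have "(\<Sum>i\<in>UNIV. peval (($) q) (B w i) * y $ i) = 0"
            using B0[OF j(1), of w] by (simp add: j(2) flip: peval_vector_field)
          moreover have "(\<Sum>i\<in>UNIV. peval (($) q) (B w i) * (c *s y + z) $ i) =
              c * (\<Sum>i\<in>UNIV. peval (($) q) (B w i) * y $ i) + (\<Sum>i\<in>UNIV. peval (($) q) (B w i) * z $ i)"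
            by (simp add: distrib_left sum.distrib sum_distrib_left mult.left_commute)
          ultimately show ?case using step by simp
        qed simp
        thus False using q by (simp add: L_def peval_vector_field)
      qed
      thus ?thesis using ind[of q] q by (auto simp: indep_gradients_def less_Suc_eq)
    qed
  qed
qed

text \<open>Irreducibility is stated as primality of the ideal, so that it applies to sets that are
  not Zariski closed: the cone over the real points and the set of conormal vectors.\<close>

locale irreducible_set =
  fixes \<Omega> :: "(complex ^ 'v::finite) set"
  assumes nonempty: "\<Omega> \<noteq> {}"
    and prime: "f * g \<in> vanishing_ideal \<Omega> \<Longrightarrow> f \<in> vanishing_ideal \<Omega> \<or> g \<in> vanishing_ideal \<Omega>"
begin

abbreviation "I \<equiv> vanishing_ideal \<Omega>"

lemma in_I_iff: "f \<in> I \<longleftrightarrow> (\<forall>x\<in>\<Omega>. peval (($) x) f = 0)"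
  by (simp add: vanishing_ideal_def)

lemma I_0 [simp, intro]: "0 \<in> I"
  and I_add: "f \<in> I \<Longrightarrow> g \<in> I \<Longrightarrow> f + g \<in> I"
  and I_diff: "f \<in> I \<Longrightarrow> g \<in> I \<Longrightarrow> f - g \<in> I"
  and I_mult: "f \<in> I \<Longrightarrow> r * f \<in> I"
  and I_mult2: "f \<in> I \<Longrightarrow> f * r \<in> I"
  by (auto simp: in_I_iff)

lemma I_Const: "Const a \<in> I \<longleftrightarrow> a = 0"
  using nonempty by (auto simp: in_I_iff)

lemma I_prod: "finite A \<Longrightarrow> (\<And>i. i \<in> A \<Longrightarrow> f i \<notin> I) \<Longrightarrow> (\<Prod>i\<in>A. f i) \<notin> I"
proof (induction A rule: finite_induct)
  case empty
  show ?case using I_Const[of 1] by (simp add: Const_1)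
next
  case (insert i A)
  thus ?case using prime by auto
qed

text \<open>Take an independent set of coordinates of greatest cardinality. With relations in place
  of field extensions, \<open>card T\<close> plays the part of the transcendence degree.\<close>

lemma exists_transcendence_basis:
  "\<exists>T. (\<forall>f. f \<in> polys_in T \<longrightarrow> f \<in> I \<longrightarrow> f = 0) \<and> (\<forall>v. v \<notin> T \<longrightarrow> (\<exists>R\<in>polys_in (insert v T). R \<in> I \<and> R \<noteq> 0))"
proof -
  define P where "P T \<longleftrightarrow> (\<forall>f. f \<in> polys_in T \<longrightarrow> f \<in> I \<longrightarrow> f = 0)" for T
  have "P {}"
    unfolding P_def
  proof (intro allI impI)
    fix f assume f: "f \<in> polys_in {}" "f \<in> I"
    then obtain a where "f = Const a" unfolding polys_in_empty by blast
    thus "f = 0" using f(2) by (simp add: I_Const)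
  qed
  moreover have "\<forall>T. P T \<longrightarrow> card T < Suc (CARD('v))" by (auto intro: card_mono simp: less_Suc_eq_le)
  ultimately obtain T where T: "P T" "\<And>T'. P T' \<Longrightarrow> card T' \<le> card T"
    using ex_has_greatest_nat[of P "{}" card "Suc (CARD('v))"] by blast
  have "\<exists>R\<in>polys_in (insert v T). R \<in> I \<and> R \<noteq> 0" if "v \<notin> T" for v
  proof (rule ccontr)
    assume "\<not> ?thesis"
    hence "P (insert v T)" unfolding P_def by blast
    from T(2)[OF this] that show False by simp
  qed
  thus ?thesis using T(1) unfolding P_def by blast
qed

end

locale transcendence_basis = irreducible_set \<Omega> for \<Omega> :: "(complex ^ 'v::finite) set" +
  fixes T :: "'v::finite set"
  assumes indep: "f \<in> polys_in T \<Longrightarrow> f \<in> vanishing_ideal \<Omega> \<Longrightarrow> f = 0"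
    and alg: "v \<notin> T \<Longrightarrow> \<exists>R\<in>polys_in (insert v T). R \<in> vanishing_ideal \<Omega> \<and> R \<noteq> 0"
begin

text \<open>The derivation \<open>\<partial>/\<partial>x\<^sub>j\<close> of the purely transcendental part extends, up to a common denominator,
  one algebraic coordinate \<open>z\<close> at a time: the value at \<open>z\<close> is forced by a relation \<open>R\<close> of least
  degree, and \<open>\<partial>R/\<partial>z\<close> does not vanish on \<open>\<Omega>\<close> as its degree is smaller.\<close>

lemma exists_tangent_field:
  assumes "j \<in> T"
  shows "\<exists>b. b j \<notin> I \<and> (\<forall>l\<in>T - {j}. b l = 0) \<and> (\<forall>g\<in>I. vector_field b g \<in> I)"
proof -
  have "\<exists>b. b j \<notin> I \<and> (\<forall>l\<in>T - {j}. b l = 0) \<and> (\<forall>g\<in>I. g \<in> polys_in (T \<union> S) \<longrightarrow> vector_field b g \<in> I)"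
    if "S \<subseteq> - T" for S
    using finite_subset[OF that finite] that
  proof (induction S rule: finite_induct)
    case empty
    have "1 \<notin> I" using I_Const[of 1] by (simp add: Const_1)
    moreover have "vector_field b g \<in> I" if "g \<in> I" "g \<in> polys_in (T \<union> {})" for b g
    proof -
      have "g = 0" using indep that by simp
      thus ?thesis by simp
    qed
    ultimately show ?case by (intro exI[of _ "\<lambda>l. if l = j then 1 else 0"]) simp
  next
    case (insert z S)
    define U where "U = T \<union> S"
    have zU: "z \<notin> U" using insert by (auto simp: U_def)
    from insert obtain b where b: "b j \<notin> I" "\<forall>l\<in>T - {j}. b l = 0"
      and bI: "\<And>g. g \<in> I \<Longrightarrow> g \<in> polys_in U \<Longrightarrow> vector_field b g \<in> I" by (auto simp: U_def)
    \<comment> \<open>A relation counts only if its leading coefficient does not vanish identically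
      on \<Omega>; otherwise its degree could be lowered modulo \<open>I\<close>.\<close>
    let ?Q = "\<lambda>R. R \<in> I \<and> R \<in> polys_in (insert z U) \<and> lead_coeff (univ_at z R) \<notin> I"
    obtain R0 where R0: "R0 \<in> polys_in (insert z T)" "R0 \<in> I" "R0 \<noteq> 0"
      using alg[of z] insert.prems by auto
    have "lead_coeff (univ_at z R0) \<in> polys_in T" using R0 insert.prems by (intro coeff_univ_at_in) auto
    hence "lead_coeff (univ_at z R0) \<notin> I" using indep R0(3) by fastforce
    hence "?Q R0" using R0 polys_in_mono[of "insert z T" "insert z U"] unfolding U_def by blast
    then obtain R where R: "?Q R" and min: "\<And>R'. ?Q R' \<Longrightarrow> degree (univ_at z R) \<le> degree (univ_at z R')"
      using ex_has_least_nat[of ?Q R0 "\<lambda>R. degree (univ_at z R)"] by blast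
    define p where "p = univ_at z R"
    define l where "l = lead_coeff p"
    define d where "d = degree p"
    have d0: "d > 0"
    proof (rule ccontr)
      assume "\<not> d > 0"
      hence "R \<in> polys_in (- {z})" by (simp add: d_def p_def flip: degree_univ_at_0_iff)
      hence "lead_coeff (univ_at z R) = R" by (simp add: univ_at_const)
      thus False using R by metis
    qed
    define R' where "R' = partial_deriv z R"
    have "R' \<notin> I"
    proof
      assume R'I: "R' \<in> I"
      have c: "coeff (univ_at z R') (d - 1) = of_nat d * l"
        using d0 by (simp add: R'_def coeff_univ_at_partial_deriv l_def d_def p_def del: of_nat_Suc)
      have lI: "of_nat d * l \<notin> I"
      proof
        assume "of_nat d * l \<in> I"
        hence "Const (of_nat d) \<in> I \<or> l \<in> I" unfolding of_nat_eq_Const by (rule prime)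
        thus False using R d0 by (simp add: I_Const l_def p_def)
      qed
      have "degree (univ_at z R') \<le> d - 1"
        by (rule degree_le) (auto simp: R'_def coeff_univ_at_partial_deriv d_def p_def coeff_eq_0)
      moreover have "coeff (univ_at z R') (d - 1) \<noteq> 0" using lI c by auto
      ultimately have deg: "degree (univ_at z R') = d - 1" by (metis antisym le_degree)
      hence "?Q R'" using R'I lI c R polys_in_partial_deriv[of R _ z] by (simp add: R'_def)
      from min[OF this] show False using deg d0 by (simp add: d_def p_def)
    qed
    \<comment> \<open>The entry at \<open>z\<close> is the one for which \<open>b'\<close> kills
      \<open>R\<close>; the other entries are multiplied by \<open>R'\<close> in place of dividing
      by it.\<close>
    define b' where "b' v = (if v = z then - (\<Sum>v\<in>UNIV - {z}. b v * partial_deriv v R) else R' * b v)" for v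
    have split: "vector_field b' g = R' * (\<Sum>v\<in>UNIV - {z}. b v * partial_deriv v g) + b' z * partial_deriv z g" for g
      unfolding vector_field_def
      by (subst sum.remove[of _ z]) (auto simp: b'_def sum_distrib_left mult.assoc intro!: sum.cong)
    have DR: "vector_field b' R = 0"
      unfolding split by (simp add: b'_def R'_def mult.commute)
    have DU: "vector_field b' g \<in> I" if "g \<in> I" "g \<in> polys_in U" for g
    proof -
      have z0: "partial_deriv z g = 0"
        using that zU by (intro partial_deriv_not_in_vars) (auto simp: polys_in_def)
      have "vector_field b g = (\<Sum>v\<in>UNIV - {z}. b v * partial_deriv v g)"
        unfolding vector_field_def by (subst sum.remove[of _ z]) (auto simp: z0)
      hence "vector_field b' g = R' * vector_field b g" by (simp add: split z0)
      thus ?thesis using bI[OF that] by (simp add: I_mult)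
    qed
    have lU: "l \<in> polys_in (insert z U)"
      unfolding l_def p_def by (rule polys_in_insert, rule coeff_univ_at_in) (use R zU in auto)
    \<comment> \<open>Lower the degree in \<open>z\<close>: strip the top term if its coefficient
      lies in \<open>I\<close>, otherwise reduce modulo \<open>R\<close>, which \<open>b'\<close>
      kills. The factor \<open>l\<close> that this introduces is removed by primality.\<close>
    have D: "vector_field b' g \<in> I" if "g \<in> I" "g \<in> polys_in (insert z U)" for g
      using that
    proof (induction "degree (univ_at z g)" arbitrary: g rule: less_induct)
      case (less g)
      define e where "e = degree (univ_at z g)"
      define c where "c = lead_coeff (univ_at z g)"
      have cU: "c \<in> polys_in U" unfolding c_def using less.prems zU by (intro coeff_univ_at_in)
      hence cU': "c \<in> polys_in (insert z U)" by (rule polys_in_insert)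
      have VU: "c * Var z ^ n \<in> polys_in (insert z U)" for n using cU' by auto
      have IH: "vector_field b' g' \<in> I"
        if "g' \<in> I" "g' \<in> polys_in (insert z U)" "degree (univ_at z g') < e \<or> g' = 0" for g'
        using less.hyps[of g'] that by (auto simp: e_def)
      show ?case
      proof (cases "c \<in> I")
        case True
        define g' where "g' = g - c * Var z ^ e"
        have "degree (univ_at z g') < e \<or> g' = 0"
          using pseudo_reduction[of z 1 g] by (simp add: g'_def c_def e_def)
        moreover have "g' \<in> I" "g' \<in> polys_in (insert z U)"
          unfolding g'_def using less.prems True VU by (auto intro: I_diff I_mult2)
        ultimately have "vector_field b' g' \<in> I" by (intro IH)
        moreover have "vector_field b' g = vector_field b' g' +
            (c * vector_field b' (Var z ^ e) + vector_field b' c * Var z ^ e)"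
          by (simp add: g'_def)
        ultimately show ?thesis using DU[OF True cU] True by (simp add: I_add I_mult2)
      next
        case False
        hence "d \<le> e" using min[of g] less.prems by (simp add: c_def d_def p_def e_def)
        define r where "r = c * Var z ^ (e - d)"
        define g' where "g' = l * g - r * R"
        have "degree (univ_at z g') < e \<or> g' = 0"
          using pseudo_reduction[of z R g] \<open>d \<le> e\<close>
          by (simp add: g'_def r_def c_def e_def d_def p_def l_def)
        moreover have "g' \<in> I" "g' \<in> polys_in (insert z U)"
          unfolding g'_def r_def using less.prems R VU lU by (auto intro!: I_diff I_mult)
        ultimately have "vector_field b' g' \<in> I" by (intro IH)
        moreover have "l * vector_field b' g = vector_field b' g' + vector_field b' r * R - vector_field b' l * g"
          by (simp add: g'_def DR)
        ultimately have "l * vector_field b' g \<in> I"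
          using R less.prems by (simp add: I_add I_diff I_mult)
        thus ?thesis using prime R by (auto simp: l_def p_def)
      qed
    qed
    show ?case
    proof (intro exI[of _ b'] conjI ballI impI)
      show "b' j \<notin> I" using b(1) \<open>R' \<notin> I\<close> prime insert.prems assms by (auto simp: b'_def)
      show "b' l = 0" if "l \<in> T - {j}" for l using b(2) that insert.prems by (auto simp: b'_def)
      show "vector_field b' g \<in> I" if "g \<in> I" "g \<in> polys_in (T \<union> insert z S)" for g
        using D that by (simp add: U_def)
    qed
  qed
  from this[of "- T"] show ?thesis by simp
qed

text \<open>On \<Omega>, the fields from \<open>exists_tangent_field\<close> are orthogonal to the
  gradients of all members of \<open>I\<close>, and among the entries in \<open>T\<close> the field
  for \<open>j\<close> has only its own. So each gradient entry in \<open>T\<close> is a linear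
  function of those outside \<open>T\<close>, with common denominator \<open>a\<close>.\<close>

lemma gradients_parametrized:
  obtains a :: "('v, complex) mpoly" and E :: "'v \<Rightarrow> 'v \<Rightarrow> ('v, complex) mpoly"
  where "a \<notin> I" "\<And>g x i. g \<in> I \<Longrightarrow> x \<in> \<Omega> \<Longrightarrow> peval (($) x) a \<noteq> 0 \<Longrightarrow>
    gradient g x $ i = (\<Sum>l\<in>- T. gradient g x $ l / peval (($) x) a * peval (($) x) (E l i))"
proof -
  have "\<forall>j\<in>T. \<exists>b. b j \<notin> I \<and> (\<forall>l\<in>T - {j}. b l = 0) \<and> (\<forall>g\<in>I. vector_field b g \<in> I)"
    using exists_tangent_field by blast
  then obtain b where b: "\<And>j. j \<in> T \<Longrightarrow> b j j \<notin> I" "\<And>j l. j \<in> T \<Longrightarrow> l \<in> T - {j} \<Longrightarrow> b j l = 0"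
    "\<And>j g. j \<in> T \<Longrightarrow> g \<in> I \<Longrightarrow> vector_field (b j) g \<in> I" by metis
  define a where "a = (\<Prod>j\<in>T. b j j)"
  define E where "E l i = (if i \<in> T then - b i l * (\<Prod>j\<in>T - {i}. b j j) else if i = l then a else 0)" for l i
  have "a \<notin> I" unfolding a_def using b(1) by (intro I_prod) auto
  moreover have "gradient g x $ i = (\<Sum>l\<in>- T. gradient g x $ l / peval (($) x) a * peval (($) x) (E l i))"
    if g: "g \<in> I" "x \<in> \<Omega>" "peval (($) x) a \<noteq> 0" for g x i
  proof (cases "i \<in> T")
    case False
    have "(\<Sum>l\<in>- T. gradient g x $ l / peval (($) x) a * peval (($) x) (E l i)) =
        (\<Sum>l\<in>- T. if l = i then gradient g x $ l else 0)"
      by (rule sum.cong) (use False g(3) in \<open>auto simp: E_def\<close>)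
    thus ?thesis using False by simp
  next
    case True
    let ?u = "gradient g x" and ?P = "peval (($) x)"
    have a: "?P a = ?P (b i i) * ?P (\<Prod>j\<in>T - {i}. b j j)"
      using True by (simp add: a_def prod.remove[of T i])
    have "0 = ?P (vector_field (b i) g)" using b(3)[OF True g(1)] g(2) by (simp add: in_I_iff)
    also have "\<dots> = (\<Sum>l\<in>insert i (- T). ?P (b i l) * ?u $ l)"
      unfolding peval_vector_field
      by (rule sum.mono_neutral_right) (use b(2)[OF True] in auto)
    also have "\<dots> = ?P (b i i) * ?u $ i + (\<Sum>l\<in>- T. ?P (b i l) * ?u $ l)"
      using True by simp
    finally have "?P (b i i) * ?u $ i = - (\<Sum>l\<in>- T. ?P (b i l) * ?u $ l)"
      by (simp add: eq_neg_iff_add_eq_0)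
    note rel = this
    have "?P a * ?u $ i = ?P (\<Prod>j\<in>T - {i}. b j j) * (?P (b i i) * ?u $ i)"
      by (simp only: a ac_simps)
    also have "\<dots> = (\<Sum>l\<in>- T. ?u $ l * ?P (E l i))"
      unfolding rel using True by (simp add: E_def ac_simps sum_distrib_left sum_negf)
    finally have "?P a * ?u $ i = (\<Sum>l\<in>- T. ?u $ l * ?P (E l i))" .
    hence "?u $ i = (\<Sum>l\<in>- T. ?u $ l * ?P (E l i)) / ?P a"
      using g(3) by (simp add: field_simps)
    thus ?thesis by (simp add: sum_divide_distrib)
  qed
  ultimately show ?thesis using that by blast
qed

text \<open>The vectors with entries \<open>E l i\<close> span all gradients at such a point, and
  there is one of them for each index \<open>l\<close> outside \<open>T\<close>.\<close>

lemma gradients_dimension: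
  obtains a where "a \<notin> I"
    "\<And>x G. x \<in> \<Omega> \<Longrightarrow> peval (($) x) a \<noteq> 0 \<Longrightarrow> G \<subseteq> (\<lambda>g. gradient g x) ` I \<Longrightarrow> vec.independent G \<Longrightarrow>
       card G \<le> CARD('v) - card T"
proof -
  obtain a E where a: "a \<notin> I" "\<And>g x i. g \<in> I \<Longrightarrow> x \<in> \<Omega> \<Longrightarrow> peval (($) x) a \<noteq> 0 \<Longrightarrow>
    gradient g x $ i = (\<Sum>l\<in>- T. gradient g x $ l / peval (($) x) a * peval (($) x) (E l i))"
    using gradients_parametrized by blast
  have "card G \<le> CARD('v) - card T"
    if x: "x \<in> \<Omega>" "peval (($) x) a \<noteq> 0" and G: "G \<subseteq> (\<lambda>g. gradient g x) ` I" "vec.independent G" for x G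
  proof -
    define e where "e l = (\<chi> i. peval (($) x) (E l i))" for l
    have "gradient g x \<in> vec.span (e ` (- T))" if "g \<in> I" for g
    proof -
      have "gradient g x = (\<Sum>l\<in>- T. (gradient g x $ l / peval (($) x) a) *s e l)"
        unfolding vec_eq_iff sum_component vector_smult_component e_def vec_lambda_beta
        by (intro allI a(2)[OF that x])
      also have "\<dots> \<in> vec.span (e ` (- T))"
        by (intro vec.span_sum vec.span_scale vec.span_base imageI)
      finally show ?thesis .
    qed
    hence "G \<subseteq> vec.span (e ` (- T))" using G(1) by auto
    hence "card G \<le> card (e ` (- T))" using vec.independent_span_bound[OF _ G(2)] by simp
    also have "\<dots> \<le> card (- T)" by (rule card_image_le) simp
    also have "\<dots> = CARD('v) - card T" by (simp add: Compl_eq_Diff_UNIV card_Diff_subset)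
    finally show ?thesis .
  qed
  thus ?thesis using that a(1) by blast
qed

text \<open>At a general point \<open>q\<close> of \<Omega> at most \<open>CARD('v) - card T\<close>
  gradients are independent, so those of the \<open>f j\<close> already span all gradients of
  members of \<open>I\<close>, and a field that kills each \<open>f j\<close> kills \<open>g\<close>
  at \<open>q\<close>. Primality extends this from general points to all of \<Omega>.\<close>

lemma annihilating_field_preserves_ideal:
  assumes x: "x \<in> \<Omega>" and f: "\<And>j. j < k \<Longrightarrow> f j \<in> I" and k: "CARD('v) - card T \<le> k"
    and s: "peval (($) x) s \<noteq> 0" "\<And>q. peval (($) q) s \<noteq> 0 \<Longrightarrow> indep_gradients f k q"
    and b: "\<And>j. j < k \<Longrightarrow> vector_field b (f j) = 0"
    and g: "g \<in> I"
  shows "vector_field b g \<in> I"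
proof (rule ccontr)
  assume nI: "vector_field b g \<notin> I"
  obtain a where a: "a \<notin> I" "\<And>x G. x \<in> \<Omega> \<Longrightarrow> peval (($) x) a \<noteq> 0 \<Longrightarrow>
      G \<subseteq> (\<lambda>g. gradient g x) ` I \<Longrightarrow> vec.independent G \<Longrightarrow> card G \<le> CARD('v) - card T"
    using gradients_dimension by blast
  have "s \<notin> I" using s(1) x by (auto simp: in_I_iff)
  hence "s * (a * vector_field b g) \<notin> I" using a(1) nI prime by blast
  then obtain q where q: "q \<in> \<Omega>" "peval (($) q) s \<noteq> 0" "peval (($) q) a \<noteq> 0"
    "peval (($) q) (vector_field b g) \<noteq> 0" by (auto simp: in_I_iff)
  let ?G = "(\<lambda>i. gradient (f i) q) ` {..<k}"
  have G: "vec.independent ?G" "card ?G = k" using indep_gradients_card[OF s(2)[OF q(2)]] by auto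
  have ng: "gradient g q \<notin> vec.span ?G"
  proof
    assume "gradient g q \<in> vec.span ?G"
    hence "(\<Sum>i\<in>UNIV. peval (($) q) (b i) * gradient g q $ i) = 0"
    proof (induction rule: vec.span_induct_alt)
      case (step c y z)
      then obtain j where j: "j < k" "y = gradient (f j) q" by auto
      have "(\<Sum>i\<in>UNIV. peval (($) q) (b i) * y $ i) = 0"
        using b[OF j(1)] by (simp add: j(2) flip: peval_vector_field)
      moreover have "(\<Sum>i\<in>UNIV. peval (($) q) (b i) * (c *s y + z) $ i) =
          c * (\<Sum>i\<in>UNIV. peval (($) q) (b i) * y $ i) + (\<Sum>i\<in>UNIV. peval (($) q) (b i) * z $ i)"
        by (simp add: distrib_left sum.distrib sum_distrib_left mult.left_commute)
      ultimately show ?case using step by simp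
    qed simp
    thus False using q(4) by (simp add: peval_vector_field)
  qed
  hence "gradient g q \<notin> ?G" by (rule contrapos_nn) (rule vec.span_base)
  hence "card (insert (gradient g q) ?G) = Suc k" using G(2) by simp
  moreover have "card (insert (gradient g q) ?G) \<le> CARD('v) - card T"
  proof (rule a(2)[OF q(1,3)])
    show "insert (gradient g q) ?G \<subseteq> (\<lambda>g. gradient g q) ` I" using g f by auto
    show "vec.independent (insert (gradient g q) ?G)" using G(1) ng by (simp add: vec.independent_insert)
  qed
  ultimately show False using k by simp
qed

end

section \<open>Transcendence degree and relations between gradients\<close>

lemma coord_ring_trdeg_eq: "coord_ring_trdeg Z =
    Sup {k. \<exists>f :: nat \<Rightarrow> ('m::finite, complex) mpoly. \<forall>P :: (nat, complex) mpoly.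
           poly_vars P \<subseteq> {..<k} \<longrightarrow> poly_subst Const f P \<in> vanishing_ideal Z \<longrightarrow> P = 0}"
  by (simp add: coord_ring_trdeg_def vanishing_ideal_def peval_poly_subst_Const)

lemma coord_ring_trdeg_cong:
  "vanishing_ideal Z = vanishing_ideal Z' \<Longrightarrow> coord_ring_trdeg Z = coord_ring_trdeg (Z' :: (complex ^ 'm::finite) set)"
  by (simp add: coord_ring_trdeg_eq)

definition rename :: "('v \<Rightarrow> 'w) \<Rightarrow> ('v, complex) mpoly \<Rightarrow> ('w, complex) mpoly"
  where "rename r f = poly_subst Const (\<lambda>i. Var (r i)) f"

lemma peval_rename: "peval w (rename r f) = peval (\<lambda>i. w (r i)) f"
  by (simp add: rename_def peval_poly_subst_Const)

lemma rename_polys_in: "f \<in> polys_in S \<Longrightarrow> rename r f \<in> polys_in (r ` S)"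
  unfolding rename_def by (intro polys_in_poly_subst polys_in_Var) (auto simp: polys_in_def)

context transcendence_basis
begin

lemma algebraic_relations:
  "\<exists>hh mm cc. algebraic_over UNIV T (($) ` \<Omega>) hh mm cc \<and> (\<forall>v. v \<notin> T \<longrightarrow> hh v \<notin> I)"
proof -
  have "\<forall>v. \<exists>R. v \<notin> T \<longrightarrow> R \<in> polys_in (insert v T) \<and> R \<in> I \<and> R \<noteq> 0"
    using alg by blast
  then obtain R where R: "\<And>v. v \<notin> T \<Longrightarrow> R v \<in> polys_in (insert v T)" "\<And>v. v \<notin> T \<Longrightarrow> R v \<in> I"
    "\<And>v. v \<notin> T \<Longrightarrow> R v \<noteq> 0" by metis
  define p where "p v = univ_at v (R v)" for v
  have c: "coeff (p v) j \<in> polys_in T" if "v \<notin> T" for v j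
    unfolding p_def using R(1)[OF that] that by (rule coeff_univ_at_in)
  have "lead_coeff (p v) \<notin> I" if v: "v \<notin> T" for v
  proof
    assume "lead_coeff (p v) \<in> I"
    hence "lead_coeff (p v) = 0" using indep c[OF v] by blast
    thus False using R(3)[OF v] by (simp add: p_def)
  qed
  moreover have "algebraic_over UNIV T (($) ` \<Omega>) (\<lambda>v. lead_coeff (p v)) (\<lambda>v. degree (p v)) (\<lambda>v j. - coeff (p v) j)"
  proof
    fix v assume "v \<in> UNIV - T"
    hence v: "v \<notin> T" by simp
    show "lead_coeff (p v) \<in> polys_in T" by (rule c[OF v])
    show "- coeff (p v) j \<in> polys_in T" for j by (intro polys_in_uminus c v)
    fix w assume "w \<in> ($) ` \<Omega>"
    then obtain x where x: "w = ($) x" "x \<in> \<Omega>" by blast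
    hence "0 = peval w (poly (p v) (Var v))"
      using R(2)[OF v] by (simp add: in_I_iff p_def poly_univ_at)
    also have "\<dots> = (\<Sum>j\<le>degree (p v). peval w (coeff (p v) j) * w v ^ j)"
      by (simp add: poly_altdef)
    also have "\<dots> = (\<Sum>j<degree (p v). peval w (coeff (p v) j) * w v ^ j)
        + peval w (lead_coeff (p v)) * w v ^ degree (p v)"
      by (simp flip: lessThan_Suc_atMost)
    finally show "peval w (lead_coeff (p v)) * w v ^ degree (p v) =
        (\<Sum>j<degree (p v). peval w (- coeff (p v) j) * w v ^ j)"
      by (simp add: sum_negf eq_neg_iff_add_eq_0 add.commute)
  qed simp_all
  ultimately show ?thesis by blast
qed

lemma independent_polys_card_le:
  assumes "\<And>P :: (nat, complex) mpoly. poly_vars P \<subseteq> {..<k} \<Longrightarrow> poly_subst Const f P \<in> I \<Longrightarrow> P = 0"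
  shows "k \<le> card T"
proof (rule ccontr)
  assume k: "\<not> k \<le> card T"
  obtain hh mm cc where rel: "algebraic_over UNIV T (($) ` \<Omega>) hh mm cc"
    and hI: "\<And>v. v \<notin> T \<Longrightarrow> hh v \<notin> I" using algebraic_relations by blast
  interpret A: algebraic_over UNIV T "($) ` \<Omega>" hh mm cc by (rule rel)
  have h: "A.h \<notin> I" unfolding A.h_def by (intro I_prod hI) simp_all
  obtain P :: "(nat, complex) mpoly" where P: "P \<noteq> 0" "poly_vars P \<subseteq> {..<k}"
    "\<forall>w\<in>($) ` \<Omega>. peval w A.h \<noteq> 0 \<longrightarrow> peval (\<lambda>i. peval w (f i)) P = 0"
    using A.dependent_polys[of "{..<k}" f] k by auto
  have "A.h * poly_subst Const f P \<in> I"
    unfolding in_I_iff peval_mult peval_poly_subst_Const mult_eq_0_iff using P(3) by blast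
  hence "poly_subst Const f P \<in> I" using prime h by blast
  thus False using assms P(1,2) by blast
qed

lemma coord_ring_trdeg_le: "coord_ring_trdeg \<Omega> \<le> card T"
proof -
  let ?K = "{k. \<exists>f :: nat \<Rightarrow> ('v, complex) mpoly. \<forall>P :: (nat, complex) mpoly.
           poly_vars P \<subseteq> {..<k} \<longrightarrow> poly_subst Const f P \<in> I \<longrightarrow> P = 0}"
  have K: "k \<le> card T" if "k \<in> ?K" for k
    using that independent_polys_card_le[of k] by blast
  show ?thesis
    unfolding coord_ring_trdeg_eq
  proof (cases "?K = {}")
    case True
    thus "Sup ?K \<le> card T" by (simp only: Sup_nat_empty)
  next
    case False
    thus "Sup ?K \<le> card T" using K by (rule cSup_least)
  qed
qed

text \<open>A set of natural numbers lies below its \<open>Sup\<close> only if it is bounded; the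
  bound comes from \<open>independent_polys_card_le\<close>.\<close>

lemma le_coord_ring_trdeg:
  assumes "\<And>P :: (nat, complex) mpoly. poly_vars P \<subseteq> {..<k} \<Longrightarrow> poly_subst Const f P \<in> I \<Longrightarrow> P = 0"
  shows "k \<le> coord_ring_trdeg \<Omega>"
proof -
  let ?K = "{k. \<exists>f :: nat \<Rightarrow> ('v, complex) mpoly. \<forall>P :: (nat, complex) mpoly.
           poly_vars P \<subseteq> {..<k} \<longrightarrow> poly_subst Const f P \<in> I \<longrightarrow> P = 0}"
  have "l \<le> card T" if "l \<in> ?K" for l
    using that independent_polys_card_le[of l] by blast
  hence "bdd_above ?K" by (rule bdd_aboveI)
  moreover have "k \<in> ?K" using assms by blast
  ultimately show ?thesis unfolding coord_ring_trdeg_eq by (intro cSup_upper)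
qed

text \<open>At a general point, all gradients are combinations of \<open>CARD('v) - card T\<close> vectors that depend
  polynomially on the point. The pairs of a point and a coefficient vector therefore have
  \<open>CARD('v)\<close> independent coordinates, one less than the number of entries of a gradient and one
  coordinate of the point.\<close>

lemma exists_gradient_relation:
  fixes v0 :: 'v
  obtains P :: "('v option, complex) mpoly" and s where "P \<noteq> 0" "s \<notin> I"
    "\<And>x g. x \<in> \<Omega> \<Longrightarrow> peval (($) x) s \<noteq> 0 \<Longrightarrow> g \<in> I \<Longrightarrow>
       peval (case_option (x $ v0) (($) (gradient g x))) P = 0"
proof -
  obtain a E where a: "a \<notin> I" and E: "\<And>g x i. g \<in> I \<Longrightarrow> x \<in> \<Omega> \<Longrightarrow> peval (($) x) a \<noteq> 0 \<Longrightarrow>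
    gradient g x $ i = (\<Sum>l\<in>- T. gradient g x $ l / peval (($) x) a * peval (($) x) (E l i))"
    using gradients_parametrized by blast
  obtain hh mm cc where rel: "algebraic_over UNIV T (($) ` \<Omega>) hh mm cc"
    and hI: "\<And>v. v \<notin> T \<Longrightarrow> hh v \<notin> I" using algebraic_relations by blast
  interpret R: algebraic_over UNIV T "($) ` \<Omega>" hh mm cc by (rule rel)
  \<comment> \<open>The \<open>Inl\<close> variables are the coordinates of the point; the
    \<open>Inr\<close> variables are the coefficients of a gradient in the parametrization, one for
    each index outside \<open>T\<close>.\<close>
  define V T' :: "('v + 'v) set" where "V = range Inl \<union> Inr ` (- T)" and "T' = Inl ` T \<union> Inr ` (- T)"
  define \<Omega>' where "\<Omega>' = {w :: 'v + 'v \<Rightarrow> complex. (\<chi> v. w (Inl v)) \<in> \<Omega>}"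
  define hh' where "hh' z = rename (Inl :: 'v \<Rightarrow> 'v + 'v) (hh (projl z))" for z :: "'v + 'v"
  define cc' where "cc' z j = rename (Inl :: 'v \<Rightarrow> 'v + 'v) (cc (projl z) j)" for z :: "'v + 'v" and j
  define mm' where "mm' z = mm (projl z)" for z :: "'v + 'v"
  have VT: "V - T' = Inl ` (- T)" by (auto simp: V_def T'_def)
  have ren: "rename Inl f \<in> polys_in T'" if "f \<in> polys_in T" for f :: "('v, complex) mpoly"
    using rename_polys_in[OF that, of "Inl :: 'v \<Rightarrow> 'v + 'v"] polys_in_mono[of "Inl ` T" T']
    unfolding T'_def by blast
  have vl: "($) (\<chi> v. w (Inl v)) = (\<lambda>v. w (Inl v))" for w :: "'v + 'v \<Rightarrow> complex"
    by auto
  have ev: "peval w (rename Inl f) = peval (($) (\<chi> v. w (Inl v))) f" for w :: "'v + 'v \<Rightarrow> complex" and f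
    by (simp add: peval_rename vl)
  interpret A: algebraic_over V T' \<Omega>' hh' mm' cc'
  proof
    show "finite V" by simp
    show "T' \<subseteq> V" by (auto simp: V_def T'_def)
    fix v assume "v \<in> V - T'"
    then obtain u where u: "v = Inl u" "u \<notin> T" unfolding VT by blast
    show "hh' v \<in> polys_in T'" unfolding hh'_def u(1) sum.sel by (intro ren R.hT) (simp add: u(2))
    show "cc' v j \<in> polys_in T'" for j unfolding cc'_def u(1) sum.sel by (intro ren R.cT) (simp add: u(2))
    fix w assume "w \<in> \<Omega>'"
    hence w: "(\<chi> v. w (Inl v)) \<in> \<Omega>" by (simp add: \<Omega>'_def)
    show "peval w (hh' v) * w v ^ mm' v = (\<Sum>j<mm' v. peval w (cc' v j) * w v ^ j)"
      using R.rel[of u, OF _ imageI[OF w]] u(2) by (simp add: hh'_def cc'_def mm'_def u(1) ev vl)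
  qed
  define h where "h = (\<Prod>v\<in>- T. hh v)"
  have h: "h \<notin> I" unfolding h_def by (intro I_prod hI) simp_all
  have evh: "peval w A.h = peval (($) (\<chi> v. w (Inl v))) h" for w
    unfolding A.h_def VT h_def by (simp add: prod.reindex hh'_def ev)
  define y :: "'v option \<Rightarrow> ('v + 'v, complex) mpoly"
    where "y = case_option (Var (Inl v0)) (\<lambda>i. \<Sum>l\<in>- T. Var (Inr l) * rename Inl (E l i))"
  have "card T' = CARD('v)"
  proof -
    have "card T' = card (Inl ` T :: ('v + 'v) set) + card (Inr ` (- T) :: ('v + 'v) set)"
      unfolding T'_def by (rule card_Un_disjoint) auto
    also have "\<dots> = card T + card (- T)" by (simp add: card_image)
    also have "\<dots> = card (T \<union> - T)" by (rule card_Un_disjoint[symmetric]) auto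
    finally show ?thesis by simp
  qed
  moreover have "y i \<in> polys_in V" for i
  proof (cases i)
    case None
    show ?thesis unfolding y_def None by (simp add: polys_in_Var V_def)
  next
    case (Some j)
    have "rename Inl (E l j) \<in> polys_in V" for l
      using rename_polys_in[of "E l j" UNIV "Inl :: 'v \<Rightarrow> 'v + 'v"] polys_in_mono[of "range Inl" V]
      unfolding V_def by auto
    thus ?thesis unfolding y_def Some option.case
      by (intro polys_in_sum polys_in_mult polys_in_Var) (auto simp: V_def)
  qed
  ultimately obtain P :: "('v option, complex) mpoly" where P: "P \<noteq> 0"
    "\<forall>w\<in>\<Omega>'. peval w A.h \<noteq> 0 \<longrightarrow> peval (\<lambda>i. peval w (y i)) P = 0"
    using A.dependent_polys[of UNIV y] by (auto simp: UNIV_option_conv card_image)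
  have "peval (case_option (x $ v0) (($) (gradient g x))) P = 0"
    if x: "x \<in> \<Omega>" and s: "peval (($) x) (a * h) \<noteq> 0" and g: "g \<in> I" for x g
  proof -
    define w :: "'v + 'v \<Rightarrow> complex"
      where "w = case_sum (($) x) (\<lambda>l. gradient g x $ l / peval (($) x) a)"
    have wx: "(\<chi> v. w (Inl v)) = x" by (simp add: w_def vec_eq_iff)
    have "peval w (y i) = case_option (x $ v0) (($) (gradient g x)) i" for i
    proof (cases i)
      case None
      thus ?thesis by (simp add: y_def w_def)
    next
      case (Some j)
      have "peval w (y (Some j)) = (\<Sum>l\<in>- T. gradient g x $ l / peval (($) x) a * peval (($) x) (E l j))"
        unfolding y_def option.case peval_sum peval_mult peval_Var ev wx by (simp add: w_def)
      also have "\<dots> = gradient g x $ j" using E[OF g x, of j] s by simp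
      finally show ?thesis using Some by simp
    qed
    moreover have "w \<in> \<Omega>'" using x wx by (simp add: \<Omega>'_def)
    moreover have "peval w A.h \<noteq> 0" using s by (simp add: evh wx)
    ultimately show ?thesis using P(2) by auto
  qed
  moreover have "a * h \<notin> I" using prime a h by blast
  ultimately show ?thesis using that P(1) by blast
qed

end

section \<open>Minors of the Jacobian matrix\<close>

text \<open>Composing with the transposition of \<open>i\<close> and \<open>j\<close> changes the
  sign of every term and keeps its product, so the sum is its own negative.\<close>

lemma leibniz_repeated_row:
  fixes M :: "nat \<Rightarrow> nat \<Rightarrow> complex"
  assumes "i < c" "j < c" "i \<noteq> j" "\<And>l. M i l = M j l"
  shows "(\<Sum>\<pi> | \<pi> permutes {..<c}. of_int (sign \<pi>) * (\<Prod>k<c. M k (\<pi> k))) = 0"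
proof -
  let ?S = "{\<pi>. \<pi> permutes {..<c}}"
  let ?t = "\<lambda>\<pi>. of_int (sign \<pi>) * (\<Prod>k<c. M k (\<pi> k))"
  let ?\<tau> = "Transposition.transpose i j"
  have tau: "?\<tau> permutes {..<c}" using assms by (intro permutes_swap_id) auto
  have "sum ?t ?S = sum (\<lambda>\<pi>. ?t (\<pi> \<circ> ?\<tau>)) ?S"
    by (rule sum.reindex_bij_witness[of _ "\<lambda>\<pi>. \<pi> \<circ> ?\<tau>" "\<lambda>\<pi>. \<pi> \<circ> ?\<tau>"])
       (auto simp: comp_assoc tau permutes_compose)
  also have "\<dots> = sum (\<lambda>\<pi>. - ?t \<pi>) ?S"
  proof (rule sum.cong)
    fix \<pi> assume "\<pi> \<in> ?S"
    hence p: "permutation \<pi>" "permutation ?\<tau>" using tau permutation_permutes by blast+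
    have "(\<Prod>k<c. M k ((\<pi> \<circ> ?\<tau>) k)) = (\<Prod>k<c. M (?\<tau> k) (\<pi> k))"
      by (subst prod.permute[OF tau]) (simp add: comp_def)
    also have "\<dots> = (\<Prod>k<c. M k (\<pi> k))"
      by (rule prod.cong) (use assms in \<open>auto simp: Transposition.transpose_def\<close>)
    finally show "?t (\<pi> \<circ> ?\<tau>) = - ?t \<pi>"
      using p assms(3) by (simp add: sign_compose sign_swap_id)
  qed simp
  also have "\<dots> = - sum ?t ?S" by (rule sum_negf)
  finally show ?thesis by simp
qed

text \<open>As a function of its \<open>j\<close>-th row the minor is linear, and it vanishes on the
  earlier rows, hence on their span.\<close>

lemma jacobian_minor_indep_gradients:
  fixes x :: "complex ^ 'm::finite"
  assumes "jacobian_minor c r s x \<noteq> 0"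
  shows "indep_gradients r c x"
  unfolding indep_gradients_def
proof (intro allI impI notI)
  fix j assume j: "j < c" "gradient (r j) x \<in> vec.span ((\<lambda>i. gradient (r i) x) ` {..<j})"
  define M where "M w k l = (if k = j then w $ s l else gradient (r k) x $ s l)" for w :: "complex ^ 'm" and k l
  define D where "D w = (\<Sum>\<pi> | \<pi> permutes {..<c}. of_int (sign \<pi>) * (\<Prod>k<c. M w k (\<pi> k)))" for w
  have Mprod: "(\<Prod>k<c. M w k (\<pi> k)) = w $ s (\<pi> j) * (\<Prod>k\<in>{..<c} - {j}. gradient (r k) x $ s (\<pi> k))" for w \<pi>
    using j(1) by (subst prod.remove[of _ j]) (auto simp: M_def intro!: prod.cong)
  have lin: "D (a *s v + w) = a * D v + D w" for a v w
    unfolding D_def Mprod by (simp add: distrib_right distrib_left sum.distrib sum_distrib_left ac_simps)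
  have "D w = 0" if "w \<in> vec.span ((\<lambda>i. gradient (r i) x) ` {..<j})" for w
    using that
  proof (induction rule: vec.span_induct_alt)
    case base
    show ?case using lin[of "-1" 0 0] by simp
  next
    case (step a v w)
    then obtain i where i: "i < j" "v = gradient (r i) x" by auto
    have "D v = 0"
      unfolding D_def by (rule leibniz_repeated_row[of i c j]) (use i j in \<open>auto simp: M_def\<close>)
    thus ?case using step lin by simp
  qed
  moreover have "D (gradient (r j) x) = jacobian_minor c r s x"
    unfolding D_def jacobian_minor_def M_def by (intro sum.cong arg_cong2[where f = "(*)"] prod.cong) auto
  ultimately show False using assms j(2) by simp
qed

section \<open>Zariski closures\<close>

text \<open>Elements of a projective variety are nonzero vectors, so a set containing 0 has no
  closed superset and its hull would be the whole space.\<close>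

lemma zariski_closure_eq:
  assumes "0 \<notin> S"
  shows "zariski_closure S = {x. x \<noteq> 0 \<and> (\<forall>f. homogeneous f \<longrightarrow> f \<in> vanishing_ideal S \<longrightarrow> peval (($) x) f = 0)}"
    (is "_ = ?Z")
proof
  have "projective_variety ?Z"
    unfolding projective_variety_def by (intro exI[of _ "{f. homogeneous f \<and> f \<in> vanishing_ideal S}"]) auto
  moreover have "S \<subseteq> ?Z" using assms by (auto simp: vanishing_ideal_def)
  ultimately show "zariski_closure S \<subseteq> ?Z" unfolding zariski_closure_def by (intro hull_minimal)
next
  show "?Z \<subseteq> zariski_closure S"
    unfolding zariski_closure_def hull_def
  proof (intro subsetI InterI, clarify)
    fix x t assume x: "x \<noteq> 0" "\<forall>f. homogeneous f \<longrightarrow> f \<in> vanishing_ideal S \<longrightarrow> peval (($) x) f = 0"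
      and t: "projective_variety t" "S \<subseteq> t"
    then obtain F where F: "\<forall>f\<in>F. homogeneous f" "t = {x. x \<noteq> 0 \<and> (\<forall>f\<in>F. peval (($) x) f = 0)}"
      by (auto simp: projective_variety_def)
    hence "f \<in> vanishing_ideal S" if "f \<in> F" for f
      using t(2) that unfolding vanishing_ideal_def by blast
    thus "x \<in> t" using F x by blast
  qed
qed

text \<open>All homogeneous coordinate vectors of the projective points represented in
  \<open>S\<close>.\<close>

definition scaling_cone :: "(complex ^ 'm) set \<Rightarrow> (complex ^ 'm) set"
  where "scaling_cone S = {\<mu> *s x | \<mu> x. \<mu> \<noteq> 0 \<and> x \<in> S}"

lemma scaling_cone_scale: "y \<in> scaling_cone S \<Longrightarrow> t \<noteq> 0 \<Longrightarrow> t *s y \<in> scaling_cone S"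
proof -
  assume "y \<in> scaling_cone S" "t \<noteq> 0"
  then obtain \<mu> x where "y = \<mu> *s x" "\<mu> \<noteq> 0" "x \<in> S" by (auto simp: scaling_cone_def)
  hence "t *s y = (t * \<mu>) *s x" "t * \<mu> \<noteq> 0" using \<open>t \<noteq> 0\<close> by auto
  thus ?thesis using \<open>x \<in> S\<close> unfolding scaling_cone_def by blast
qed

lemma subset_scaling_cone: "S \<subseteq> scaling_cone S"
  unfolding scaling_cone_def by (auto intro!: exI[of _ "1::complex"])

lemma vec_nth_scale: "($) (t *s y) = (\<lambda>i. t * y $ i)"
  by auto

lemma homog_comp_in_vanishing_ideal_scaling_cone:
  fixes S :: "(complex ^ 'm::finite) set"
  assumes "f \<in> vanishing_ideal (scaling_cone S)"
  shows "homog_comp d f \<in> vanishing_ideal (scaling_cone S)"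
  unfolding vanishing_ideal_def mem_Collect_eq
proof
  fix x assume "x \<in> scaling_cone S"
  hence "peval (\<lambda>i. t * x $ i) f = 0" if "t \<noteq> 0" for t
    using assms scaling_cone_scale[OF _ that, of x S] by (auto simp: vanishing_ideal_def simp flip: vec_nth_scale)
  thus "peval (($) x) (homog_comp d f) = 0" by (rule peval_homog_comp_eq_0)
qed

text \<open>If \<open>f\<close> vanishes on the cone, so do its homogeneous components, and these
  are equations of the closure. The explicit cone can therefore replace the closure in statements
  about the ideal.\<close>

lemma vanishing_ideal_zariski_closure:
  fixes S :: "(complex ^ 'm::finite) set"
  assumes "0 \<notin> S"
  shows "vanishing_ideal (zariski_closure S) = vanishing_ideal (scaling_cone S)"
proof (intro subset_antisym subsetI)
  fix f assume f: "f \<in> vanishing_ideal (zariski_closure S)"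
  have "y \<in> zariski_closure S" if yS: "y \<in> scaling_cone S" for y
  proof -
    obtain \<mu> x where y: "y = \<mu> *s x" "\<mu> \<noteq> 0" "x \<in> S" using yS by (auto simp: scaling_cone_def)
    hence "x \<noteq> 0" using assms by auto
    hence "y \<noteq> 0" using y by auto
    moreover have "peval (($) y) g = 0" if "homogeneous g" "g \<in> vanishing_ideal S" for g
      using homogeneous_peval_scale[OF that(1)] that(2) y(3)
      by (auto simp: y(1) vec_nth_scale vanishing_ideal_def)
    ultimately show ?thesis by (simp add: zariski_closure_eq[OF assms])
  qed
  thus "f \<in> vanishing_ideal (scaling_cone S)" using f by (auto simp: vanishing_ideal_def)
next
  fix f assume f: "f \<in> vanishing_ideal (scaling_cone S)"
  have "homog_comp d f \<in> vanishing_ideal S" for d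
    using homog_comp_in_vanishing_ideal_scaling_cone[OF f, of d] subset_scaling_cone[of S]
    by (auto simp: vanishing_ideal_def)
  hence "peval (($) x) (homog_comp d f) = 0" if "x \<in> zariski_closure S" for x d
    using that homogeneous_homog_comp[of d f] by (simp add: zariski_closure_eq[OF assms])
  hence "peval (($) x) f = 0" if "x \<in> zariski_closure S" for x
    by (subst homog_comp_sum[OF order_refl]) (simp add: that)
  thus "f \<in> vanishing_ideal (zariski_closure S)" by (simp add: vanishing_ideal_def)
qed

lemma projective_variety_zariski_closure: "0 \<notin> S \<Longrightarrow> projective_variety (zariski_closure S)"
  unfolding zariski_closure_eq projective_variety_def
  by (intro exI[of _ "{f. homogeneous f \<and> f \<in> vanishing_ideal S}"]) auto

lemma irreducible_variety_zariski_closure: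
  fixes S :: "(complex ^ 'm::finite) set"
  assumes "0 \<notin> S" "S \<noteq> {}"
    and prime: "\<And>f g. f * g \<in> vanishing_ideal (zariski_closure S) \<Longrightarrow>
       f \<in> vanishing_ideal (zariski_closure S) \<or> g \<in> vanishing_ideal (zariski_closure S)"
  shows "irreducible_variety projective_variety (zariski_closure S)"
  unfolding irreducible_variety_def
proof (intro conjI allI impI)
  let ?Z = "zariski_closure S"
  show "projective_variety ?Z" using assms(1) by (rule projective_variety_zariski_closure)
  show "?Z \<noteq> {}" using assms(2) hull_subset[of S projective_variety] by (auto simp: zariski_closure_def)
  fix A B assume AB: "projective_variety A" "projective_variety B" "?Z = A \<union> B"
  have ex: "\<exists>f. (\<forall>x\<in>A. peval (($) x) f = 0) \<and> f \<notin> vanishing_ideal ?Z"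
    if A: "projective_variety A" "A \<subseteq> ?Z" "?Z \<noteq> A" for A
  proof -
    obtain F where F: "A = {x. x \<noteq> 0 \<and> (\<forall>f\<in>F. peval (($) x) f = 0)}"
      using \<open>projective_variety A\<close> by (auto simp: projective_variety_def)
    obtain x where x: "x \<in> ?Z" "x \<notin> A" using A(2,3) by blast
    hence "x \<noteq> 0" by (simp add: zariski_closure_eq[OF assms(1)])
    then obtain f where "f \<in> F" "peval (($) x) f \<noteq> 0" using x F by blast
    thus ?thesis using x F by (intro exI[of _ f]) (auto simp: vanishing_ideal_def)
  qed
  show "?Z = A \<or> ?Z = B"
  proof (rule ccontr)
    assume "\<not> ?thesis"
    then obtain f g where fg: "\<forall>x\<in>A. peval (($) x) f = 0" "f \<notin> vanishing_ideal ?Z"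
      "\<forall>x\<in>B. peval (($) x) g = 0" "g \<notin> vanishing_ideal ?Z"
      using ex[OF AB(1)] ex[OF AB(2)] AB(3) by blast
    have "f * g \<in> vanishing_ideal ?Z" using fg(1,3) unfolding AB(3) by (auto simp: vanishing_ideal_def)
    thus False using prime fg(2,4) by blast
  qed
qed

section \<open>The conormal variety of an irreducible cone\<close>

lemma vec_nth_gradient: "($) (gradient g x) = (\<lambda>i. peval (($) x) (partial_deriv i g))"
  by (auto simp: gradient_def)

lemma derivation_partial_deriv: "derivation (partial_deriv i :: ('v, 'a::comm_ring_1) mpoly \<Rightarrow> _)"
  by (simp add: derivation_def)

locale irreducible_cone = irreducible_set \<Omega> for \<Omega> :: "(complex ^ 'v::finite) set" +
  assumes conic: "x \<in> \<Omega> \<Longrightarrow> t \<noteq> 0 \<Longrightarrow> t *s x \<in> \<Omega>"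
begin

text \<open>For a cone of regular points these are 0 and the coordinate vectors of the hyperplanes
  tangent at points of \<Omega> itself. Adding gradients at points of the closure would not change
  the ideal \<open>J\<close>, by \<open>in_J_iff\<close>.\<close>

definition conormal :: "(complex ^ 'v) set"
  where "conormal = {gradient g x | g x. g \<in> I \<and> x \<in> \<Omega>}"

abbreviation "J \<equiv> vanishing_ideal conormal"

definition along_gradient :: "('v, complex) mpoly \<Rightarrow> ('v, complex) mpoly \<Rightarrow> ('v, complex) mpoly"
  where "along_gradient g G = poly_subst Const (\<lambda>i. partial_deriv i g) G"

lemma peval_along_gradient: "peval (($) x) (along_gradient g G) = peval (($) (gradient g x)) G"
  by (simp add: along_gradient_def peval_poly_subst_Const vec_nth_gradient)

lemma in_J_iff: "G \<in> J \<longleftrightarrow> (\<forall>g\<in>I. along_gradient g G \<in> I)"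
proof -
  have "G \<in> J \<longleftrightarrow> (\<forall>g\<in>I. \<forall>x\<in>\<Omega>. peval (($) (gradient g x)) G = 0)"
    by (subst vanishing_ideal_def) (unfold conormal_def, blast)
  thus ?thesis by (simp add: in_I_iff[of "along_gradient _ _"] peval_along_gradient)
qed

lemma zero_in_conormal: "0 \<in> conormal"
proof -
  obtain x where "x \<in> \<Omega>" using nonempty by blast
  moreover have "(0 :: complex ^ 'v) = gradient 0 x" by simp
  ultimately show ?thesis unfolding conormal_def using I_0 by blast
qed

text \<open>\<open>G\<close> and \<open>H\<close> may fail at different points and for different
  members \<open>g\<close>, \<open>h\<close> of \<open>I\<close>. The pencil \<open>k t\<close>
  joins \<open>g\<close> to \<open>h\<close> inside \<open>I\<close>, and for all but finitely many
  \<open>t\<close> a single member fails for both. Primality of \<open>I\<close> does the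
  rest.\<close>

lemma conormal_prime:
  assumes "G * H \<in> J"
  shows "G \<in> J \<or> H \<in> J"
proof (rule ccontr)
  assume "\<not> ?thesis"
  then obtain g h x y where g: "g \<in> I" "x \<in> \<Omega>" "peval (($) (gradient g x)) G \<noteq> 0"
    and h: "h \<in> I" "y \<in> \<Omega>" "peval (($) (gradient h y)) H \<noteq> 0"
    unfolding in_J_iff in_I_iff[of "along_gradient _ _"] peval_along_gradient by blast
  define k where "k t = Const (1 - t) * g + Const t * h" for t
  have kI: "k t \<in> I" for t unfolding k_def using g h by (intro I_add I_mult)
  have k: "($) (gradient (k t) z) = (\<lambda>i. gradient g z $ i + t * (gradient h z $ i - gradient g z $ i))" for t z
    unfolding k_def gradient_add gradient_Const_mult by (rule ext) (simp add: algebra_simps)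
  define p where "p = line_poly (($) (gradient g x)) (\<lambda>i. gradient h x $ i - gradient g x $ i) G"
  define q where "q = line_poly (($) (gradient g y)) (\<lambda>i. gradient h y $ i - gradient g y $ i) H"
  have p: "poly p t = peval (($) (gradient (k t) x)) G" and q: "poly q t = peval (($) (gradient (k t) y)) H" for t
    by (simp_all add: p_def q_def poly_line_poly k)
  have "k 0 = g" "k 1 = h" by (simp_all add: k_def Const_0 Const_1)
  hence "p \<noteq> 0" "q \<noteq> 0" using g(3) h(3) p[of 0] q[of 1] by auto
  hence "finite {t. poly (p * q) t = 0}" by (intro poly_roots_finite) simp
  then obtain t where t: "poly (p * q) t \<noteq> 0"
    using infinite_UNIV_char_0[where 'a = complex] by (metis (mono_tags, lifting) UNIV_eq_I mem_Collect_eq)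
  hence "along_gradient (k t) G \<notin> I" "along_gradient (k t) H \<notin> I"
    using g(2) h(2) by (auto simp: in_I_iff peval_along_gradient p q)
  moreover have "along_gradient (k t) G * along_gradient (k t) H \<in> I"
    using assms kI[of t] unfolding in_J_iff by (simp add: along_gradient_def poly_subst_mult coeff_hom_Const)
  ultimately show False using prime by blast
qed

lemma irreducible_set_conormal: "irreducible_set conormal"
  by unfold_locales (use zero_in_conormal conormal_prime in blast)+

text \<open>The polynomial \<open>g (t * y) / t\<close> has at \<open>y\<close> the gradient that
  \<open>g\<close> has at \<open>t * y\<close>; it lies in \<open>I\<close> because \<Omega> is a
  cone.\<close>

lemma gradient_rescale:
  assumes "g \<in> I" "t \<noteq> 0"
  obtains g' where "g' \<in> I" "\<And>y. gradient g' y = gradient g (t *s y)"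
proof
  define s where "s = (poly_subst Const (\<lambda>j. Const t * Var j) g :: ('v, complex) mpoly)"
  have ev: "peval (($) y) (poly_subst Const (\<lambda>j. Const t * Var j) f) = peval (($) (t *s y)) f" for y f
    by (simp add: peval_poly_subst_Const vec_nth_scale)
  show "Const (1 / t) * s \<in> I"
    unfolding in_I_iff using assms conic by (auto simp: s_def ev in_I_iff)
  fix y
  have "partial_deriv i s = Const t * poly_subst Const (\<lambda>j. Const t * Var j) (partial_deriv i g)" for i
  proof -
    have "partial_deriv i s = (\<Sum>j\<in>UNIV. poly_subst Const (\<lambda>j. Const t * Var j) (partial_deriv j g) *
        partial_deriv i (Const t * Var j))"
      unfolding s_def by (rule derivation_poly_subst[OF coeff_hom_Const derivation_partial_deriv]) simp
    also have "\<dots> = (\<Sum>j\<in>UNIV. if j = i then Const t * poly_subst Const (\<lambda>j. Const t * Var j) (partial_deriv j g) else 0)"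
      by (rule sum.cong) (auto simp: partial_deriv_Var mult.commute)
    finally show ?thesis by simp
  qed
  thus "gradient (Const (1 / t) * s) y = gradient g (t *s y)"
    using assms(2) by (simp add: gradient_def vec_eq_iff ev)
qed

text \<open>\<open>g\<close> vanishes along the line through 0 and \<open>x\<close>. Hence the
  hyperplane given by a gradient contains its point, the incidence condition in
  \<open>tangent_hyperplane\<close>.\<close>

lemma euler:
  assumes "g \<in> I" "x \<in> \<Omega>"
  shows "(\<Sum>i\<in>UNIV. gradient g x $ i * x $ i) = 0"
proof -
  have "line_poly (\<lambda>_. 0) (($) x) g = 0"
  proof (rule poly_0_if_vanishing_off_0)
    fix t :: complex assume "t \<noteq> 0"
    hence "peval (($) (t *s x)) g = 0" using assms conic by (simp add: in_I_iff)
    thus "poly (line_poly (\<lambda>_. 0) (($) x) g) t = 0" by (simp add: poly_line_poly vec_nth_scale)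
  qed
  hence "0 = poly (pderiv (line_poly (\<lambda>_. 0) (($) x) g)) 1" by simp
  also have "\<dots> = (\<Sum>i\<in>UNIV. gradient g x $ i * x $ i)"
    by (simp only: poly_pderiv_line_poly) (simp add: gradient_def)
  finally show ?thesis ..
qed

lemma span_gradients: "vec.span ((\<lambda>f. gradient f x) ` I) = (\<lambda>f. gradient f x) ` I"
proof (subst vec.span_eq_iff)
  show "vec.subspace ((\<lambda>f. gradient f x) ` I)"
    unfolding vec.subspace_def
  proof (intro conjI ballI allI)
    show "0 \<in> (\<lambda>f. gradient f x) ` I" by (rule image_eqI[of _ _ 0]) auto
    fix u assume u: "u \<in> (\<lambda>f. gradient f x) ` I"
    then obtain f where f: "u = gradient f x" "f \<in> I" by blast
    show "a *s u \<in> (\<lambda>f. gradient f x) ` I" for a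
      by (rule image_eqI[of _ _ "Const a * f"]) (simp_all add: f I_mult gradient_Const_mult)
    fix v assume "v \<in> (\<lambda>f. gradient f x) ` I"
    then obtain h where h: "v = gradient h x" "h \<in> I" by blast
    show "u + v \<in> (\<lambda>f. gradient f x) ` I"
      by (rule image_eqI[of _ _ "f + h"]) (simp_all add: f h I_add gradient_add)
  qed
qed

text \<open>A tangent hyperplane at a point of the closure is a gradient there, and
  \<open>along_gradient\<close> lies in the ideal of the closure. Conversely, a point of the cone is
  rescaled to one of \<open>S\<close>, which is regular, so its nonzero gradients are tangent
  hyperplanes.\<close>

lemma vanishing_ideal_dual_variety:
  assumes \<Omega>: "\<Omega> = scaling_cone S" and S0: "0 \<notin> S" and reg: "S \<subseteq> regular_points (zariski_closure S)"
    and ne: "\<exists>x\<in>regular_points (zariski_closure S). \<exists>u. tangent_hyperplane (zariski_closure S) x u"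
  shows "vanishing_ideal (dual_variety (zariski_closure S)) = J"
proof -
  let ?Z = "zariski_closure S"
  define T where "T = {u. \<exists>x\<in>regular_points ?Z. tangent_hyperplane ?Z x u}"
  have I: "vanishing_ideal ?Z = I" using vanishing_ideal_zariski_closure[OF S0] \<Omega> by simp
  have row: "jacobian_row_space ?Z x = (\<lambda>f. gradient f x) ` I" for x
    unfolding jacobian_row_space_def I by (rule span_gradients)
  have T0: "0 \<notin> T" by (simp add: T_def tangent_hyperplane_def)
  have "vanishing_ideal (dual_variety ?Z) = vanishing_ideal (scaling_cone T)"
    unfolding dual_variety_def T_def[symmetric] by (rule vanishing_ideal_zariski_closure[OF T0])
  also have "\<dots> = J"
  proof (intro subset_antisym subsetI)
    fix G assume G: "G \<in> J"
    show "G \<in> vanishing_ideal (scaling_cone T)"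
      unfolding vanishing_ideal_def mem_Collect_eq
    proof
      fix y assume "y \<in> scaling_cone T"
      then obtain \<mu> u where y: "y = \<mu> *s u" "u \<in> T" unfolding scaling_cone_def by blast
      then obtain x where x: "x \<in> ?Z" "u \<in> (\<lambda>f. gradient f x) ` I"
        unfolding T_def regular_points_def tangent_hyperplane_def row by blast
      then obtain g where g: "g \<in> I" "u = gradient g x" by blast
      have "along_gradient (Const \<mu> * g) G \<in> vanishing_ideal ?Z"
        unfolding I using G g(1) by (simp add: in_J_iff I_mult)
      hence "peval (($) x) (along_gradient (Const \<mu> * g) G) = 0"
        using x(1) by (simp add: vanishing_ideal_def)
      thus "peval (($) y) G = 0" by (simp add: peval_along_gradient gradient_Const_mult y(1) g(2))
    qed
  next
    fix G assume G: "G \<in> vanishing_ideal (scaling_cone T)"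
    have van: "peval (($) (t *s u)) G = 0" if "u \<in> T" "t \<noteq> 0" for t u
      using G that unfolding vanishing_ideal_def scaling_cone_def by blast
    \<comment> \<open>The zero gradient is no hyperplane. \<open>G\<close> vanishes there because it
      vanishes on the punctured line through any tangent hyperplane; \<open>ne\<close> provides
      one.\<close>
    have G0: "peval (($) 0) G = 0"
    proof -
      obtain u where u: "u \<in> T" using ne by (auto simp: T_def)
      have "line_poly (\<lambda>_. 0) (($) u) G = 0"
        by (rule poly_0_if_vanishing_off_0) (use van[OF u] in \<open>simp add: poly_line_poly vec_nth_scale\<close>)
      hence "peval (\<lambda>i. 0) G = 0" using poly_line_poly[of "\<lambda>_. 0" "($) u" G 0] by simp
      moreover have "($) (0 :: complex ^ 'v) = (\<lambda>i. 0)" by auto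
      ultimately show ?thesis by simp
    qed
    show "G \<in> J"
      unfolding in_J_iff in_I_iff[of "along_gradient _ _"] peval_along_gradient
    proof (intro ballI)
      fix g x assume g: "g \<in> I" and "x \<in> \<Omega>"
      then obtain \<mu> s where x: "x = \<mu> *s s" "\<mu> \<noteq> 0" "s \<in> S" unfolding \<Omega> scaling_cone_def by blast
      obtain g' where g': "g' \<in> I" "\<And>y. gradient g' y = gradient g (\<mu> *s y)"
        using gradient_rescale[OF g x(2)] by blast
      have u: "gradient g x = gradient g' s" by (simp add: g'(2) x(1))
      show "peval (($) (gradient g x)) G = 0"
      proof (cases "gradient g x = 0")
        case True
        thus ?thesis using G0 by simp
      next
        case False
        have "s \<in> \<Omega>" unfolding \<Omega> using x(3) subset_scaling_cone by blast
        hence "tangent_hyperplane ?Z s (gradient g x)"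
          unfolding tangent_hyperplane_def row u using False g'(1) euler[OF g'(1)] by (simp add: u)
        hence "gradient g x \<in> T" unfolding T_def using x(3) reg by blast
        from van[OF this, of 1] show ?thesis by simp
      qed
    qed
  qed
  finally show ?thesis .
qed

text \<open>Counting gives a relation \<open>P\<close> between the gradient entries and the extra
  coordinate \<open>x $ v0\<close>. Moving \<open>x\<close> along its line while adapting the member
  of \<open>I\<close> keeps the gradient and changes \<open>x $ v0\<close> freely, so the
  coefficients of \<open>P\<close> in that coordinate vanish separately; the leading one is
  \<open>G\<close>.\<close>

lemma exists_nonzero_in_J:
  assumes v0: "\<And>x. x \<in> \<Omega> \<Longrightarrow> x $ v0 \<noteq> 0"
  shows "\<exists>G\<in>J. G \<noteq> 0"
proof -
  obtain T where "(\<forall>f. f \<in> polys_in T \<longrightarrow> f \<in> I \<longrightarrow> f = 0) \<and> (\<forall>v. v \<notin> T \<longrightarrow> (\<exists>R\<in>polys_in (insert v T). R \<in> I \<and> R \<noteq> 0))"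
    using exists_transcendence_basis by blast
  then interpret transcendence_basis \<Omega> T by unfold_locales blast+
  obtain P :: "('v option, complex) mpoly" and s where P: "P \<noteq> 0" and s: "s \<notin> I"
    and rel: "\<And>x g. x \<in> \<Omega> \<Longrightarrow> peval (($) x) s \<noteq> 0 \<Longrightarrow> g \<in> I \<Longrightarrow>
       peval (case_option (x $ v0) (($) (gradient g x))) P = 0"
    using exists_gradient_relation[of v0] by blast
  define c where "c = lead_coeff (univ_at None P)"
  have c0: "c \<noteq> 0" using P by (simp add: c_def)
  have cin: "c \<in> polys_in (- {None})" unfolding c_def by (rule coeff_univ_at_in')
  define G where "G = (poly_subst Const (case_option 0 Var) c :: ('v, complex) mpoly)"
  have G: "peval z G = peval (case_option 0 z) c" for z
    unfolding G_def peval_poly_subst_Const by (intro peval_cong) (auto split: option.splits)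
  have "G \<noteq> 0"
  proof -
    obtain y where "peval y c \<noteq> 0" using exists_nonroot[OF c0 infinite_UNIV_char_0] by blast
    moreover have "peval y c = peval (case_option 0 (\<lambda>i. y (Some i))) c"
      by (rule peval_cong) (use cin in \<open>auto simp: polys_in_def split: option.splits\<close>)
    ultimately have "peval (\<lambda>i. y (Some i)) G \<noteq> 0" by (simp add: G)
    thus ?thesis by auto
  qed
  moreover have "G \<in> J"
    unfolding in_J_iff
  proof
    fix g assume g: "g \<in> I"
    \<comment> \<open>\<open>P\<close> is known to hold only where \<open>s\<close> is nonzero. If a
      homogeneous component of \<open>s\<close> is nonzero at \<open>y\<close>, then
      \<open>s\<close> has only finitely many zeros on the line of multiples of \<open>y\<close>,
      which leaves enough of them.\<close>
    have "\<exists>d. homog_comp d s \<notin> I"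
    proof (rule ccontr)
      assume "\<not> ?thesis"
      hence comp: "homog_comp d s \<in> I" for d by blast
      have "(\<Sum>d\<in>D. homog_comp d s) \<in> I" if "finite D" for D
        using that by (induction D rule: finite_induct) (auto intro: I_add comp)
      thus False using s homog_comp_sum[of s "total_degree s"] by (metis finite_atMost order_refl)
    qed
    then obtain d where d: "homog_comp d s \<notin> I" by blast
    have "homog_comp d s * along_gradient g G \<in> I"
      unfolding in_I_iff peval_mult peval_along_gradient mult_eq_0_iff
    proof (intro ballI disjCI)
      fix y assume y: "y \<in> \<Omega>" and Gy: "peval (($) (gradient g y)) G \<noteq> 0"
      define u where "u = ($) (gradient g y)"
      define q where "q = map_poly (peval (case_option 0 u)) (univ_at None P)"
      have q: "poly q \<tau> = peval (case_option \<tau> u) P" for \<tau>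
      proof -
        have "map_poly (peval (case_option \<tau> u)) (univ_at None P) = q"
          unfolding q_def
        proof (rule poly_eqI)
          fix n
          have "peval (case_option \<tau> u) (coeff (univ_at None P) n) = peval (case_option 0 u) (coeff (univ_at None P) n)"
            by (rule peval_cong) (use coeff_univ_at_in'[of None P n] in \<open>auto simp: polys_in_def split: option.splits\<close>)
          thus "coeff (map_poly (peval (case_option \<tau> u)) (univ_at None P)) n =
              coeff (map_poly (peval (case_option 0 u)) (univ_at None P)) n"
            by (simp add: coeff_map_poly)
        qed
        thus ?thesis using peval_poly[of "case_option \<tau> u" "univ_at None P" "Var None"] by (simp add: poly_univ_at)
      qed
      have "coeff q (degree (univ_at None P)) \<noteq> 0"
        using Gy by (simp add: q_def coeff_map_poly G u_def c_def)
      hence q0: "q \<noteq> 0" by auto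
      have "line_poly (\<lambda>_. 0) (($) y) s = 0"
      proof (rule ccontr)
        define r where "r = line_poly (\<lambda>_. 0) (($) y) s"
        assume "line_poly (\<lambda>_. 0) (($) y) s \<noteq> 0"
        hence "r * pcompose q [:0, y $ v0:] * [:0, 1:] \<noteq> 0"
          using q0 v0[OF y] by (simp add: r_def pcompose_eq_0_iff)
        hence "finite {t. poly (r * pcompose q [:0, y $ v0:] * [:0, 1:]) t = 0}" by (rule poly_roots_finite)
        then obtain t where "poly (r * pcompose q [:0, y $ v0:] * [:0, 1:]) t \<noteq> 0"
          using infinite_UNIV_char_0[where 'a = complex] by (metis (mono_tags, lifting) UNIV_eq_I mem_Collect_eq)
        hence t: "poly r t \<noteq> 0" "poly q (t * y $ v0) \<noteq> 0" "t \<noteq> 0" by (auto simp: poly_pcompose)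
        obtain g' where g': "g' \<in> I" "\<And>z. gradient g' z = gradient g ((1 / t) *s z)"
          using gradient_rescale[OF g, of "1 / t"] t(3) by auto
        have "(1 / t) *s (t *s y) = y" using t(3) by (simp add: vec_eq_iff)
        hence "gradient g' (t *s y) = gradient g y" by (simp only: g'(2))
        moreover have "peval (($) (t *s y)) s \<noteq> 0"
          using t(1) by (simp add: r_def poly_line_poly vec_nth_scale)
        ultimately have "peval (case_option (t * y $ v0) u) P = 0"
          using rel[OF conic[OF y t(3)] _ g'(1)] by (simp add: u_def)
        thus False using t(2) q by simp
      qed
      thus "peval (($) y) (homog_comp d s) = 0" by (simp flip: coeff_line_poly_0)
    qed
    thus "along_gradient g G \<in> I" using prime d by blast
  qed
  ultimately show ?thesis by blast
qed

end

section \<open>The cone over a real variety\<close>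

lemma embed_nth [simp]: "embed x $ None = 1" "embed x $ Some j = complex_of_real (x $ j)"
  by (simp_all add: embed_def)

lemma zero_notin_embed: "0 \<notin> embed ` X"
proof
  assume "0 \<in> embed ` X"
  then obtain x where "(0 :: complex ^ 'a option) = embed x" by blast
  hence "(0 :: complex ^ 'a option) $ None = embed x $ None" by (rule arg_cong)
  thus False by simp
qed

text \<open>Irreducibility of \<open>X\<close> concerns real equations; for a fixed complex factor
  \<open>t\<close> this splits a complex equation on the cone into two of them.\<close>

lemma real_and_imaginary_part_on_embed:
  "\<exists>fr fi :: ('n::finite, real) mpoly. \<forall>x. peval (($) (t *s embed x)) f = Complex (peval (($) x) fr) (peval (($) x) fi)"
proof (induction f rule: mpoly_induct)
  case (Const a)
  show ?case by (rule exI[of _ "Const (Re a)"], rule exI[of _ "Const (Im a)"]) simp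
next
  case (Var i)
  show ?case
  proof (cases i)
    case None
    show ?thesis unfolding None
      by (rule exI[of _ "Const (Re t)"], rule exI[of _ "Const (Im t)"]) simp
  next
    case (Some j)
    show ?thesis unfolding Some
      by (rule exI[of _ "Const (Re t) * Var j"], rule exI[of _ "Const (Im t) * Var j"]) (simp add: complex_eq_iff)
  qed
next
  case (add f g)
  then obtain fr fi gr gi :: "('n, real) mpoly"
    where "\<And>x. peval (($) (t *s embed x)) f = Complex (peval (($) x) fr) (peval (($) x) fi)"
      "\<And>x. peval (($) (t *s embed x)) g = Complex (peval (($) x) gr) (peval (($) x) gi)" by blast
  thus ?case by - (rule exI[of _ "fr + gr"], rule exI[of _ "fi + gi"],
      simp add: complex_eq_iff del: vector_smult_component)
next
  case (mult f g)
  then obtain fr fi gr gi :: "('n, real) mpoly"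
    where "\<And>x. peval (($) (t *s embed x)) f = Complex (peval (($) x) fr) (peval (($) x) fi)"
      "\<And>x. peval (($) (t *s embed x)) g = Complex (peval (($) x) gr) (peval (($) x) gi)" by blast
  thus ?case
    by - (rule exI[of _ "fr * gr - fi * gi"], rule exI[of _ "fr * gi + fi * gr"],
      simp add: complex_eq_iff del: vector_smult_component)
qed

text \<open>\<open>f\<close> and \<open>g\<close> may be nonzero at different multiples of points of
  \<open>X\<close>. One factor \<open>t\<close> works for both, as each has finitely many zeros on
  the line in question. On the slice of the cone with this \<open>t\<close>, the zero sets of
  \<open>f\<close> and \<open>g\<close> are real varieties covering \<open>X\<close>.\<close>

lemma irreducible_cone_embed:
  fixes X :: "(real ^ 'n::finite) set"
  assumes X: "irreducible_variety real_variety X"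
  shows "irreducible_cone (scaling_cone (embed ` X))"
proof
  show "scaling_cone (embed ` X) \<noteq> {}"
    using X subset_scaling_cone[of "embed ` X"] by (auto simp: irreducible_variety_def)
  show "x \<in> scaling_cone (embed ` X) \<Longrightarrow> t \<noteq> 0 \<Longrightarrow> t *s x \<in> scaling_cone (embed ` X)" for x t
    by (rule scaling_cone_scale)
  fix f g :: "('n option, complex) mpoly"
  assume fg: "f * g \<in> vanishing_ideal (scaling_cone (embed ` X))"
  show "f \<in> vanishing_ideal (scaling_cone (embed ` X)) \<or> g \<in> vanishing_ideal (scaling_cone (embed ` X))"
  proof (rule ccontr)
    assume n: "\<not> ?thesis"
    have ex: "\<exists>x\<in>X. line_poly (\<lambda>_. 0) (($) (embed x)) h \<noteq> 0"
      if h: "h \<notin> vanishing_ideal (scaling_cone (embed ` X))" for h :: "('n option, complex) mpoly"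
    proof -
      obtain y where y: "y \<in> scaling_cone (embed ` X)" "peval (($) y) h \<noteq> 0"
        using h unfolding vanishing_ideal_def by blast
      then obtain \<mu> x where "y = \<mu> *s embed x" "x \<in> X" unfolding scaling_cone_def by blast
      hence "poly (line_poly (\<lambda>_. 0) (($) (embed x)) h) \<mu> \<noteq> 0"
        using y(2) by (simp add: poly_line_poly vec_nth_scale)
      hence "line_poly (\<lambda>_. 0) (($) (embed x)) h \<noteq> 0" by auto
      thus ?thesis using \<open>x \<in> X\<close> by blast
    qed
    from n ex[of f] ex[of g] obtain x y where x: "x \<in> X" "line_poly (\<lambda>_. 0) (($) (embed x)) f \<noteq> 0"
      and y: "y \<in> X" "line_poly (\<lambda>_. 0) (($) (embed y)) g \<noteq> 0" by blast
    define p where "p = line_poly (\<lambda>_. 0) (($) (embed x)) f * line_poly (\<lambda>_. 0) (($) (embed y)) g * [:0, 1:]"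
    have "p \<noteq> 0" using x y by (simp add: p_def)
    hence "finite {t. poly p t = 0}" by (rule poly_roots_finite)
    then obtain t where "poly p t \<noteq> 0"
      using infinite_UNIV_char_0[where 'a = complex] by (metis (mono_tags, lifting) UNIV_eq_I mem_Collect_eq)
    hence t: "peval (($) (t *s embed x)) f \<noteq> 0" "peval (($) (t *s embed y)) g \<noteq> 0" "t \<noteq> 0"
      by (auto simp: p_def poly_line_poly vec_nth_scale)
    define V where "V h = {x \<in> X. peval (($) (t *s embed x)) h = 0}" for h
    have V: "real_variety (V h)" for h
    proof -
      obtain F where F: "X = {x. \<forall>f\<in>F. peval (($) x) f = 0}"
        using X by (auto simp: irreducible_variety_def real_variety_def)
      obtain hr hi :: "('n, real) mpoly"
        where h: "\<And>x. peval (($) (t *s embed x)) h = Complex (peval (($) x) hr) (peval (($) x) hi)"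
        using real_and_imaginary_part_on_embed[of t h] by blast
      show ?thesis
        unfolding real_variety_def V_def
        by (rule exI[of _ "insert hr (insert hi F)"]) (auto simp: F h complex_eq_iff)
    qed
    have "X = V f \<union> V g"
    proof -
      have "peval (($) (t *s embed z)) f * peval (($) (t *s embed z)) g = 0" if "z \<in> X" for z
      proof -
        have "t *s embed z \<in> scaling_cone (embed ` X)" using t(3) that unfolding scaling_cone_def by blast
        thus ?thesis using fg unfolding vanishing_ideal_def by (simp flip: peval_mult)
      qed
      thus ?thesis unfolding V_def by auto
    qed
    hence "X = V f \<or> X = V g" using X V unfolding irreducible_variety_def by blast
    thus False using t x(1) y(1) unfolding V_def by blast
  qed
qed

section \<open>Minimizers are points of tangency\<close>

text \<open>Carries the equations of \<open>X\<close> into the ideal of the cone, so that a curve on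
  which the ideal vanishes gives points of \<open>X\<close>. \<open>D\<close> may exceed the degree:
  in a sum, each summand is multiplied by the power of the coordinate \<open>None\<close> that
  belongs to the other.\<close>

lemma homogenization:
  "\<exists>H D. \<forall>t y. peval (($) (t *s embed y)) H = t ^ D * complex_of_real (peval (($) y) (h :: ('n::finite, real) mpoly))"
proof (induction h rule: mpoly_induct)
  case (Const a)
  show ?case by (rule exI[of _ "Const (complex_of_real a)"], rule exI[of _ 0]) simp
next
  case (Var j)
  show ?case by (rule exI[of _ "Var (Some j)"], rule exI[of _ 1]) simp
next
  case (add f g)
  then obtain F G D E
    where "\<And>t y. peval (($) (t *s embed y)) F = t ^ D * complex_of_real (peval (($) y) f)"
      "\<And>t y. peval (($) (t *s embed y)) G = t ^ E * complex_of_real (peval (($) y) g)" by blast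
  thus ?case
    by - (rule exI[of _ "F * Var None ^ E + G * Var None ^ D"], rule exI[of _ "D + E"],
      simp add: power_add algebra_simps del: vector_smult_component,
      simp add: algebra_simps)
next
  case (mult f g)
  then obtain F G D E
    where "\<And>t y. peval (($) (t *s embed y)) F = t ^ D * complex_of_real (peval (($) y) f)"
      "\<And>t y. peval (($) (t *s embed y)) G = t ^ E * complex_of_real (peval (($) y) g)" by blast
  thus ?case
    by - (rule exI[of _ "F * G"], rule exI[of _ "D + E"],
      simp add: power_add algebra_simps del: vector_smult_component)
qed

lemma power_series_pos:
  fixes a :: "nat \<Rightarrow> real"
  assumes "\<epsilon> > 0" "\<And>t. \<bar>t\<bar> < \<epsilon> \<Longrightarrow> (\<lambda>j. a j * t ^ j) sums F t" "a 0 > 0"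
  shows "\<exists>\<delta>>0. \<delta> \<le> \<epsilon> \<and> (\<forall>t. \<bar>t\<bar> < \<delta> \<longrightarrow> F t > 0)"
proof -
  have "isCont F 0" using power_series_DERIV_0(1)[OF assms(1,2)] by (rule DERIV_isCont)
  then obtain d where d: "d > 0" "\<And>t. dist t 0 < d \<Longrightarrow> dist (F t) (a 0) < a 0"
    using assms(3) power_series_DERIV_0(2)[OF assms(1,2)] unfolding continuous_at_eps_delta by metis
  show ?thesis
  proof (intro exI[of _ "min d \<epsilon>"] conjI allI impI)
    fix t assume "\<bar>t\<bar> < min d \<epsilon>"
    hence "dist (F t) (a 0) < a 0" by (intro d(2)) (simp add: dist_real_def)
    thus "F t > 0" by (simp add: dist_real_def abs_if split: if_splits)
  qed (use d(1) assms(1) in auto)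
qed

text \<open>Coordinates of the hyperplane \<open>\<langle>c, x\<rangle> = t\<close>.\<close>

definition hyperplane :: "real \<Rightarrow> real ^ 'n \<Rightarrow> complex ^ 'n option"
  where "hyperplane t c = (\<chi> i. case i of None \<Rightarrow> - complex_of_real t | Some j \<Rightarrow> complex_of_real (c $ j))"

lemma hyperplane_nth [simp]:
  "hyperplane t c $ None = - complex_of_real t" "hyperplane t c $ Some j = complex_of_real (c $ j)"
  by (simp_all add: hyperplane_def)

lemma sum_option: "(\<Sum>i\<in>UNIV. f i) = f None + (\<Sum>j\<in>UNIV. f (Some j))" for f :: "'n::finite option \<Rightarrow> 'a::comm_monoid_add"
  by (simp add: UNIV_option_conv sum.reindex)

lemma hyperplane_embed: "(\<Sum>i\<in>UNIV. hyperplane (c \<bullet> x) c $ i * embed x $ i) = 0"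
  by (simp add: sum_option inner_vec_def)

text \<open>If the hyperplane were not in the row space, some real vector \<open>v\<close> would be
  orthogonal to all gradients but not to \<open>u\<close>. A curve with velocity a nonzero multiple
  of \<open>v\<close> stays on the cone over \<open>X\<close>, so the linear form \<open>u\<close>
  has a minimum on it at time 0 although its derivative there is not 0.\<close>

lemma lagrange:
  fixes h :: "nat \<Rightarrow> ('n::finite, real) mpoly"
  assumes Xh: "X = {v. \<forall>i\<in>{1..p}. peval (($) v) (h i) = 0}"
    and irr: "irreducible_variety real_variety X" and smooth: "smooth_variety X"
    and xX: "x \<in> X" and min: "\<And>y. y \<in> X \<Longrightarrow> c \<bullet> x \<le> c \<bullet> y"
  shows "\<exists>g\<in>vanishing_ideal (scaling_cone (embed ` X)). gradient g (embed x) = hyperplane (c \<bullet> x) c"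
proof -
  define \<Omega> where "\<Omega> = scaling_cone (embed ` X)"
  define Z where "Z = projective_closure X"
  define xx where "xx = embed x"
  define u where "u = hyperplane (c \<bullet> x) c"
  interpret irreducible_cone \<Omega> unfolding \<Omega>_def by (rule irreducible_cone_embed[OF irr])
  obtain T where "(\<forall>f. f \<in> polys_in T \<longrightarrow> f \<in> I \<longrightarrow> f = 0) \<and> (\<forall>v. v \<notin> T \<longrightarrow> (\<exists>R\<in>polys_in (insert v T). R \<in> I \<and> R \<noteq> 0))"
    using exists_transcendence_basis by blast
  then interpret transcendence_basis \<Omega> T by unfold_locales blast+
  have xx\<Omega>: "xx \<in> \<Omega>" unfolding xx_def \<Omega>_def using xX subset_scaling_cone by blast
  have xxreal: "xx $ i \<in> \<real>" for i by (cases i) (simp_all add: xx_def)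
  have ZI: "vanishing_ideal Z = I"
    unfolding Z_def projective_closure_def \<Omega>_def by (rule vanishing_ideal_zariski_closure[OF zero_notin_embed])
  define k where "k = codimension Z"
  \<comment> \<open>The minor that is nonzero at a regular point has size \<open>k\<close>, which
    has to reach the number of gradients that can be independent at a general point.\<close>
  have k: "CARD('n option) - card T \<le> k"
    unfolding k_def codimension_def coord_ring_trdeg_cong[OF ZI] using coord_ring_trdeg_le by (rule diff_le_mono2)
  have "xx \<in> regular_points Z" using smooth xX unfolding smooth_variety_def Z_def xx_def by blast
  then obtain r s where r: "\<And>j. j < k \<Longrightarrow> r j \<in> I" "jacobian_minor k r s xx \<noteq> 0"
    unfolding regular_points_def singular_point_def k_def ZI by blast
  have rind: "indep_gradients r k xx" using r(2) by (rule jacobian_minor_indep_gradients)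
  \<comment> \<open>Conjugation maps a multiple of a real point to another multiple of the same
    point.\<close>
  have cnjI: "cnj_poly g \<in> I" if "g \<in> I" for g
    unfolding in_I_iff
  proof
    fix y assume "y \<in> \<Omega>"
    then obtain t z where y: "y = t *s embed z" "t \<noteq> 0" "z \<in> X" unfolding \<Omega>_def scaling_cone_def by blast
    have "(\<lambda>i. cnj (y $ i)) = ($) (cnj t *s embed z)"
    proof
      fix i show "cnj (y $ i) = (cnj t *s embed z) $ i" by (cases i) (simp_all add: y(1))
    qed
    moreover have "cnj t *s embed z \<in> \<Omega>" using y unfolding \<Omega>_def scaling_cone_def by auto
    ultimately show "peval (($) y) (cnj_poly g) = 0"
      using that by (simp only: peval_cnj_poly in_I_iff complex_cnj_zero)
  qed
  \<comment> \<open>The curve must be real, hence so must the vector field and the members of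
    \<open>I\<close> that define it. Splitting into real and imaginary parts shows that their
    gradients span the same complex space as all gradients.\<close>
  define S where "S = {gradient g xx | g. g \<in> I \<and> real_poly g}"
  have spanS: "gradient g xx \<in> vec.span S" if "g \<in> I" for g
  proof -
    define gr where "gr = Const (1 / 2) * (g + cnj_poly g)"
    define gi where "gi = Const (- \<i> / 2) * (g - cnj_poly g)"
    have g: "g = gr + Const \<i> * gi"
    proof -
      have "gr + Const \<i> * gi = (Const (1 / 2) + Const (\<i> * (- \<i> / 2))) * g + (Const (1 / 2) - Const (\<i> * (- \<i> / 2))) * cnj_poly g"
        unfolding gr_def gi_def Const_mult by (simp add: algebra_simps)
      also have "\<dots> = g" by (simp add: Const_1 Const_0 flip: Const_add Const_diff)
      finally show ?thesis ..
    qed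
    have "real_poly gr" "real_poly gi"
      by (simp_all add: real_poly_def gr_def gi_def Const_uminus algebra_simps)
    moreover have "gr \<in> I" "gi \<in> I"
      unfolding gr_def gi_def by (intro I_mult I_add I_diff that cnjI)+
    ultimately have "gradient gr xx \<in> S" "gradient gi xx \<in> S" unfolding S_def by blast+
    hence "gradient gr xx + \<i> *s gradient gi xx \<in> vec.span S"
      by (intro vec.span_add vec.span_scale vec.span_base)
    thus ?thesis by (subst g) (simp only: gradient_add gradient_Const_mult)
  qed
  obtain B where B: "B \<subseteq> S" "vec.independent B" "S \<subseteq> vec.span B"
    using vec.maximal_independent_subset[of S] by blast
  have finB: "finite B" using B(2) by (rule vec.finiteI_independent)
  have spanB: "vec.span B = vec.span S" using B vec.span_mono vec.span_span by (metis subset_antisym)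
  define k' where "k' = card B"
  have kk': "k \<le> k'"
  proof -
    let ?G = "(\<lambda>i. gradient (r i) xx) ` {..<k}"
    have "?G \<subseteq> vec.span B" unfolding spanB using spanS r(1) by auto
    hence "card ?G \<le> card B"
      using vec.independent_span_bound[OF finB] indep_gradients_card[OF rind] by blast
    thus ?thesis using indep_gradients_card[OF rind] by (simp add: k'_def)
  qed
  obtain e where e: "bij_betw e {..<k'} B"
    using ex_bij_betw_nat_finite[OF finB] unfolding k'_def atLeast0LessThan by blast
  have "\<forall>j\<in>{..<k'}. \<exists>g. g \<in> I \<and> real_poly g \<and> gradient g xx = e j"
  proof
    fix j assume "j \<in> {..<k'}"
    hence "e j \<in> S" using e B(1) unfolding bij_betw_def by blast
    thus "\<exists>g. g \<in> I \<and> real_poly g \<and> gradient g xx = e j" unfolding S_def mem_Collect_eq by metis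
  qed
  then obtain f where "\<forall>j\<in>{..<k'}. f j \<in> I \<and> real_poly (f j) \<and> gradient (f j) xx = e j"
    by (rule bchoice[THEN exE])
  hence f: "f j \<in> I" "real_poly (f j)" "gradient (f j) xx = e j" if "j < k'" for j
    using that by auto
  have find: "indep_gradients f k' xx"
    unfolding indep_gradients_def
  proof (intro allI impI notI)
    fix j assume j: "j < k'" "gradient (f j) xx \<in> vec.span ((\<lambda>i. gradient (f i) xx) ` {..<j})"
    have eB: "e i \<in> B" if "i < k'" for i using e that unfolding bij_betw_def by blast
    have "(\<lambda>i. gradient (f i) xx) ` {..<j} \<subseteq> B - {e j}"
    proof
      fix v assume "v \<in> (\<lambda>i. gradient (f i) xx) ` {..<j}"
      then obtain i where i: "i < j" "v = gradient (f i) xx" by blast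
      have "e i \<noteq> e j" using bij_betw_imp_inj_on[OF e] i(1) j(1) by (auto simp: inj_on_def)
      thus "v \<in> B - {e j}" using i j(1) f(3)[of i] eB[of i] by simp
    qed
    hence "e j \<in> vec.span (B - {e j})" using j f(3)[OF j(1)] vec.span_mono by (metis subsetD)
    thus False using B(2) eB[OF j(1)] unfolding vec.dependent_def by blast
  qed
  have "u \<in> vec.span S"
  proof (rule ccontr)
    assume uS: "u \<notin> vec.span S"
    have ureal: "u $ i \<in> \<real>" for i by (cases i) (simp_all add: u_def)
    have Sreal: "v $ i \<in> \<real>" if "v \<in> insert u S" for v i
      using that real_poly_gradient[OF _ xxreal] ureal unfolding S_def by blast
    obtain v where v: "\<forall>i. v $ i \<in> \<real>" "\<forall>w\<in>S. (\<Sum>i\<in>UNIV. w $ i * v $ i) = 0" "(\<Sum>i\<in>UNIV. u $ i * v $ i) \<noteq> 0"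
      using real_separating_vector[OF uS Sreal] by blast
    have "\<forall>j<k'. real_poly (f j)" "\<forall>i. xx $ i \<in> \<real>" using f(2) xxreal by auto
    from annihilating_vector_fields[OF this find]
    obtain s Bf where s: "real_poly s" "peval (($) xx) s \<noteq> 0"
      and Breal: "\<forall>v. (\<forall>i. v $ i \<in> \<real>) \<longrightarrow> (\<forall>i. real_poly (Bf v i))"
      and B0: "\<forall>v. \<forall>j<k'. vector_field (Bf v) (f j) = 0"
      and Bx: "\<forall>v. (\<forall>j<k'. (\<Sum>i\<in>UNIV. gradient (f j) xx $ i * v $ i) = 0) \<longrightarrow>
       (\<forall>i. peval (($) xx) (Bf v i) = peval (($) xx) s * v $ i)"
      and ind: "\<forall>q. peval (($) q) s \<noteq> 0 \<longrightarrow> indep_gradients f k' q"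
      by (elim exE conjE) (rule that; assumption)
    define b where "b = Bf v"
    have breal: "real_poly (b i)" for i using Breal v(1) by (simp add: b_def)
    have bx: "peval (($) xx) (b i) = peval (($) xx) s * v $ i" for i
    proof -
      have "(\<Sum>i\<in>UNIV. gradient (f j) xx $ i * v $ i) = 0" if "j < k'" for j
      proof -
        have "gradient (f j) xx \<in> S" unfolding S_def using f[OF that] by blast
        thus ?thesis using v(2) by blast
      qed
      thus ?thesis using Bx unfolding b_def by blast
    qed
    have bI: "vector_field b g \<in> I" if "g \<in> I" for g
    proof (rule annihilating_field_preserves_ideal[OF xx\<Omega> _ _ s(2) _ _ that])
      show "f j \<in> I" if "j < k'" for j using f(1)[OF that] .
      show "CARD('n option) - card T \<le> k'" using k kk' by (rule order.trans)
      show "indep_gradients f k' q" if "peval (($) q) s \<noteq> 0" for q using ind that by blast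
      show "vector_field b (f j) = 0" if "j < k'" for j using B0 that by (simp add: b_def)
    qed
    obtain \<epsilon> \<gamma> where \<epsilon>: "\<epsilon> > 0"
      and \<gamma>: "\<And>t g. cmod t < \<epsilon> \<Longrightarrow> (\<lambda>j. taylor b (($) xx) g j * t ^ j) sums peval (\<gamma> t) g"
      using vector_field_flow[of b "($) xx"] by blast
    have \<gamma>I: "peval (\<gamma> t) g = 0" if "cmod t < \<epsilon>" "g \<in> I" for t g
    proof -
      have "(vector_field b ^^ j) g \<in> I" for j
        by (induction j) (simp_all add: that(2) bI)
      hence "taylor b (($) xx) g j = 0" for j using xx\<Omega> by (simp add: taylor_def in_I_iff)
      hence "(\<lambda>j. taylor b (($) xx) g j * t ^ j) sums 0" by simp
      thus ?thesis using \<gamma>[OF that(1), of g] sums_unique2 by blast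
    qed
    define a where "a i j = Re (taylor b (($) xx) (Var i) j)" for i j
    define G where "G t i = Re (\<gamma> (complex_of_real t) i)" for t i
    have taylor_a: "taylor b (($) xx) (Var i) j = complex_of_real (a i j)" for i j
    proof -
      have "taylor b (($) xx) (Var i) j \<in> \<real>"
        by (rule real_poly_taylor[OF breal real_poly_Var xxreal])
      thus ?thesis unfolding a_def by (rule of_real_Re[symmetric])
    qed
    have sums_a: "(\<lambda>j. a i j * t ^ j) sums G t i" and \<gamma>G: "\<gamma> (complex_of_real t) i = complex_of_real (G t i)"
      if "\<bar>t\<bar> < \<epsilon>" for t i
    proof -
      have "(\<lambda>j. complex_of_real (a i j * t ^ j)) sums \<gamma> (complex_of_real t) i"
        using \<gamma>[of "complex_of_real t" "Var i"] that by (simp add: taylor_a)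
      from sums_Re[OF this] sums_Im[OF this]
      have 1: "(\<lambda>j. a i j * t ^ j) sums G t i" and 2: "(\<lambda>j. 0 :: real) sums Im (\<gamma> (complex_of_real t) i)"
        unfolding G_def Re_complex_of_real Im_complex_of_real by simp_all
      show "(\<lambda>j. a i j * t ^ j) sums G t i" by (rule 1)
      have "Im (\<gamma> (complex_of_real t) i) = 0" using 2 sums_zero sums_unique2 by blast
      thus "\<gamma> (complex_of_real t) i = complex_of_real (G t i)" by (simp add: G_def complex_eq_iff)
    qed
    have a0: "a i 0 = Re (xx $ i)" for i by (simp add: a_def taylor_def)
    have a1: "a i 1 = Re (peval (($) xx) s) * Re (v $ i)" for i
    proof -
      have "taylor b (($) xx) (Var i) 1 = peval (($) xx) s * v $ i" by (simp add: taylor_def bx)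
      moreover have "peval (($) xx) s \<in> \<real>" by (rule real_poly_peval[OF s(1) xxreal])
      ultimately show ?thesis using v(1) by (auto simp: a_def elim!: Reals_cases)
    qed
    \<comment> \<open>The coordinate \<open>None\<close> of the curve starts at 1 and stays positive
      for small \<open>t\<close>, which permits the passage back to affine points.\<close>
    have "a None 0 > 0" by (simp add: a0 xx_def)
    from power_series_pos[OF \<epsilon> sums_a this]
    obtain \<delta> where \<delta>: "\<delta> > 0" "\<delta> \<le> \<epsilon>" "\<And>t. \<bar>t\<bar> < \<delta> \<Longrightarrow> G t None > 0" by blast
    define y where "y t = (\<chi> j. G t (Some j) / G t None)" for t
    have yX: "y t \<in> X" if t: "\<bar>t\<bar> < \<delta>" for t
    proof -
      have te: "\<bar>t\<bar> < \<epsilon>" using t \<delta>(2) by simp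
      have pos: "G t None > 0" by (rule \<delta>(3)[OF t])
      have eq: "\<gamma> (complex_of_real t) = ($) (complex_of_real (G t None) *s embed (y t))"
      proof
        fix i show "\<gamma> (complex_of_real t) i = (complex_of_real (G t None) *s embed (y t)) $ i"
          using pos by (cases i) (simp_all add: \<gamma>G[OF te] y_def)
      qed
      have "peval (($) (y t)) (h i) = 0" if i: "i \<in> {1..p}" for i
      proof -
        obtain H D where H: "\<And>t y. peval (($) (t *s embed y)) H = t ^ D * complex_of_real (peval (($) y) (h i))"
          using homogenization[of "h i"] by blast
        have "H \<in> I"
          unfolding in_I_iff
        proof
          fix z assume "z \<in> \<Omega>"
          then obtain \<mu> w where z: "z = \<mu> *s embed w" "w \<in> X" unfolding \<Omega>_def scaling_cone_def by blast
          have "peval (($) w) (h i) = 0" using z(2) i unfolding Xh by blast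
          thus "peval (($) z) H = 0" unfolding z(1) H by simp
        qed
        from \<gamma>I[OF _ this, of "complex_of_real t"] te
        have "complex_of_real (G t None) ^ D * complex_of_real (peval (($) (y t)) (h i)) = 0"
          unfolding eq H by simp
        thus ?thesis using pos by simp
      qed
      thus ?thesis unfolding Xh by blast
    qed
    define A where "A j = (\<Sum>i\<in>UNIV. Re (u $ i) * a i j)" for j
    \<comment> \<open>The pairing of \<open>u\<close> with the curve: for small \<open>t\<close> it
      is the positive coordinate \<open>None\<close> times the excess of the objective over its
      minimum.\<close>
    define F where "F t = (\<Sum>i\<in>UNIV. Re (u $ i) * G t i)" for t
    have AF: "(\<lambda>j. A j * t ^ j) sums F t" if "\<bar>t\<bar> < \<delta>" for t
    proof -
      have "(\<lambda>j. \<Sum>i\<in>UNIV. Re (u $ i) * (a i j * t ^ j)) sums (\<Sum>i\<in>UNIV. Re (u $ i) * G t i)"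
        using that \<delta>(2) by (intro sums_sum sums_mult sums_a) simp
      thus ?thesis by (simp add: A_def F_def sum_distrib_right mult.assoc)
    qed
    have F0: "F 0 \<le> F t" if t: "\<bar>t\<bar> < \<delta>" for t
    proof -
      have pos: "G t None > 0" by (rule \<delta>(3)[OF t])
      have "F t = (\<Sum>j\<in>UNIV. c $ j * G t (Some j)) - (c \<bullet> x) * G t None"
        by (simp add: F_def u_def sum_option)
      also have "(\<Sum>j\<in>UNIV. c $ j * G t (Some j)) = G t None * (c \<bullet> y t)"
        using pos by (simp add: y_def inner_vec_def sum_distrib_left)
      finally have "F t = G t None * (c \<bullet> y t - c \<bullet> x)" by (simp add: algebra_simps)
      moreover have "c \<bullet> y t - c \<bullet> x \<ge> 0" using min[OF yX[OF t]] by simp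
      moreover have "F 0 = 0"
        using power_series_DERIV_0(2)[OF \<delta>(1) AF]
        by (simp add: A_def a0 xx_def u_def sum_option inner_vec_def)
      ultimately show ?thesis using pos by simp
    qed
    have "A 1 = 0"
      by (rule DERIV_local_min[OF power_series_DERIV_0(1)[OF \<delta>(1) AF] \<delta>(1)]) (use F0 in auto)
    hence "Re (peval (($) xx) s) * (\<Sum>i\<in>UNIV. Re (u $ i) * Re (v $ i)) = 0"
      unfolding A_def a1 sum_distrib_left by (simp add: mult.left_commute)
    moreover have "Re (peval (($) xx) s) \<noteq> 0"
    proof -
      have "peval (($) xx) s \<in> \<real>" using s(1) xxreal by (rule real_poly_peval)
      thus ?thesis using s(2) by (metis of_real_Re of_real_0)
    qed
    ultimately have "(\<Sum>i\<in>UNIV. Re (u $ i) * Re (v $ i)) = 0" by simp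
    moreover have "(\<Sum>i\<in>UNIV. u $ i * v $ i) = complex_of_real (\<Sum>i\<in>UNIV. Re (u $ i) * Re (v $ i))"
      unfolding of_real_sum
    proof (rule sum.cong)
      fix i
      show "u $ i * v $ i = complex_of_real (Re (u $ i) * Re (v $ i))"
        using ureal[of i] v(1) by (simp add: of_real_Re)
    qed simp
    ultimately show False using v(3) by simp
  qed
  moreover have "vec.span S \<subseteq> vec.span ((\<lambda>f. gradient f xx) ` I)"
    by (rule vec.span_mono) (auto simp: S_def)
  ultimately have "u \<in> (\<lambda>f. gradient f xx) ` I" unfolding span_gradients by blast
  thus ?thesis unfolding u_def xx_def \<Omega>_def by (auto simp: image_iff)
qed

section \<open>The optimal value function\<close>

lemma optimal_value_attained:
  fixes X :: "(real ^ 'n::finite) set"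
  assumes "compact X" "X \<noteq> {}"
  obtains x where "x \<in> X" "optimal_value X c = c \<bullet> x" "\<And>y. y \<in> X \<Longrightarrow> c \<bullet> x \<le> c \<bullet> y"
proof -
  have "continuous_on X (\<lambda>x. c \<bullet> x)" by (intro continuous_intros)
  then obtain x where x: "x \<in> X" "\<forall>y\<in>X. c \<bullet> x \<le> c \<bullet> y"
    using continuous_attains_inf[OF assms] by blast
  have "optimal_value X c = c \<bullet> x"
    unfolding optimal_value_def by (rule Least_equality) (use x in auto)
  thus ?thesis using x by (intro that) auto
qed

section \<open>The change of sign in \<open>c_0\<close> and the passage between real and complex
  coefficients\<close>

lemma peval_flip_sign:
  "peval (($) (hyperplane t c)) (flip_sign \<Phi>) =
     complex_of_real (peval (\<lambda>i. case i of None \<Rightarrow> t | Some j \<Rightarrow> c $ j) \<Phi>)"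
proof -
  have hom: "coeff_hom (\<lambda>a. Const (complex_of_real a) :: ('n option, complex) mpoly)"
    by (simp add: coeff_hom_def Const_0 Const_1 Const_add Const_mult)
  have hom': "coeff_hom complex_of_real" by (simp add: coeff_hom_def)
  have "peval (($) (hyperplane t c)) (flip_sign \<Phi>) =
      poly_subst complex_of_real (\<lambda>i. complex_of_real (case i of None \<Rightarrow> t | Some j \<Rightarrow> c $ j)) \<Phi>"
    unfolding flip_sign_def hom_poly_subst[OF hom coeff_hom_peval] peval_Const
    by (rule poly_subst_cong) (auto split: option.splits)
  thus ?thesis
    by (simp add: peval_def[of "\<lambda>i. case i of None \<Rightarrow> t | Some j \<Rightarrow> c $ j"] hom_poly_subst[OF coeff_hom_id hom'])
qed

lemma lookup_flip_sign:
  fixes \<Phi> :: "('n option, real) mpoly"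
  shows "Poly_Mapping.lookup (flip_sign \<Phi>) m = (- 1) ^ Poly_Mapping.lookup m None * complex_of_real (Poly_Mapping.lookup \<Phi> m)"
proof -
  define \<sigma> :: "'n option \<Rightarrow> ('n option, complex) mpoly"
    where "\<sigma> i = (case i of None \<Rightarrow> - Var None | Some j \<Rightarrow> Var (Some j))" for i
  have \<sigma>_eq: "(\<lambda>i. case i of None \<Rightarrow> - Var None | Some j \<Rightarrow> Var (Some j)) = \<sigma>"
    by (rule ext) (simp add: \<sigma>_def)
  have \<sigma>: "\<sigma> i = Const (if i = None then - 1 else 1) * Var i" for i
    by (cases i) (simp_all add: \<sigma>_def Const_uminus Const_1)
  have em: "eval_monom \<sigma> m = Const ((- 1) ^ Poly_Mapping.lookup m None) * eval_monom Var m" for m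
  proof -
    let ?V = "insert None (Poly_Mapping.keys m)"
    have "eval_monom \<sigma> m = (\<Prod>i\<in>?V. Const (if i = None then - 1 else 1) ^ Poly_Mapping.lookup m i) *
        (\<Prod>i\<in>?V. Var i ^ Poly_Mapping.lookup m i)"
      by (subst eval_monom_superset[of ?V]) (auto simp: \<sigma> power_mult_distrib prod.distrib)
    also have "(\<Prod>i\<in>?V. Var i ^ Poly_Mapping.lookup m i) = (eval_monom Var m :: ('n option, complex) mpoly)"
      by (rule eval_monom_superset[symmetric]) auto
    also have "(\<Prod>i\<in>?V. Const (if i = None then - 1 else 1) ^ Poly_Mapping.lookup m i) =
        (\<Prod>i\<in>{None}. Const (if i = None then - 1 else 1) ^ Poly_Mapping.lookup m i :: ('n option, complex) mpoly)"
      by (rule prod.mono_neutral_right) (auto simp: Const_1)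
    finally show ?thesis by (simp add: Const_power)
  qed
  have "flip_sign \<Phi> = (\<Sum>m\<in>Poly_Mapping.keys \<Phi>. Poly_Mapping.single m
      ((- 1) ^ Poly_Mapping.lookup m None * complex_of_real (Poly_Mapping.lookup \<Phi> m)))"
    unfolding flip_sign_def poly_subst_eq \<sigma>_eq em single_eq_eval_monom Const_mult
    by (rule sum.cong) (simp_all add: ac_simps)
  thus ?thesis by (auto simp: lookup_sum lookup_single when_def in_keys_iff)
qed

lemma keys_flip_sign: "Poly_Mapping.keys (flip_sign \<Phi>) = Poly_Mapping.keys \<Phi>"
  by (auto simp: in_keys_iff lookup_flip_sign)

text \<open>If \<open>F\<close> vanishes on the real graph of the optimal value function, then
  \<open>A\<close> and \<open>B\<close> are real relations for that function, of no larger degree.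
  This compares the least degree of a real relation with that of a complex one.\<close>

lemma flip_sign_real_and_imaginary_part:
  fixes F :: "('n option, complex) mpoly"
  obtains A B where "F = flip_sign A + Const \<i> * flip_sign B"
    "Poly_Mapping.keys A \<subseteq> Poly_Mapping.keys F" "Poly_Mapping.keys B \<subseteq> Poly_Mapping.keys F"
proof -
  define P where "P r = (\<Sum>m\<in>Poly_Mapping.keys F. Poly_Mapping.single m
      ((- 1) ^ Poly_Mapping.lookup m None * r (Poly_Mapping.lookup F m)))" for r :: "complex \<Rightarrow> real"
  have P: "Poly_Mapping.lookup (P r) m = (- 1) ^ Poly_Mapping.lookup m None * r (Poly_Mapping.lookup F m)"
    if "r 0 = 0" for r m
    using that by (auto simp: P_def lookup_sum lookup_single when_def in_keys_iff)
  have sign: "(- 1) ^ n * ((- 1) ^ n * z) = (z :: complex)" for n z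
    by (simp flip: power_add mult.assoc)
  have L: "Poly_Mapping.lookup (Const a * f) m = a * Poly_Mapping.lookup f m"
    for a :: complex and f :: "('n option, complex) mpoly" and m
    by (simp add: Const_def flip: mult_map_scale_conv_mult) (simp add: Poly_Mapping.map.rep_eq when_def)
  have "F = flip_sign (P Re) + Const \<i> * flip_sign (P Im)"
    by (rule poly_mapping_eqI) (simp add: lookup_add L lookup_flip_sign P sign complex_eq mult.left_commute)
  moreover have "Poly_Mapping.keys (P Re) \<subseteq> Poly_Mapping.keys F" "Poly_Mapping.keys (P Im) \<subseteq> Poly_Mapping.keys F"
    by (auto simp: in_keys_iff P)
  ultimately show ?thesis using that by blast
qed

lemma total_degree_mono: "Poly_Mapping.keys f \<subseteq> Poly_Mapping.keys g \<Longrightarrow> total_degree f \<le> total_degree g"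
  by (rule total_degree_leI) (auto intro: monom_degree_le_total_degree)

lemma mpoly_associated:
  fixes F G :: "('v, complex) mpoly"
  assumes "F dvd G" "G dvd F" "F \<noteq> 0"
  shows "\<exists>k. k \<noteq> 0 \<and> G = Const k * F"
proof -
  obtain a b where a: "G = F * a" and b: "F = G * b" using assms(1,2) by (elim dvdE)
  have "F * 1 = G * b" using b by simp
  also have "\<dots> = F * (a * b)" unfolding a by (simp only: mult.assoc)
  finally have "1 = a * b" using assms(3) by (rule mpoly_mult_cancel)
  hence "a dvd 1" by (rule dvdI)
  then obtain k where "a = Const k" "a \<noteq> 0" by (auto simp: mpoly_is_unit_iff total_degree_eq_0)
  thus ?thesis using a by (intro exI[of _ k]) (simp add: mult.commute)
qed

lemma keys_Const_mult:
  fixes f :: "('v, complex) mpoly"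
  assumes "k \<noteq> 0"
  shows "Poly_Mapping.keys (Const k * f) = Poly_Mapping.keys f"
proof -
  have "Poly_Mapping.lookup (Const k * f) m = k * Poly_Mapping.lookup f m" for m
    by (simp add: Const_def flip: mult_map_scale_conv_mult) (simp add: Poly_Mapping.map.rep_eq when_def)
  thus ?thesis using assms by (simp add: set_eq_iff in_keys_iff)
qed

theorem theorem3p2:
  fixes h :: "nat \<Rightarrow> ('n::finite, real) mpoly" and p :: nat and X :: "(real ^ 'n) set"
  assumes "X = {v. \<forall>i\<in>{1..p}. peval (($) v) (h i) = 0}"
    and "irreducible_variety real_variety X"
    and "smooth_variety X"
    and "compact X"
  shows "irreducible_hypersurface (dual_variety (projective_closure X)) \<and>
    (\<exists>\<Phi>. optimal_value_polynomial X \<Phi>) \<and>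
    (\<exists>F. defining_polynomial F (dual_variety (projective_closure X))) \<and>
    (\<forall>\<Phi> F. optimal_value_polynomial X \<Phi> \<longrightarrow>
       defining_polynomial F (dual_variety (projective_closure X)) \<longrightarrow>
       (\<exists>k. k \<noteq> 0 \<and> F = Const k * flip_sign \<Phi>)) \<and>
    (\<exists>F. irreducible F \<and> F \<in> vanishing_ideal (dual_variety (projective_closure X))) \<and>
    (\<forall>F. irreducible F \<longrightarrow> F \<in> vanishing_ideal (dual_variety (projective_closure X)) \<longrightarrow>
       algebraic_degree X = degree_in None F)"
proof -
  define \<Omega> where "\<Omega> = scaling_cone (embed ` X)"
  define Z where "Z = projective_closure X"
  define D where "D = dual_variety Z"
  define u where "u c = hyperplane (optimal_value X c) c" for c :: "real ^ 'n"
  interpret irreducible_cone \<Omega> unfolding \<Omega>_def by (rule irreducible_cone_embed[OF assms(2)])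
  have Xne: "X \<noteq> {}" using assms(2) by (simp add: irreducible_variety_def)
  have tangent: "\<exists>x\<in>X. \<exists>g\<in>I. gradient g (embed x) = u c \<and> (\<Sum>i\<in>UNIV. u c $ i * embed x $ i) = 0" for c
  proof -
    obtain x where x: "x \<in> X" "optimal_value X c = c \<bullet> x" "\<And>y. y \<in> X \<Longrightarrow> c \<bullet> x \<le> c \<bullet> y"
      using optimal_value_attained[OF assms(4) Xne] by blast
    show ?thesis
      using lagrange[OF assms(1-3) x(1,3)] x(1) hyperplane_embed[of c x] unfolding u_def x(2) \<Omega>_def by blast
  qed
  have Zdef: "Z = zariski_closure (embed ` X)" by (simp add: Z_def projective_closure_def)
  have ZI: "vanishing_ideal Z = I"
    unfolding Zdef \<Omega>_def by (rule vanishing_ideal_zariski_closure[OF zero_notin_embed])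
  have regular: "embed ` X \<subseteq> regular_points Z" using assms(3) by (simp add: smooth_variety_def Z_def)
  have tangent_ex: "\<exists>x\<in>regular_points Z. \<exists>v. tangent_hyperplane Z x v"
  proof -
    \<comment> \<open>Any nonzero objective vector yields a tangent hyperplane; here all its entries
      are 1.\<close>
    obtain x g where x: "x \<in> X" "g \<in> I" "gradient g (embed x) = u (\<chi> i. 1)"
      "(\<Sum>i\<in>UNIV. u (\<chi> i. 1) $ i * embed x $ i) = 0" using tangent[of "\<chi> i. 1"] by blast
    have "u (\<chi> i. 1) $ Some j = 1" for j by (simp add: u_def)
    hence "u (\<chi> i. 1) \<noteq> 0" by (metis zero_index zero_neq_one)
    moreover have "u (\<chi> i. 1) \<in> jacobian_row_space Z (embed x)"
      unfolding jacobian_row_space_def ZI x(3)[symmetric] by (intro vec.span_base imageI x(2))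
    ultimately have "tangent_hyperplane Z (embed x) (u (\<chi> i. 1))"
      using x(4) by (simp add: tangent_hyperplane_def)
    thus ?thesis using x(1) regular by blast
  qed
  have DJ: "vanishing_ideal D = J"
    unfolding D_def Zdef
    by (rule vanishing_ideal_dual_variety[OF \<Omega>_def zero_notin_embed])
       (use regular tangent_ex in \<open>simp_all add: Zdef\<close>)
  have Ju: "peval (($) (u c)) G = 0" if "G \<in> J" for G c
  proof -
    obtain x g where x: "x \<in> X" "g \<in> I" "gradient g (embed x) = u c" using tangent[of c] by blast
    have "embed x \<in> \<Omega>" unfolding \<Omega>_def using x(1) subset_scaling_cone by blast
    hence "u c \<in> conormal" unfolding conormal_def x(3)[symmetric] using x(2) by blast
    thus ?thesis using that by (simp add: vanishing_ideal_def)
  qed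
  have no_c0: "G = 0" if G: "G \<in> polys_in (- {None})" "\<And>c. peval (($) (u c)) G = 0" for G
  proof (rule ccontr)
    assume "G \<noteq> 0"
    have "infinite (\<real> :: complex set)" using infinite_UNIV_char_0[where 'a = real]
      by (auto simp: Reals_def dest!: finite_imageD intro: inj_onI)
    then obtain y where y: "range y \<subseteq> \<real>" "peval y G \<noteq> 0"
      using exists_nonroot[OF \<open>G \<noteq> 0\<close>] by blast
    define c where "c = (\<chi> j. Re (y (Some j)))"
    have "peval y G = peval (($) (u c)) G"
    proof (rule peval_cong)
      fix i assume "i \<in> poly_vars G"
      then obtain j where j: "i = Some j" using G(1) by (cases i) (auto simp: polys_in_def)
      have "y (Some j) \<in> \<real>" using y(1) by blast
      thus "y i = u c $ i" by (simp add: j u_def c_def of_real_Re)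
    qed
    thus False using y(2) G(2) by simp
  qed
  have "\<exists>G\<in>J. G \<noteq> 0"
  proof (rule exists_nonzero_in_J[of None])
    fix x assume "x \<in> \<Omega>"
    then obtain t y where "x = t *s embed y" "t \<noteq> 0" unfolding \<Omega>_def scaling_cone_def by blast
    thus "x $ None \<noteq> 0" by simp
  qed
  then obtain F where F: "F \<in> J" "F \<noteq> 0" and Fmin: "\<And>G. G \<in> J \<Longrightarrow> G \<noteq> 0 \<Longrightarrow> total_degree F \<le> total_degree G"
    using ex_has_least_nat[of "\<lambda>G. G \<in> J \<and> G \<noteq> 0" _ total_degree] by blast
  interpret N: irreducible_set conormal by (rule irreducible_set_conormal)
  have Fnu: "\<not> F dvd 1"
  proof
    assume "F dvd 1"
    then obtain k where "F = Const k" "k \<noteq> 0" using F(2) by (auto simp: mpoly_is_unit_iff total_degree_eq_0)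
    thus False using F(1) by (simp add: N.I_Const)
  qed
  have "irreducible F"
  proof (rule irreducibleI[OF F(2) Fnu])
    fix a b assume ab: "F = a * b"
    hence ne: "a \<noteq> 0" "b \<noteq> 0" using F(2) by auto
    have "a \<in> J \<or> b \<in> J" using F(1) unfolding ab by (rule conormal_prime)
    hence "total_degree F \<le> total_degree a \<or> total_degree F \<le> total_degree b" using Fmin ne by blast
    thus "a dvd 1 \<or> b dvd 1" using ne by (auto simp: ab total_degree_mult mpoly_is_unit_iff)
  qed
  hence Fprime: "prime_elem F" by (rule irreducible_imp_prime_mpoly)
  have Fc0: "F \<notin> polys_in (- {None})" using no_c0 Ju F by blast
  \<comment> \<open>Stated for every polynomial that vanishes on the graph, so that it serves both
    the members of \<open>J\<close> and the sign-flipped real relations.\<close>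
  have Fdvd: "F dvd G" if G: "\<And>c. peval (($) (u c)) G = 0" for G
  proof (rule ccontr)
    assume "\<not> F dvd G"
    from mpoly_elimination[OF Fprime Fc0 this]
    obtain \<alpha> \<beta> where e: "\<alpha> * F + \<beta> * G \<noteq> 0" "\<alpha> * F + \<beta> * G \<in> polys_in (- {None})" by blast
    have "peval (($) (u c)) (\<alpha> * F + \<beta> * G) = 0" for c using Ju[OF F(1)] G by simp
    thus False using no_c0 e by blast
  qed
  have JF: "J = {G. F dvd G}"
  proof (intro subset_antisym subsetI)
    show "G \<in> {G. F dvd G}" if "G \<in> J" for G using Fdvd Ju[OF that] by blast
    show "G \<in> J" if "G \<in> {G. F dvd G}" for G using that F(1) by (auto elim!: dvdE intro: N.I_mult2)
  qed
  have van: "vanishes_on_optimal_value X \<Psi> \<longleftrightarrow> (\<forall>c. peval (($) (u c)) (flip_sign \<Psi>) = 0)" for \<Psi>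
    unfolding vanishes_on_optimal_value_def u_def peval_flip_sign of_real_eq_0_iff ..
  have flip0: "flip_sign \<Psi> = 0 \<longleftrightarrow> \<Psi> = 0" for \<Psi> :: "('n option, real) mpoly"
    by (metis keys_eq_empty keys_flip_sign)
  have td: "total_degree (flip_sign \<Psi>) = total_degree \<Psi>" for \<Psi> :: "('n option, real) mpoly"
    by (simp add: total_degree_def keys_flip_sign)
  \<comment> \<open>A real relation of degree at most that of \<open>F\<close>. An optimal
    polynomial, being divisible by \<open>F\<close> after the sign change, then has the degree of
    \<open>F\<close>, and the quotient is constant.\<close>
  obtain \<Psi> where \<Psi>: "\<Psi> \<noteq> 0" "vanishes_on_optimal_value X \<Psi>" "total_degree \<Psi> \<le> total_degree F"
  proof -
    obtain A B where AB: "F = flip_sign A + Const \<i> * flip_sign B"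
      "Poly_Mapping.keys A \<subseteq> Poly_Mapping.keys F" "Poly_Mapping.keys B \<subseteq> Poly_Mapping.keys F"
      using flip_sign_real_and_imaginary_part by blast
    have "vanishes_on_optimal_value X A \<and> vanishes_on_optimal_value X B"
    proof -
      define ev where "ev c = peval (\<lambda>i. case i of None \<Rightarrow> optimal_value X c | Some j \<Rightarrow> c $ j)"
        for c and f :: "('n option, real) mpoly"
      have "complex_of_real (ev c A) + \<i> * complex_of_real (ev c B) = 0" for c
        using Ju[OF F(1), of c] unfolding AB(1) by (simp add: u_def peval_flip_sign ev_def)
      hence "ev c A = 0 \<and> ev c B = 0" for c by (simp add: complex_eq_iff)
      thus ?thesis by (simp add: vanishes_on_optimal_value_def ev_def)
    qed
    moreover have "A \<noteq> 0 \<or> B \<noteq> 0"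
    proof (rule ccontr)
      assume "\<not> (A \<noteq> 0 \<or> B \<noteq> 0)"
      hence "flip_sign A = 0" "flip_sign B = 0" unfolding flip0 by blast+
      thus False using F(2) unfolding AB(1) by simp
    qed
    moreover note total_degree_mono[OF AB(2)] total_degree_mono[OF AB(3)]
    ultimately show ?thesis using that by blast
  qed
  have optimal: "\<exists>\<Phi>. optimal_value_polynomial X \<Phi>"
  proof -
    let ?P = "\<lambda>\<Psi>. \<Psi> \<noteq> 0 \<and> vanishes_on_optimal_value X \<Psi>"
    obtain \<Phi> where "?P \<Phi>" "\<And>\<Psi>. ?P \<Psi> \<Longrightarrow> total_degree \<Phi> \<le> total_degree \<Psi>"
      using ex_has_least_nat[of ?P \<Psi> total_degree] \<Psi> by blast
    hence "optimal_value_polynomial X \<Phi>"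
      unfolding optimal_value_polynomial_def is_arg_min_def by (auto simp: not_less)
    thus ?thesis ..
  qed
  have flipF: "\<exists>q. q \<noteq> 0 \<and> F = Const q * flip_sign \<Phi>" if opt: "optimal_value_polynomial X \<Phi>" for \<Phi>
  proof -
    have "is_arg_min total_degree (\<lambda>\<Psi>. \<Psi> \<noteq> 0 \<and> vanishes_on_optimal_value X \<Psi>) \<Phi>"
      using opt by (simp only: optimal_value_polynomial_def)
    hence \<Phi>: "\<Phi> \<noteq> 0" "vanishes_on_optimal_value X \<Phi>" and "\<not> total_degree \<Psi> < total_degree \<Phi>"
      using \<Psi>(1,2) unfolding is_arg_min_def by blast+
    hence \<Phi>3: "total_degree \<Phi> \<le> total_degree \<Psi>" by simp
    have "F dvd flip_sign \<Phi>" using \<Phi>(2) unfolding van by (intro Fdvd) blast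
    then obtain Q where Q: "flip_sign \<Phi> = F * Q" by (elim dvdE)
    have "F * Q \<noteq> 0" unfolding Q[symmetric] flip0 by (rule \<Phi>(1))
    hence Q0: "Q \<noteq> 0" by (simp add: mpoly_mult_eq_0_iff)
    have "total_degree F + total_degree Q = total_degree \<Phi>"
      by (simp only: td[of \<Phi>, symmetric] Q total_degree_mult[OF F(2) Q0])
    hence "total_degree Q = 0" using \<Phi>3 \<Psi>(3) by linarith
    hence "Q dvd 1" using Q0 by (simp add: mpoly_is_unit_iff)
    then obtain R where "1 = Q * R" by (elim dvdE)
    hence "F = flip_sign \<Phi> * R" unfolding Q by (simp add: mult.assoc)
    hence "flip_sign \<Phi> dvd F" by (rule dvdI)
    moreover have "flip_sign \<Phi> \<noteq> 0" using \<Phi>(1) flip0 by simp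
    ultimately show ?thesis using mpoly_associated[OF _ \<open>F dvd flip_sign \<Phi>\<close>] by blast
  qed
  have deg: "algebraic_degree X = degree_in None G" if G: "F dvd G" "G dvd F" for G
  proof -
    \<comment> \<open>The choice does not matter: every optimal polynomial has the same monomials as
      \<open>F\<close>.\<close>
    define \<Phi> where "\<Phi> = (SOME \<Phi>. optimal_value_polynomial X \<Phi>)"
    have "optimal_value_polynomial X \<Phi>" unfolding \<Phi>_def using optimal by (rule someI_ex)
    then obtain q where q: "q \<noteq> 0" "F = Const q * flip_sign \<Phi>" using flipF by blast
    obtain k where k: "k \<noteq> 0" "G = Const k * F" using mpoly_associated[OF G F(2)] by blast
    have "Poly_Mapping.keys G = Poly_Mapping.keys \<Phi>"
      unfolding k(2) keys_Const_mult[OF k(1)] by (simp only: q(2) keys_Const_mult[OF q(1)] keys_flip_sign)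
    thus ?thesis by (simp add: algebraic_degree_def \<Phi>_def[symmetric] degree_in_def)
  qed
  have hypersurface: "irreducible_hypersurface D"
    unfolding irreducible_hypersurface_def
  proof
    define S where "S = {v. \<exists>x\<in>regular_points Z. tangent_hyperplane Z x v}"
    have DS: "D = zariski_closure S" by (simp add: D_def dual_variety_def S_def)
    show "irreducible_variety projective_variety D"
      unfolding DS
    proof (rule irreducible_variety_zariski_closure)
      show "0 \<notin> S" by (simp add: S_def tangent_hyperplane_def)
      show "S \<noteq> {}" using tangent_ex by (auto simp: S_def)
    qed (unfold DS[symmetric] DJ, rule conormal_prime)
    obtain T where T: "(\<forall>f. f \<in> polys_in T \<longrightarrow> f \<in> J \<longrightarrow> f = 0) \<and> (\<forall>v. v \<notin> T \<longrightarrow> (\<exists>R\<in>polys_in (insert v T). R \<in> J \<and> R \<noteq> 0))"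
      using N.exists_transcendence_basis by blast
    then interpret N: transcendence_basis conormal T by unfold_locales blast+
    \<comment> \<open>\<open>F\<close> is a relation among all coordinates, so \<open>T\<close>
      misses one of them. The coordinates other than \<open>c_0\<close> are independent modulo
      \<open>J\<close> by \<open>no_c0\<close>, which gives the opposite bound below.\<close>
    have "T \<noteq> UNIV" using T F by auto
    hence "card T < CARD('n option)" by (intro psubset_card_mono) auto
    moreover have "coord_ring_trdeg conormal \<le> card T" by (rule N.coord_ring_trdeg_le)
    moreover have "CARD('n) \<le> coord_ring_trdeg conormal"
    proof -
      obtain e where e: "bij_betw e {..<CARD('n)} (UNIV :: 'n set)"
        using ex_bij_betw_nat_finite[of "UNIV :: 'n set"] unfolding atLeast0LessThan by auto
      show ?thesis
      proof (rule N.le_coord_ring_trdeg)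
        fix P :: "(nat, complex) mpoly"
        assume P: "poly_vars P \<subseteq> {..<CARD('n)}" "poly_subst Const (\<lambda>j. Var (Some (e j))) P \<in> J"
        have "poly_subst Const (\<lambda>j. Var (Some (e j))) P \<in> polys_in (- {None})"
          by (intro polys_in_poly_subst polys_in_Var) simp
        hence z: "poly_subst Const (\<lambda>j. Var (Some (e j))) P = 0" using no_c0 Ju[OF P(2)] by blast
        show "P = 0"
        proof (rule ccontr)
          assume "P \<noteq> 0"
          then obtain y where y: "peval y P \<noteq> 0" using exists_nonroot infinite_UNIV_char_0 by blast
          define w where "w = case_option 0 (\<lambda>i. y (inv_into {..<CARD('n)} e i))"
          have "peval y P = peval (\<lambda>j. w (Some (e j))) P"
          proof (rule peval_cong)
            fix j assume "j \<in> poly_vars P"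
            thus "y j = w (Some (e j))"
              using P(1) bij_betw_inv_into_left[OF e, of j] by (auto simp: w_def)
          qed
          also have "\<dots> = peval w (poly_subst Const (\<lambda>j. Var (Some (e j))) P)"
            by (simp add: peval_poly_subst_Const)
          finally show False using y z by simp
        qed
      qed
    qed
    moreover have "coord_ring_trdeg D = coord_ring_trdeg conormal" using DJ by (rule coord_ring_trdeg_cong)
    ultimately show "codimension D = 1" by (simp add: codimension_def)
  qed
  have "defining_polynomial F D" by (simp add: defining_polynomial_def DJ JF)
  moreover have "\<exists>k. k \<noteq> 0 \<and> G = Const k * flip_sign \<Phi>"
    if G: "optimal_value_polynomial X \<Phi>" "defining_polynomial G D" for \<Phi> G
  proof -
    have "{H. G dvd H} = {H. F dvd H}" using G(2) unfolding defining_polynomial_def DJ JF by simp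
    hence "F dvd G" "G dvd F" using dvd_refl by blast+
    then obtain k where k: "k \<noteq> 0" "G = Const k * F" using mpoly_associated[OF _ _ F(2)] by blast
    obtain q where q: "q \<noteq> 0" "F = Const q * flip_sign \<Phi>" using flipF[OF G(1)] by blast
    have "G = Const (k * q) * flip_sign \<Phi>" by (simp only: k(2) q(2) Const_mult mult.assoc)
    moreover have "k * q \<noteq> 0" using k(1) q(1) by simp
    ultimately show ?thesis by metis
  qed
  moreover have "algebraic_degree X = degree_in None G" if G: "irreducible G" "G \<in> vanishing_ideal D" for G
  proof -
    have "F dvd G" using G(2) unfolding DJ JF by simp
    then obtain Q where Q: "G = F * Q" by (elim dvdE)
    hence "Q dvd 1" using irreducibleD[OF G(1)] Fnu by blast
    then obtain R where R: "1 = Q * R" by (elim dvdE)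
    hence "F = G * R" unfolding Q by (simp add: mult.assoc)
    hence "G dvd F" by (rule dvdI)
    with \<open>F dvd G\<close> show ?thesis by (rule deg)
  qed
  ultimately show ?thesis
    using hypersurface optimal \<open>irreducible F\<close> F(1) DJ unfolding D_def Z_def by blast
qed

end
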